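(* Let $V:\mathbb{R}^d\to\mathbb{R}$ be twice continuously differentiable with $-\beta I\preceq\nabla^2V\preceq\beta I$, let $\gamma>0$, $q>1$, and let $\mathbf P_h$ be the OHO kernel with friction $\gamma$ and step size $h$. If $h\ll\frac{1}{\beta^{1/2}q^{1/2}}\wedge\frac1\gamma$, then for all $x_0,\bar x_0,p_0,\bar p_0\in\mathbb{R}^d$, $$\mathsf R_q(\delta_{(x_0,p_0)}\mathbf P_h\,\|\,\delta_{(\bar x_0,\bar p_0)}\mathbf P_h)\lesssim \frac{q\|\bar x_0-x_0\|^2}{\gamma h^3}+\frac{q\|\bar p_0-p_0\|^2}{\gamma h}+\beta^2dh^4q.$$ Moreover, if additionally $\|\nabla^2V(x)-\nabla^2V(y)\|_{\mathrm{op}}\le\beta_{\mathrm H_1}\|x-y\|$ for all $x,y$, then $$\mathsf R_q(\delta_{(x_0,p_0)}\mathbf P_h\,\|\,\delta_{(\bar x_0,\bar p_0)}\mathbf P_h)\lesssim q\|\bar x_0-x_0\|^2\Bigl(\frac1{\gamma h^3}+\beta_{\mathrm H_1}^2h^4d\Bigr)+\frac{q\|\bar p_0-p_0\|^2}{\gamma h},$$ and in particular, if also $h\lesssim\frac{1}{\beta_{\mathrm H_1}^{2/7}\gamma^{1/7}d^{1/7}}$, then $$\mathsf R_q(\delta_{(x_0,p_0)}\mathbf P_h\,\|\,\delta_{(\bar x_0,\bar p_0)}\mathbf P_h)\lesssim\frac{q\|x_0-\bar x_0\|^2}{\gamma h^3}+\frac{q\|\bar p_0-p_0\|^2}{\gamma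 h}.$$
   Context: Rényi divergence $\mathsf R_q(\mu\|\nu)=\frac1{q-1}\log\int(\mathrm d\mu/\mathrm d\nu)^q\,\mathrm d\nu$ (or $+\infty$ if $\mu\not\ll\nu$). Hamiltonian flow $\Phi_t(x,p)$: solution at time $t$ of $\dot x_t=p_t$, $\dot p_t=-\nabla V(x_t)$ from $(x,p)$. OHO kernel $\mathbf P_h$: from $(x,p)$, set $P^{\mathsf O}=e^{-\gamma h/2}p+\sqrt{1-e^{-\gamma h}}\,\xi_1$, $(x',\tilde p)=\Phi_h(x,P^{\mathsf O})$, $p'=e^{-\gamma h/2}\tilde p+\sqrt{1-e^{-\gamma h}}\,\xi_2$, with $\xi_1,\xi_2\sim\mathcal N(0,I_d)$ independent; output $(x',p')$. $a\lesssim b$ means $a\le Cb$ for an absolute constant $C$; hypothesis $h\ll b$ means $h\le cb$ for a sufficiently small absolute constant $c$. *)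

theory Defs
  imports "HOL-Probability.Probability"
begin

text \<open>
  The constants hidden in the asymptotic inequalities must not depend on the dimension, so the
  dimension has to be an ordinary variable, bound inside the scope of those constants, and not
  a type. A vector in the Euclidean space of dimension \<open>d\<close> is an extensional function on
  \<open>{..<d}\<close>. The type \<^typ>\<open>nat \<Rightarrow> real\<close> carries the product topology, which on
  such functions is the Euclidean topology.
\<close>

definition Rn :: "nat \<Rightarrow> (nat \<Rightarrow> real) set" where
  "Rn d = {..<d} \<rightarrow>\<^sub>E UNIV"

definition Rn_borel :: "nat \<Rightarrow> (nat \<Rightarrow> real) measure" where
  "Rn_borel d = (\<Pi>\<^sub>M i\<in>{..<d}. borel)"

definition enorm :: "nat \<Rightarrow> (nat \<Rightarrow> real) \<Rightarrow> real" where
  "enorm d x = L2_set x {..<d}"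

definition edist :: "nat \<Rightarrow> (nat \<Rightarrow> real) \<Rightarrow> (nat \<Rightarrow> real) \<Rightarrow> real" where
  "edist d x y = enorm d (\<lambda>i. x i - y i)"

definition partial :: "nat \<Rightarrow> ((nat \<Rightarrow> real) \<Rightarrow> real) \<Rightarrow> (nat \<Rightarrow> real) \<Rightarrow> real" where
  "partial i f x = deriv (\<lambda>t. f (x(i := t))) (x i)"

definition C1_on_Rn :: "nat \<Rightarrow> ((nat \<Rightarrow> real) \<Rightarrow> real) \<Rightarrow> bool" where
  "C1_on_Rn d f \<longleftrightarrow>
     (\<forall>i<d. (\<forall>x\<in>Rn d. (\<lambda>t. f (x(i := t))) differentiable (at (x i))) \<and>
            continuous_on (Rn d) (partial i f))"

definition C2_on_Rn :: "nat \<Rightarrow> ((nat \<Rightarrow> real) \<Rightarrow> real) \<Rightarrow> bool" where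
  "C2_on_Rn d f \<longleftrightarrow> C1_on_Rn d f \<and> (\<forall>i<d. C1_on_Rn d (partial i f))"

text \<open>Matrices of size \<open>d\<close> are functions of two indices, of which only the values at
  indices below \<open>d\<close> matter.\<close>

definition hessian :: "((nat \<Rightarrow> real) \<Rightarrow> real) \<Rightarrow> (nat \<Rightarrow> real) \<Rightarrow> nat \<Rightarrow> nat \<Rightarrow> real" where
  "hessian f x i j = partial i (partial j f) x"

definition scaled_id :: "real \<Rightarrow> nat \<Rightarrow> nat \<Rightarrow> real" where
  "scaled_id a i j = (if i = j then a else 0)"

definition mat_vec :: "nat \<Rightarrow> (nat \<Rightarrow> nat \<Rightarrow> real) \<Rightarrow> (nat \<Rightarrow> real) \<Rightarrow> nat \<Rightarrow> real" where
  "mat_vec d A v = (\<lambda>i\<in>{..<d}. \<Sum>j<d. A i j * v j)"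

definition loewner_le :: "nat \<Rightarrow> (nat \<Rightarrow> nat \<Rightarrow> real) \<Rightarrow> (nat \<Rightarrow> nat \<Rightarrow> real) \<Rightarrow> bool" where
  "loewner_le d A B \<longleftrightarrow>
     (\<forall>v\<in>Rn d. (\<Sum>i<d. v i * mat_vec d A v i) \<le> (\<Sum>i<d. v i * mat_vec d B v i))"

definition op_norm :: "nat \<Rightarrow> (nat \<Rightarrow> nat \<Rightarrow> real) \<Rightarrow> real" where
  "op_norm d A = (SUP v\<in>{v \<in> Rn d. enorm d v \<le> 1}. enorm d (mat_vec d A v))"

text \<open>Trajectories of the Hamiltonian ODE, on the whole real line (the gradient being
  globally Lipschitz below, solutions exist for all times and are unique).\<close>

definition ham_trajectory ::
  "nat \<Rightarrow> ((nat \<Rightarrow> real) \<Rightarrow> real) \<Rightarrow> (real \<Rightarrow> nat \<Rightarrow> real) \<Rightarrow> (real \<Rightarrow> nat \<Rightarrow> real) \<Rightarrow> bool" where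
  "ham_trajectory d V X P \<longleftrightarrow>
     (\<forall>t. X t \<in> Rn d \<and> P t \<in> Rn d \<and>
       (\<forall>i<d. ((\<lambda>s. X s i) has_real_derivative P t i) (at t) \<and>
              ((\<lambda>s. P s i) has_real_derivative - partial i V (X t)) (at t)))"

definition ham_flow ::
  "nat \<Rightarrow> ((nat \<Rightarrow> real) \<Rightarrow> real) \<Rightarrow> real \<Rightarrow>
   (nat \<Rightarrow> real) \<times> (nat \<Rightarrow> real) \<Rightarrow> (nat \<Rightarrow> real) \<times> (nat \<Rightarrow> real)" where
  "ham_flow d V t z =
     (THE w. \<exists>X P. ham_trajectory d V X P \<and> (X 0, P 0) = z \<and> (X t, P t) = w)"

definition std_gaussian :: "nat \<Rightarrow> (nat \<Rightarrow> real) measure" where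
  "std_gaussian d = (\<Pi>\<^sub>M i\<in>{..<d}. density lborel (\<lambda>x. ennreal (std_normal_density x)))"

definition O_step ::
  "nat \<Rightarrow> real \<Rightarrow> real \<Rightarrow> (nat \<Rightarrow> real) \<Rightarrow> (nat \<Rightarrow> real) \<Rightarrow> nat \<Rightarrow> real" where
  "O_step d \<gamma> h p \<xi> =
     (\<lambda>i\<in>{..<d}. exp (- \<gamma> * h / 2) * p i + sqrt (1 - exp (- \<gamma> * h)) * \<xi> i)"

definition OHO_update ::
  "nat \<Rightarrow> ((nat \<Rightarrow> real) \<Rightarrow> real) \<Rightarrow> real \<Rightarrow> real \<Rightarrow> (nat \<Rightarrow> real) \<times> (nat \<Rightarrow> real) \<Rightarrow>
   (nat \<Rightarrow> real) \<times> (nat \<Rightarrow> real) \<Rightarrow> (nat \<Rightarrow> real) \<times> (nat \<Rightarrow> real)" where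
  "OHO_update d V \<gamma> h = (\<lambda>(x, p) (\<xi>1, \<xi>2).
     let (x', p') = ham_flow d V h (x, O_step d \<gamma> h p \<xi>1)
     in (x', O_step d \<gamma> h p' \<xi>2))"

text \<open>\<open>OHO d V \<gamma> h z\<close> is the kernel started from the point mass at \<open>z = (x, p)\<close>.\<close>

definition OHO ::
  "nat \<Rightarrow> ((nat \<Rightarrow> real) \<Rightarrow> real) \<Rightarrow> real \<Rightarrow> real \<Rightarrow> (nat \<Rightarrow> real) \<times> (nat \<Rightarrow> real) \<Rightarrow>
   ((nat \<Rightarrow> real) \<times> (nat \<Rightarrow> real)) measure" where
  "OHO d V \<gamma> h z =
     distr (std_gaussian d \<Otimes>\<^sub>M std_gaussian d) (Rn_borel d \<Otimes>\<^sub>M Rn_borel d) (OHO_update d V \<gamma> h z)"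

text \<open>\<^term>\<open>RN_deriv \<nu> \<mu>\<close> is the density of \<open>\<mu>\<close> with respect to \<open>\<nu>\<close>,
  and \<^term>\<open>absolutely_continuous \<nu> \<mu>\<close> says that \<open>\<mu>\<close> is absolutely continuous
  with respect to \<open>\<nu>\<close>. The density is almost everywhere finite, so that
  \<^const>\<open>enn2real\<close> inside the integral is harmless; the integral itself may be infinite.\<close>

definition renyi_integral :: "real \<Rightarrow> 'a measure \<Rightarrow> 'a measure \<Rightarrow> ennreal" where
  "renyi_integral q \<mu> \<nu> = (\<integral>\<^sup>+ x. ennreal (enn2real (RN_deriv \<nu> \<mu> x) powr q) \<partial>\<nu>)"

definition renyi_div :: "real \<Rightarrow> 'a measure \<Rightarrow> 'a measure \<Rightarrow> ereal" where
  "renyi_div q \<mu> \<nu> =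
     (if absolutely_continuous \<nu> \<mu> \<and> renyi_integral q \<mu> \<nu> \<noteq> \<infinity>
      then ereal (1 / (q - 1) * ln (enn2real (renyi_integral q \<mu> \<nu>)))
      else \<infinity>)"

end

theory Submission
  imports Defs
begin

text \<open>
  Let \<open>R\<close> map a momentum \<open>p\<close> to the momentum with which a trajectory from \<open>x0'\<close> reaches, at time
  \<open>h\<close>, the endpoint of the trajectory from \<open>(x0, p)\<close>. Replacing the first noise by the one that produces
  \<open>R p\<close>, and correcting the final momentum with the second noise, turns one step of the kernel from
  \<open>(x0, p0)\<close> into one step from \<open>(x0', p0')\<close>. Hence both kernels are images, under the same map, of the
  standard Gaussian and of its image under \<open>(x, y) \<mapsto> (x + v x, y + u x)\<close>, where \<open>v\<close> and \<open>u\<close> are bounded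
  by multiples of the initial distances and the Lipschitz constant \<open>L\<close> of \<open>v\<close> is \<open>O(\<beta> h\<^sup>2)\<close>, and
  \<open>O(\<beta>H h\<^sup>2 \<bar>x0 - x0'\<bar>)\<close> when the Hessian is Lipschitz.

  The density of the image measure is controlled by a change of variables carried out one coordinate at a
  time: the Jacobian of \<open>x + v x\<close> is at least \<open>exp (div v - 7 d L\<^sup>2)\<close>, and no determinant is needed. The
  divergence of \<open>v\<close> cancels against that of \<open>- (q - 1) v\<close>, to which the same bound is applied in order to
  estimate the \<open>q\<close>-th moment of the density.

  The dimension is a variable, so that \<open>d\<close>-dimensional vectors are embedded into the single Hilbert space
  \<open>l2\<close>, where the library of analysis is available.
\<close>

section \<open>Second-order differential equations with Lipschitz forces\<close>

text \<open>The obstacle is that no formula is at hand for the Jacobian of the shift or for the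
  density of the perturbed Gaussian: what is established about \<open>retarget\<close> is Lipschitz
  dependence on the momentum and convergence of difference quotients along the steps 1/n. Changes of
  variables are therefore one-sided inequalities. That is enough: by Young's inequality the moment
  of the density is at most a fraction of itself plus a moment of the inverse weight, and the
  fraction is absorbed. The cancellation of the divergence decides the dependence on the dimension.
  Bounded directly, the divergence would cost d L; once it has cancelled, only squares remain, and d
  L^2 gives \<beta>^2 d h^4. The Lipschitz constant of the shift can shrink with the initial
  distance because two paired trajectories differ by x0' - x0 at time 0 and by 0 at time h, whatever
  the momentum. Changing the momentum moves this displacement only through the variation of the
  Hessian along it.\<close>

definition cum_integral :: "(real \<Rightarrow> 'a::banach) \<Rightarrow> real \<Rightarrow> 'a" where
  "cum_integral f t = integral {0..t} f - integral {t..0} f"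

lemma cum_integral_0 [simp]: "cum_integral f 0 = 0"
  by (simp add: cum_integral_def)

text \<open>Near \<open>t\<close> the signed integral from 0 differs by a constant from the integral
  with fixed lower end \<open>-M\<close>, whose derivative is standard.\<close>

lemma cum_integral_has_vector_derivative:
  fixes f :: "real \<Rightarrow> 'a::banach"
  assumes "continuous_on UNIV f"
  shows "(cum_integral f has_vector_derivative f t) (at t)"
proof -
  define M where "M = \<bar>t\<bar> + 1"
  have cont: "continuous_on S f" for S
    using assms continuous_on_subset by blast
  have int: "f integrable_on {a..b}" for a b :: real
    by (intro integrable_continuous_real cont)
  have eq: "cum_integral f s = integral {-M..s} f - integral {-M..0} f" if "s \<in> {-M<..<M}" for s
  proof (cases "0 \<le> s")
    case True
    then have "integral {-M..0} f + integral {0..s} f = integral {-M..s} f"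
      by (intro Henstock_Kurzweil_Integration.integral_combine int) (auto simp: M_def)
    moreover have "integral {s..0} f = 0"
      using True by (cases "s = 0") auto
    ultimately show ?thesis by (simp add: cum_integral_def algebra_simps)
  next
    case False
    then have "integral {-M..s} f + integral {s..0} f = integral {-M..0} f"
      using that by (intro Henstock_Kurzweil_Integration.integral_combine int) auto
    then show ?thesis using False by (simp add: cum_integral_def algebra_simps)
  qed
  have tM: "t \<in> {-M<..<M}" by (auto simp: M_def)
  have "((\<lambda>s. integral {-M..s} f) has_vector_derivative f t) (at t within {-M..M})"
    using tM by (intro integral_has_vector_derivative cont) auto
  then have "((\<lambda>s. integral {-M..s} f) has_vector_derivative f t) (at t)"
    using tM at_within_Icc_at[of "- M" t M] by simp
  then have "((\<lambda>s. integral {-M..s} f - integral {-M..0} f) has_vector_derivative f t) (at t)"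
    by (auto intro!: derivative_eq_intros)
  then show ?thesis
    by (rule has_vector_derivative_transform_within_open[OF _ _ tM]) (use eq in auto)
qed

text \<open>Integration against the weight exp (l |t|) gains a factor 1 / l, so a large
  \<open>l\<close> makes the Picard operator contracting on the whole line at once. Negative times
  are reflected to positive ones.\<close>

lemma norm_le_exp_of_derivative_bound:
  fixes F :: "real \<Rightarrow> 'a::real_normed_vector"
  assumes der: "\<And>t. (F has_vector_derivative f t) (at t)" and "F 0 = 0"
    and bnd: "\<And>t. norm (f t) \<le> C * exp (l * \<bar>t\<bar>)" and "0 < l"
  shows "norm (F t) \<le> C / l * exp (l * \<bar>t\<bar>)"
proof -
  have C: "0 \<le> C"
    using order_trans[OF norm_ge_zero bnd[of 0]] by simp
  have pos: "norm (G s) \<le> C / l * exp (l * s)"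
    if G: "\<And>t. (G has_vector_derivative g t) (at t)" and "G 0 = 0"
      and b: "\<And>t. norm (g t) \<le> C * exp (l * \<bar>t\<bar>)" and "0 < s" for G :: "real \<Rightarrow> 'a" and g s
  proof -
    have "norm (G s - G 0) \<le> C / l * exp (l * s) - C / l * exp (l * 0)"
    proof (rule differentiable_bound_general[OF \<open>0 < s\<close>, where f' = g and \<phi>' = "\<lambda>t. C * exp (l * t)"])
      show "continuous_on {0..s} G"
        using G by (meson continuous_at_imp_continuous_on has_vector_derivative_continuous)
      show "((\<lambda>t. C / l * exp (l * t)) has_vector_derivative C * exp (l * x)) (at x)" for x
        using \<open>0 < l\<close> unfolding has_real_derivative_iff_has_vector_derivative[symmetric]
        by (auto intro!: derivative_eq_intros)
      show "norm (g x) \<le> C * exp (l * x)" if "0 < x" for x using b[of x] that by simp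
      show "continuous_on {0..s} (\<lambda>t. C / l * exp (l * t))" by (intro continuous_intros)
    qed (use G in auto)
    moreover have "0 \<le> C / l" using C \<open>0 < l\<close> by simp
    ultimately show ?thesis using \<open>G 0 = 0\<close> by simp
  qed
  consider "t = 0" | "0 < t" | "t < 0" by linarith
  then show ?thesis
  proof cases
    case 1 then show ?thesis using C assms by simp
  next
    case 2 then show ?thesis using pos[OF der \<open>F 0 = 0\<close> bnd] by simp
  next
    case 3
    have "((\<lambda>t. F (- t)) has_vector_derivative - f (- t)) (at t)" for t
    proof -
      have "((F \<circ> uminus) has_vector_derivative (- 1) *\<^sub>R f (- t)) (at t)"
        by (rule vector_diff_chain_at) (auto intro!: derivative_eq_intros der)
      then show ?thesis by (simp add: o_def)
    qed
    from pos[OF this, of "- t"] show ?thesis using assms(2) bnd[of "- _"] 3 by simp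
  qed
qed

lemma lipschitz_continuous_on:
  fixes f :: "'a::real_normed_vector \<Rightarrow> 'b::real_normed_vector"
  assumes "\<And>x y. norm (f x - f y) \<le> L * norm (x - y)"
  shows "continuous_on S f"
proof (rule lipschitz_on_continuous_on)
  show "(\<bar>L\<bar>)-lipschitz_on S f"
  proof (rule lipschitz_onI)
    show "dist (f x) (f y) \<le> \<bar>L\<bar> * dist x y" for x y
      using assms[of x y] mult_right_mono[OF abs_ge_self[of L], of "norm (x - y)"]
      by (simp add: dist_norm)
  qed simp
qed

text \<open>Picard's theorem in an exponentially weighted sup norm. The unknown is Y t = exp (- l
  |t|) (z t - z0), a bounded continuous function, so a single fixed point is already a global
  solution and nothing has to be continued.\<close>

lemma lipschitz_ode_exists:
  fixes f :: "'a::banach \<Rightarrow> 'a"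
  assumes lip: "\<And>x y. norm (f x - f y) \<le> L * norm (x - y)"
  shows "\<exists>z. z 0 = z0 \<and> (\<forall>t. (z has_vector_derivative f (z t)) (at t))"
proof -
  define K where "K = \<bar>L\<bar> + 1"
  \<comment> \<open>The contraction factor is K / l, hence 1/2; \<open>K\<close> is positive even if
    \<open>L\<close> is not.\<close>
  define l where "l = 2 * K"
  have K: "0 < K" "0 < l" by (auto simp: K_def l_def)
  have lipK: "norm (f x - f y) \<le> K * norm (x - y)" for x y
    using lip[of x y] mult_right_mono[of L K "norm (x - y)"] abs_ge_self[of L] by (simp add: K_def)
  have contf: "continuous_on S f" for S
    using lipschitz_continuous_on[OF lip] .
  define z where "z Y s = z0 + exp (l * \<bar>s\<bar>) *\<^sub>R apply_bcontfun Y s" for Y :: "real \<Rightarrow>\<^sub>C 'a" and s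
  have contz: "continuous_on UNIV (\<lambda>s. f (z Y s))" for Y
    unfolding z_def by (intro continuous_on_compose2[OF contf[of UNIV]] continuous_intros) auto
  define \<Phi> where "\<Phi> Y t = exp (- l * \<bar>t\<bar>) *\<^sub>R cum_integral (\<lambda>s. f (z Y s)) t" for Y t
  note cder = cum_integral_has_vector_derivative[OF contz]
  have \<Phi>_bcont: "\<Phi> Y \<in> bcontfun" for Y
  proof (rule bcontfun_normI)
    show "continuous_on UNIV (\<Phi> Y)"
      unfolding \<Phi>_def using cder
      by (intro continuous_intros) (meson continuous_at_imp_continuous_on has_vector_derivative_continuous)
    fix t
    have "norm (cum_integral (\<lambda>s. f (z Y s)) t) \<le> (norm (f z0) + K * norm Y) / l * exp (l * \<bar>t\<bar>)"
    proof (rule norm_le_exp_of_derivative_bound[OF cder])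
      fix s
      have "norm (f (z Y s)) \<le> norm (f z0) + norm (f (z Y s) - f z0)"
        by (metis norm_triangle_sub)
      also have "norm (f (z Y s) - f z0) \<le> K * (exp (l * \<bar>s\<bar>) * norm Y)"
        using lipK[of "z Y s" z0] K norm_bounded[of Y s]
        by (auto simp: z_def intro: order_trans)
      also have "norm (f z0) \<le> norm (f z0) * exp (l * \<bar>s\<bar>)"
        using K by (simp add: mult_le_cancel_left1)
      finally show "norm (f (z Y s)) \<le> (norm (f z0) + K * norm Y) * exp (l * \<bar>s\<bar>)"
        by (simp add: algebra_simps)
    qed (use K in auto)
    then show "norm (\<Phi> Y t) \<le> (norm (f z0) + K * norm Y) / l"
      by (simp add: \<Phi>_def exp_minus field_simps)
  qed
  have "\<exists>!Y. Bcontfun (\<Phi> Y) = Y"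
  proof (rule banach_fix_type[where c = "1/2"], simp, simp, intro allI)
    fix Y Y' :: "real \<Rightarrow>\<^sub>C 'a"
    show "dist (Bcontfun (\<Phi> Y)) (Bcontfun (\<Phi> Y')) \<le> 1/2 * dist Y Y'"
    proof (rule dist_bound)
      fix t
      have "norm (cum_integral (\<lambda>s. f (z Y s)) t - cum_integral (\<lambda>s. f (z Y' s)) t)
          \<le> (K * dist Y Y') / l * exp (l * \<bar>t\<bar>)"
      proof (rule norm_le_exp_of_derivative_bound[where f = "\<lambda>t. f (z Y t) - f (z Y' t)"])
        show "((\<lambda>t. cum_integral (\<lambda>s. f (z Y s)) t - cum_integral (\<lambda>s. f (z Y' s)) t)
            has_vector_derivative f (z Y t) - f (z Y' t)) (at t)" for t
          by (intro derivative_intros cder)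
        fix s
        have "norm (z Y s - z Y' s) = exp (l * \<bar>s\<bar>) * dist (apply_bcontfun Y s) (apply_bcontfun Y' s)"
          by (simp add: z_def dist_norm flip: scaleR_diff_right)
        also have "\<dots> \<le> exp (l * \<bar>s\<bar>) * dist Y Y'"
          using dist_bounded[of Y s Y'] by simp
        finally show "norm (f (z Y s) - f (z Y' s)) \<le> K * dist Y Y' * exp (l * \<bar>s\<bar>)"
          using lipK[of "z Y s" "z Y' s"] K by (auto simp: mult_ac intro: order_trans mult_left_mono)
      qed (use K in auto)
      moreover have "K * dist Y Y' / l = 1/2 * dist Y Y'" using K by (simp add: l_def)
      ultimately have "norm (cum_integral (\<lambda>s. f (z Y s)) t - cum_integral (\<lambda>s. f (z Y' s)) t)
          \<le> 1/2 * dist Y Y' * exp (l * \<bar>t\<bar>)" by simp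
      then show "dist (apply_bcontfun (Bcontfun (\<Phi> Y)) t) (apply_bcontfun (Bcontfun (\<Phi> Y')) t) \<le> 1/2 * dist Y Y'"
        (is "?d \<le> _")
      proof -
        assume le: "norm (cum_integral (\<lambda>s. f (z Y s)) t - cum_integral (\<lambda>s. f (z Y' s)) t)
          \<le> 1/2 * dist Y Y' * exp (l * \<bar>t\<bar>)"
        have "?d = exp (- l * \<bar>t\<bar>) * norm (cum_integral (\<lambda>s. f (z Y s)) t - cum_integral (\<lambda>s. f (z Y' s)) t)"
          unfolding Bcontfun_inverse[OF \<Phi>_bcont] dist_norm \<Phi>_def scaleR_diff_right[symmetric] by simp
        also have "\<dots> \<le> exp (- l * \<bar>t\<bar>) * (1/2 * dist Y Y' * exp (l * \<bar>t\<bar>))"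
          by (rule mult_left_mono[OF le]) simp
        also have "\<dots> = 1/2 * dist Y Y' * (exp (- l * \<bar>t\<bar>) * exp (l * \<bar>t\<bar>))" by (simp only: mult_ac)
        also have "exp (- l * \<bar>t\<bar>) * exp (l * \<bar>t\<bar>) = 1" by (simp flip: exp_add)
        finally show ?thesis by simp
      qed
    qed
  qed
  then obtain Y where "Bcontfun (\<Phi> Y) = Y" by blast
  then have Y: "apply_bcontfun Y t = \<Phi> Y t" for t
    by (metis Bcontfun_inverse[OF \<Phi>_bcont])
  have zt: "z Y t = z0 + cum_integral (\<lambda>s. f (z Y s)) t" for t
    unfolding z_def[of Y t] Y \<Phi>_def[of Y t] by (simp add: exp_minus)
  have "(z Y has_vector_derivative f (z Y t)) (at t)" for t
  proof -
    have "((\<lambda>t. z0 + cum_integral (\<lambda>s. f (z Y s)) t) has_vector_derivative 0 + f (z Y t)) (at t)"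
      by (intro derivative_intros cder)
    then show ?thesis by (simp add: zt[symmetric])
  qed
  moreover have "z Y 0 = z0" using zt[of 0] by simp
  ultimately show ?thesis by blast
qed

definition newton :: "('a::real_normed_vector \<Rightarrow> 'a) \<Rightarrow> (real \<Rightarrow> 'a) \<Rightarrow> (real \<Rightarrow> 'a) \<Rightarrow> bool" where
  "newton g X P \<longleftrightarrow> (\<forall>t. (X has_vector_derivative P t) (at t) \<and> (P has_vector_derivative - g (X t)) (at t))"

lemma newton_exists:
  fixes g :: "'a::banach \<Rightarrow> 'a"
  assumes lip: "\<And>x y. norm (g x - g y) \<le> \<beta> * norm (x - y)"
  shows "\<exists>X P. newton g X P \<and> X 0 = x \<and> P 0 = p"
proof -
  define f where "f z = (snd z, - g (fst z))" for z :: "'a \<times> 'a"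
  have fs: "norm (fst u) \<le> norm u" "norm (snd u) \<le> norm u" for u :: "'a \<times> 'a"
    by (cases u, simp add: norm_fst_le norm_snd_le)+
  have "norm (f z - f w) \<le> (1 + \<bar>\<beta>\<bar>) * norm (z - w)" for z w
  proof -
    have "norm (f z - f w) \<le> norm (snd z - snd w) + norm (- g (fst z) + g (fst w))"
      unfolding f_def by (simp add: norm_Pair_le)
    also have "norm (- g (fst z) + g (fst w)) = norm (g (fst z) - g (fst w))"
      by (simp add: norm_minus_commute)
    also have "\<dots> \<le> \<bar>\<beta>\<bar> * norm (fst z - fst w)"
      using lip[of "fst z" "fst w"] mult_right_mono[OF abs_ge_self[of \<beta>] norm_ge_zero[of "fst z - fst w"]]
      by linarith
    also have "\<bar>\<beta>\<bar> * norm (fst z - fst w) \<le> \<bar>\<beta>\<bar> * norm (z - w)"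
      using fs(1)[of "z - w"] by (intro mult_left_mono) simp_all
    also have "norm (snd z - snd w) \<le> norm (z - w)"
      using fs(2)[of "z - w"] by simp
    finally show ?thesis by (simp add: algebra_simps)
  qed
  from lipschitz_ode_exists[OF this, of "(x, p)"] obtain z where
    z: "z 0 = (x, p)" "\<And>t. (z has_vector_derivative f (z t)) (at t)" by blast
  have "newton g (\<lambda>t. fst (z t)) (\<lambda>t. snd (z t))"
    unfolding newton_def
  proof (intro allI conjI)
    fix t
    show "((\<lambda>t. fst (z t)) has_vector_derivative snd (z t)) (at t)"
      using bounded_linear.has_vector_derivative[OF bounded_linear_fst z(2)[of t]] by (simp add: f_def)
    show "((\<lambda>t. snd (z t)) has_vector_derivative - g (fst (z t))) (at t)"
      using bounded_linear.has_vector_derivative[OF bounded_linear_snd z(2)[of t]] by (simp add: f_def)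
  qed
  then show ?thesis using z(1)
    by (intro exI[of _ "\<lambda>t. fst (z t)"] exI[of _ "\<lambda>t. snd (z t)"]) auto
qed

text \<open>Serves twice: for trajectories, and for a potential restricted to a segment.\<close>

lemma second_order_taylor:
  fixes X P :: "real \<Rightarrow> 'a::real_normed_vector"
  assumes X: "\<And>t. (X has_vector_derivative P t) (at t)"
    and P: "\<And>t. (P has_vector_derivative A t) (at t)"
    and A: "\<And>t. t \<in> {0..h} \<Longrightarrow> norm (A t) \<le> B" and t: "t \<in> {0..h}"
  shows "norm (P t - P 0) \<le> B * t" "norm (X t - X 0 - t *\<^sub>R P 0) \<le> B * t\<^sup>2 / 2"
proof -
  have cP: "continuous_on S P" and cX: "continuous_on S X" for S
    using X P by (meson continuous_at_imp_continuous_on has_vector_derivative_continuous)+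
  have 1: "norm (P t - P 0) \<le> B * t" if t: "t \<in> {0..h}" for t
  proof (cases "t = 0")
    case False
    then have "0 < t" using t by simp
    have "norm (P t - P 0) \<le> B * t - B * 0"
    proof (rule differentiable_bound_general[OF \<open>0 < t\<close> cP, where f' = A and \<phi>' = "\<lambda>t. B"])
      show "(P has_vector_derivative A x) (at x)" for x using P .
      show "((\<lambda>t. B * t) has_vector_derivative B) (at x)" for x
        unfolding has_real_derivative_iff_has_vector_derivative[symmetric]
        by (auto intro!: derivative_eq_intros)
      show "norm (A x) \<le> B" if "0 < x" "x < t" for x using A[of x] t that by simp
    qed (auto intro!: continuous_intros)
    then show ?thesis by simp
  qed simp
  show "norm (P t - P 0) \<le> B * t" by (rule 1[OF t])
  show "norm (X t - X 0 - t *\<^sub>R P 0) \<le> B * t\<^sup>2 / 2"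
  proof (cases "t = 0")
    case False
    then have "0 < t" using t by simp
    have "norm ((X t - X 0 - t *\<^sub>R P 0) - (X 0 - X 0 - 0 *\<^sub>R P 0)) \<le> B * t\<^sup>2 / 2 - B * 0\<^sup>2 / 2"
    proof (rule differentiable_bound_general[OF \<open>0 < t\<close>, where f' = "\<lambda>t. P t - P 0" and \<phi>' = "\<lambda>t. B * t"])
      show "((\<lambda>t. X t - X 0 - t *\<^sub>R P 0) has_vector_derivative P x - P 0) (at x)" for x
        using X[of x] by (auto intro!: derivative_eq_intros)
      show "((\<lambda>t. B * t\<^sup>2 / 2) has_vector_derivative B * x) (at x)" for x
        unfolding has_real_derivative_iff_has_vector_derivative[symmetric]
        by (auto intro!: derivative_eq_intros)
      show "norm (P x - P 0) \<le> B * x" if "0 < x" "x < t" for x using 1[of x] t that by simp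
    qed (auto intro!: continuous_intros cX)
    then show ?thesis by simp
  qed simp
qed

section \<open>A priori estimates on a short time interval\<close>

locale short_time =
  fixes \<beta> h :: real
  assumes beta_nonneg: "0 \<le> \<beta>" and h_pos: "0 < h" and short: "\<beta> * h\<^sup>2 \<le> 1 / 8"
begin

text \<open>\<open>X\<close> is going to be a difference of two trajectories, or a difference of two
  such differences, with \<open>\<eta>\<close> measuring the failure of the force to be linear. With
  M the maximum of the norm on the interval, \<open>X\<close> deviates from its initial tangent by
  at most (\<beta> h^2 M + \<eta> h^2) / 2, and the first term is absorbed because
  \<open>\<beta> * h\<^sup>2\<close> is at most 1/8. The same inequality is solved once for given
  initial data and once for given endpoints.\<close>

lemma perturbed_bounds:
  fixes X P :: "real \<Rightarrow> 'a::real_normed_vector"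
  assumes X: "\<And>t. (X has_vector_derivative P t) (at t)"
    and P: "\<And>t. (P has_vector_derivative A t) (at t)"
    and A: "\<And>t. t \<in> {0..h} \<Longrightarrow> norm (A t) \<le> \<beta> * norm (X t) + \<eta>" and "0 \<le> \<eta>"
  shows ivp_bound: "\<And>t. t \<in> {0..h} \<Longrightarrow> norm (X t) \<le> 2 * (norm (X 0) + h * norm (P 0)) + \<eta> * h\<^sup>2"
    and ivp_endpoint: "norm (X h - X 0 - h *\<^sub>R P 0) \<le> \<beta> * h\<^sup>2 * (norm (X 0) + h * norm (P 0)) + \<eta> * h\<^sup>2"
    and bvp_bound: "\<And>t. t \<in> {0..h} \<Longrightarrow> norm (X t) \<le> 3 * norm (X 0) + 2 * norm (X h) + 2 * \<eta> * h\<^sup>2"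
    and bvp_initial_speed: "h * norm (P 0) \<le> 2 * norm (X 0) + 2 * norm (X h) + \<eta> * h\<^sup>2"
    and bvp_final_speed: "h * norm (P h) \<le> 3 * norm (X 0) + 3 * norm (X h) + 3 * \<eta> * h\<^sup>2"
proof -
  have "continuous_on {0..h} (\<lambda>t. norm (X t))"
    using X by (intro continuous_on_norm) (meson continuous_at_imp_continuous_on has_vector_derivative_continuous)
  moreover have "compact {0..h}" "{0..h} \<noteq> {}" using h_pos by auto
  ultimately obtain s where s: "s \<in> {0..h}" "\<And>t. t \<in> {0..h} \<Longrightarrow> norm (X t) \<le> norm (X s)"
    using continuous_attains_sup[of "{0..h}" "\<lambda>t. norm (X t)"] by blast
  define M where "M = norm (X s)"
  have M: "0 \<le> M" "\<And>t. t \<in> {0..h} \<Longrightarrow> norm (X t) \<le> M" using s by (auto simp: M_def)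
  define k where "k = \<beta> * h\<^sup>2"
  have k: "0 \<le> k" "k \<le> 1/8" using short beta_nonneg by (auto simp: k_def)
  have AB: "norm (A t) \<le> \<beta> * M + \<eta>" if "t \<in> {0..h}" for t
    using A[OF that] mult_left_mono[OF M(2)[OF that] beta_nonneg] by simp
  have T: "norm (P t - P 0) \<le> (\<beta> * M + \<eta>) * t" "norm (X t - X 0 - t *\<^sub>R P 0) \<le> (\<beta> * M + \<eta>) * t\<^sup>2 / 2"
    if "t \<in> {0..h}" for t
    using second_order_taylor[of X P A h "\<beta> * M + \<eta>" t, OF X P AB that] by auto
  have B: "0 \<le> \<beta> * M + \<eta>" using M beta_nonneg \<open>0 \<le> \<eta>\<close> by simp
  have T2: "norm (X t - X 0 - t *\<^sub>R P 0) \<le> k * M / 2 + \<eta> * h\<^sup>2 / 2" if t: "t \<in> {0..h}" for t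
  proof -
    have "t\<^sup>2 \<le> h\<^sup>2" using t by (intro power_mono) auto
    from mult_left_mono[OF this B] show ?thesis
      using T(2)[OF t] by (simp add: k_def algebra_simps add_divide_distrib)
  qed
  have kM: "k * M \<le> 1/8 * M" by (rule mult_right_mono) (use k M in auto)
  have h2: "0 \<le> \<eta> * h\<^sup>2" using \<open>0 \<le> \<eta>\<close> by simp
  have "M \<le> norm (X 0 + s *\<^sub>R P 0) + norm (X s - X 0 - s *\<^sub>R P 0)"
    unfolding M_def using norm_triangle_sub[of "X s" "X 0 + s *\<^sub>R P 0"] by (simp add: algebra_simps)
  also have "norm (X 0 + s *\<^sub>R P 0) \<le> norm (X 0) + h * norm (P 0)"
    using s(1) by (intro order_trans[OF norm_triangle_ineq] add_left_mono) (auto intro: mult_right_mono)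
  finally have M1: "M \<le> norm (X 0) + h * norm (P 0) + k * M / 2 + \<eta> * h\<^sup>2 / 2"
    using T2[OF s(1)] by linarith
  \<comment> \<open>Absorption leaves 15/16 m on the left; the constants are then rounded
    up.\<close>
  have "m \<le> 2 * a + e" if "m \<le> a + c / 2 + e / 2" "c \<le> 1/8 * m" "0 \<le> a" "0 \<le> e" for m a c e :: real
    using that by linarith
  from this[OF M1 kM _ h2] have M1': "M \<le> 2 * (norm (X 0) + h * norm (P 0)) + \<eta> * h\<^sup>2"
    using h_pos by simp
  show "norm (X t) \<le> 2 * (norm (X 0) + h * norm (P 0)) + \<eta> * h\<^sup>2" if "t \<in> {0..h}" for t
    using M(2)[OF that] M1' by linarith
  have "k * M \<le> k * (2 * (norm (X 0) + h * norm (P 0)) + \<eta> * h\<^sup>2)"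
    by (rule mult_left_mono[OF M1' k(1)])
  also have "\<dots> = 2 * (k * (norm (X 0) + h * norm (P 0))) + k * (\<eta> * h\<^sup>2)" by (simp add: algebra_simps)
  also have "k * (\<eta> * h\<^sup>2) \<le> 1 * (\<eta> * h\<^sup>2)" using k h2 by (intro mult_right_mono) auto
  finally show "norm (X h - X 0 - h *\<^sub>R P 0) \<le> \<beta> * h\<^sup>2 * (norm (X 0) + h * norm (P 0)) + \<eta> * h\<^sup>2"
    using T2[of h] h_pos unfolding k_def[symmetric] by simp
  have "h * norm (P 0) = norm (h *\<^sub>R P 0)" using h_pos by simp
  also have "\<dots> \<le> norm (X h - X 0) + norm (X h - X 0 - h *\<^sub>R P 0)"
    by (metis norm_triangle_sub norm_minus_commute)
  also have "norm (X h - X 0) \<le> norm (X h) + norm (X 0)" by (rule norm_triangle_ineq4)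
  finally have S: "h * norm (P 0) \<le> norm (X h) + norm (X 0) + k * M / 2 + \<eta> * h\<^sup>2 / 2"
    using T2[of h] h_pos by simp
  \<comment> \<open>Substituting the bound for the speed \<open>s\<close> into that for the maximum
    \<open>m\<close> leaves m \<le> 2 b + d + c + e, and \<open>c\<close> is at most m / 8.\<close>
  have arith: "m \<le> 8/7 * (2 * b + d + e)"
    if "s \<le> d + b + c / 2 + e / 2" "m \<le> b + s + c / 2 + e / 2" "c \<le> 1/8 * m" for m s b c d e :: real
    using that by (simp add: field_simps)
  have M2: "M \<le> 8/7 * (2 * norm (X 0) + norm (X h) + \<eta> * h\<^sup>2)"
    using arith[OF S M1 kM] .
  have arith2: "m \<le> 3 * b + 2 * d + 2 * e" "s \<le> 2 * b + 2 * d + e" "s + c + e \<le> 3 * b + 3 * d + 3 * e"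
    if "m \<le> 8/7 * (2 * b + d + e)" "s \<le> d + b + c / 2 + e / 2" "c \<le> 1/8 * m" "0 \<le> b" "0 \<le> d" "0 \<le> e"
    for m s b c d e :: real
    using that by (simp_all add: field_simps)
  note bounds = arith2[OF M2 S kM norm_ge_zero norm_ge_zero h2]
  show "norm (X t) \<le> 3 * norm (X 0) + 2 * norm (X h) + 2 * \<eta> * h\<^sup>2" if "t \<in> {0..h}" for t
    using M(2)[OF that] bounds(1) by simp
  show "h * norm (P 0) \<le> 2 * norm (X 0) + 2 * norm (X h) + \<eta> * h\<^sup>2"
    by (rule bounds(2))
  have "h * norm (P h) \<le> h * (norm (P 0) + norm (P h - P 0))"
    by (rule mult_left_mono) (use h_pos norm_triangle_sub in auto)
  also have "\<dots> \<le> h * norm (P 0) + h * ((\<beta> * M + \<eta>) * h)"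
    using T(1)[of h] h_pos by (simp add: distrib_left)
  also have "h * ((\<beta> * M + \<eta>) * h) = k * M + \<eta> * h\<^sup>2"
    by (simp add: k_def algebra_simps power2_eq_square)
  finally show "h * norm (P h) \<le> 3 * norm (X 0) + 3 * norm (X h) + 3 * \<eta> * h\<^sup>2"
    using bounds(3) by simp
qed

end

section \<open>The flow, the shooting problem and the map between initial momenta\<close>

locale newton_flow = short_time \<beta> h for \<beta> h :: real +
  fixes g :: "'a::banach \<Rightarrow> 'a"
  assumes lip: "\<And>x y. norm (g x - g y) \<le> \<beta> * norm (x - y)"
begin

text \<open>An arbitrary trajectory is chosen; its state at time \<open>h\<close>, which is all that
  the kernel sees, is shown in \<open>newton_unique\<close> to be independent of the choice.\<close>

definition flow :: "'a \<Rightarrow> 'a \<Rightarrow> real \<Rightarrow> 'a \<times> 'a" where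
  "flow x p = (SOME Z. newton g (\<lambda>t. fst (Z t)) (\<lambda>t. snd (Z t)) \<and> Z 0 = (x, p))"

definition pos :: "'a \<Rightarrow> 'a \<Rightarrow> real \<Rightarrow> 'a" where
  "pos x p t = fst (flow x p t)"

definition mom :: "'a \<Rightarrow> 'a \<Rightarrow> real \<Rightarrow> 'a" where
  "mom x p t = snd (flow x p t)"

lemma newton_flow: "newton g (pos x p) (mom x p)"
  and pos_0 [simp]: "pos x p 0 = x" and mom_0 [simp]: "mom x p 0 = p"
proof -
  obtain X P where "newton g X P" "X 0 = x" "P 0 = p"
    using newton_exists[of g \<beta> x p, OF lip] by blast
  then have "\<exists>Z. newton g (\<lambda>t. fst (Z t)) (\<lambda>t. snd (Z t)) \<and> Z 0 = (x, p)"
    by (intro exI[of _ "\<lambda>t. (X t, P t)"]) simp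
  from someI_ex[OF this] show "newton g (pos x p) (mom x p)" "pos x p 0 = x" "mom x p 0 = p"
    unfolding flow_def[symmetric] pos_def[abs_def] mom_def[abs_def] by auto
qed

lemma pos_deriv: "(pos x p has_vector_derivative mom x p t) (at t)"
  and mom_deriv: "(mom x p has_vector_derivative - g (pos x p t)) (at t)"
  using newton_flow[of x p] by (auto simp: newton_def)

text \<open>The summand 0 is the value of \<open>\<eta>\<close> in \<open>perturbed_bounds\<close>
  for a difference of two exact trajectories.\<close>

lemma force_difference: "norm (- g x - (- g y)) \<le> \<beta> * norm (x - y) + 0"
  using lip[of x y] by (simp add: norm_minus_commute)

lemma newton_difference:
  assumes "newton g X P" "newton g X' P'"
  shows "((\<lambda>t. X t - X' t) has_vector_derivative P t - P' t) (at t)"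
    and "((\<lambda>t. P t - P' t) has_vector_derivative - g (X t) - (- g (X' t))) (at t)"
  using assms unfolding newton_def by (blast intro: has_vector_derivative_diff)+

text \<open>The difference of the two solutions has zero initial data, so its position vanishes at
  time \<open>h\<close>; with both endpoints zero, the boundary-value bound makes the final momentum
  vanish as well.\<close>

lemma newton_unique:
  assumes N: "newton g X P" "newton g X' P'" and "X 0 = X' 0" "P 0 = P' 0"
  shows "X h = X' h" "P h = P' h"
proof -
  note D = newton_difference[OF N]
  have X: "norm (X h - X' h) \<le> 0"
    using ivp_bound[of "\<lambda>t. X t - X' t", OF D force_difference, of h] h_pos assms by simp
  have "h * norm (P h - P' h) \<le> 0"
    using bvp_final_speed[of "\<lambda>t. X t - X' t", OF D force_difference] assms X by simp
  with X show "X h = X' h" "P h = P' h" using h_pos by (auto simp: mult_le_0_iff)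
qed

lemma newton_eq_flow:
  assumes "newton g X P"
  shows "X h = pos (X 0) (P 0) h" "P h = mom (X 0) (P 0) h"
  using newton_unique[OF assms newton_flow[of "X 0" "P 0"]] by auto

lemma pos_lipschitz_mom:
  assumes "t \<in> {0..h}"
  shows "norm (pos x p t - pos x p' t) \<le> 2 * h * norm (p - p')"
  using ivp_bound[OF newton_difference[OF newton_flow newton_flow] force_difference, of t x p x p'] assms
  by simp

lemma mom_lipschitz_mom: "norm (mom x p h - mom x p' h) \<le> 6 * norm (p - p')"
proof -
  have "h * norm (mom x p h - mom x p' h) \<le> 3 * norm (pos x p h - pos x p' h)"
    using bvp_final_speed[OF newton_difference[OF newton_flow newton_flow] force_difference, of x p x p'] by simp
  also have "\<dots> \<le> 3 * (2 * h * norm (p - p'))"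
    using pos_lipschitz_mom[of h x p p'] h_pos by simp
  finally show ?thesis using h_pos by simp
qed

lemma endpoint_near_identity:
  "norm ((pos x p h - pos x p' h) - h *\<^sub>R (p - p')) \<le> 1/8 * (h * norm (p - p'))"
proof -
  have "norm ((pos x p h - pos x p' h) - h *\<^sub>R (p - p')) \<le> \<beta> * h\<^sup>2 * (h * norm (p - p'))"
    using ivp_endpoint[OF newton_difference[OF newton_flow newton_flow] force_difference, of x p x p'] by simp
  also have "\<dots> \<le> 1/8 * (h * norm (p - p'))"
    by (rule mult_right_mono[OF short]) (use h_pos in simp)
  finally show ?thesis .
qed

text \<open>As a function of the momentum, the endpoint is \<open>h\<close> times the identity up to
  a relative error 1/8, so the Newton iteration with fixed slope 1 / h is a contraction, and its
  fixed points are the solutions.\<close>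

lemma shooting: "\<exists>!p. pos x p h = y"
proof -
  define T where "T p = p - (1 / h) *\<^sub>R (pos x p h - y)" for p
  have "norm (T p - T p') \<le> 1/8 * norm (p - p')" for p p'
  proof -
    have "T p - T p' = (- (1 / h)) *\<^sub>R ((pos x p h - pos x p' h) - h *\<^sub>R (p - p'))"
      using h_pos by (simp add: T_def algebra_simps)
    then have "norm (T p - T p') = (1 / h) * norm ((pos x p h - pos x p' h) - h *\<^sub>R (p - p'))"
      using h_pos by simp
    also have "\<dots> \<le> (1 / h) * (1/8 * (h * norm (p - p')))"
      by (rule mult_left_mono[OF endpoint_near_identity]) (use h_pos in simp)
    finally show ?thesis using h_pos by simp
  qed
  then have "\<exists>!p. T p = p"
    by (intro banach_fix_type[where c = "1/8"]) (auto simp: dist_norm)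
  moreover have "T p = p \<longleftrightarrow> pos x p h = y" for p
    using h_pos by (simp add: T_def)
  ultimately show ?thesis by simp
qed

definition retarget :: "'a \<Rightarrow> 'a \<Rightarrow> 'a \<Rightarrow> 'a" where
  "retarget x' x p = (THE p'. pos x' p' h = pos x p h)"

lemma pos_retarget: "pos x' (retarget x' x p) h = pos x p h"
  unfolding retarget_def by (rule theI'[OF shooting])

text \<open>The two trajectories differ by \<open>x' - x\<close> at time 0 and coincide at time
  \<open>h\<close>: the boundary-value bounds apply with vanishing right endpoint, here and in the
  next two lemmas.\<close>

lemma retarget_speed: "norm (retarget x' x p - p) \<le> 2 * norm (x' - x) / h"
  using bvp_initial_speed[OF newton_difference[OF newton_flow newton_flow] force_difference,
      of x' "retarget x' x p" x p] h_pos
  by (simp add: pos_retarget field_simps)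

lemma retarget_final_speed:
  "norm (mom x p h - mom x' (retarget x' x p) h) \<le> 3 * norm (x' - x) / h"
  using bvp_final_speed[OF newton_difference[OF newton_flow newton_flow] force_difference,
      of x' "retarget x' x p" x p] h_pos
  by (simp add: pos_retarget norm_minus_commute field_simps)

lemma retarget_distance:
  "t \<in> {0..h} \<Longrightarrow> norm (pos x' (retarget x' x p) t - pos x p t) \<le> 3 * norm (x' - x)"
  using bvp_bound[OF newton_difference[OF newton_flow newton_flow] force_difference,
      of t x' "retarget x' x p" x p]
  by (simp add: pos_retarget)

text \<open>The displacement between paired trajectories runs from \<open>x' - x\<close> to 0 for
  every momentum. Subtracting the displacements for \<open>p\<close> and \<open>q\<close> gives a
  curve vanishing at both ends, so that only the error \<open>\<eta>\<close> of the force survives.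
  The two Lipschitz bounds below differ in the choice of \<open>\<eta>\<close>.\<close>

lemma retarget_lipschitz_aux:
  assumes "0 \<le> \<eta>"
    and \<eta>: "\<And>t. t \<in> {0..h} \<Longrightarrow>
      norm ((g (pos x' (retarget x' x p) t) - g (pos x p t))
          - (g (pos x' (retarget x' x q) t) - g (pos x q t)))
      \<le> \<beta> * norm ((pos x' (retarget x' x p) t - pos x p t)
          - (pos x' (retarget x' x q) t - pos x q t)) + \<eta>"
  shows "norm ((retarget x' x p - p) - (retarget x' x q - q)) \<le> \<eta> * h"
proof -
  define D where "D p t = pos x' (retarget x' x p) t - pos x p t" for p t
  define D' where "D' p t = mom x' (retarget x' x p) t - mom x p t" for p t
  define A where "A p t = - g (pos x' (retarget x' x p) t) - (- g (pos x p t))" for p t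
  have D: "(D p has_vector_derivative D' p t) (at t)"
    and D': "(D' p has_vector_derivative A p t) (at t)" for p t
    unfolding D_def[abs_def] D'_def[abs_def] A_def
    by (rule newton_difference[OF newton_flow newton_flow])+
  have DD: "((\<lambda>t. D p t - D q t) has_vector_derivative D' p t - D' q t) (at t)"
    and DD': "((\<lambda>t. D' p t - D' q t) has_vector_derivative A p t - A q t) (at t)" for t
    by (intro derivative_intros D D')+
  have "norm (A p t - A q t) \<le> \<beta> * norm (D p t - D q t) + \<eta>" if "t \<in> {0..h}" for t
  proof -
    have "A p t - A q t = - ((g (pos x' (retarget x' x p) t) - g (pos x p t))
          - (g (pos x' (retarget x' x q) t) - g (pos x q t)))"
      by (simp add: A_def)
    then show ?thesis using \<eta>[OF that] unfolding D_def by (metis norm_minus_cancel)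
  qed
  from bvp_initial_speed[OF DD DD' this \<open>0 \<le> \<eta>\<close>]
  have "h * norm (D' p 0 - D' q 0) \<le> \<eta> * h\<^sup>2"
    by (simp add: D_def pos_retarget)
  then show ?thesis using h_pos by (simp add: D'_def power2_eq_square)
qed

text \<open>With a merely Lipschitz force the four force terms are regrouped by starting point. Each
  pair then costs the spread of trajectories in the momentum, 2 h |p - q|, which after doubling is
  the 4 of the bound.\<close>

lemma retarget_lipschitz:
  "norm ((retarget x' x p - p) - (retarget x' x q - q)) \<le> 4 * \<beta> * h\<^sup>2 * norm (p - q)"
proof -
  have "norm ((retarget x' x p - p) - (retarget x' x q - q)) \<le> (4 * \<beta> * h * norm (p - q)) * h"
  proof (rule retarget_lipschitz_aux)
    show "0 \<le> 4 * \<beta> * h * norm (p - q)" using beta_nonneg h_pos by simp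
    fix t assume t: "t \<in> {0..h}"
    let ?X = "pos x' (retarget x' x p) t" and ?Y = "pos x' (retarget x' x q) t"
    have "norm ((g ?X - g (pos x p t)) - (g ?Y - g (pos x q t)))
        = norm ((g ?X - g ?Y) - (g (pos x p t) - g (pos x q t)))"
      by (simp add: algebra_simps)
    also have "\<dots> \<le> norm (g ?X - g ?Y) + norm (g (pos x p t) - g (pos x q t))"
      by (rule norm_triangle_ineq4)
    also have "\<dots> \<le> \<beta> * (norm (?X - ?Y) + norm (pos x p t - pos x q t))"
      unfolding distrib_left by (intro add_mono lip)
    also have "\<dots> \<le> \<beta> * (norm ((?X - pos x p t) - (?Y - pos x q t)) + 4 * h * norm (p - q))"
    proof (rule mult_left_mono[OF _ beta_nonneg])
      have "?X - ?Y = ((?X - pos x p t) - (?Y - pos x q t)) + (pos x p t - pos x q t)" by simp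
      then have "norm (?X - ?Y) \<le> norm ((?X - pos x p t) - (?Y - pos x q t)) + norm (pos x p t - pos x q t)"
        by (metis norm_triangle_ineq)
      then show "norm (?X - ?Y) + norm (pos x p t - pos x q t)
          \<le> norm ((?X - pos x p t) - (?Y - pos x q t)) + 4 * h * norm (p - q)"
        using pos_lipschitz_mom[OF t, of x p q] by simp
    qed
    finally show "norm ((g ?X - g (pos x p t)) - (g ?Y - g (pos x q t)))
        \<le> \<beta> * norm ((?X - pos x p t) - (?Y - pos x q t)) + 4 * \<beta> * h * norm (p - q)"
      by (simp add: algebra_simps)
  qed
  then show ?thesis by (simp add: power2_eq_square algebra_simps)
qed

text \<open>The error is now a product of the gap between paired trajectories, 3 |x' - x|, and their
  spread in the momentum, 2 h |p - q|; hence the 6.\<close>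

lemma retarget_lipschitz_second_order:
  assumes g2: "\<And>x y u v. norm ((g x - g y) - (g u - g v))
      \<le> \<beta> * norm ((x - y) - (u - v)) + b * norm (x - y) * norm (y - v)" and "0 \<le> b"
  shows "norm ((retarget x' x p - p) - (retarget x' x q - q)) \<le> 6 * b * h\<^sup>2 * norm (x' - x) * norm (p - q)"
proof -
  have "norm ((retarget x' x p - p) - (retarget x' x q - q)) \<le> (b * (3 * norm (x' - x)) * (2 * h * norm (p - q))) * h"
  proof (rule retarget_lipschitz_aux)
    show "0 \<le> b * (3 * norm (x' - x)) * (2 * h * norm (p - q))" using \<open>0 \<le> b\<close> h_pos by simp
    fix t assume t: "t \<in> {0..h}"
    have "b * norm (pos x' (retarget x' x p) t - pos x p t) * norm (pos x p t - pos x q t)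
        \<le> b * (3 * norm (x' - x)) * (2 * h * norm (p - q))"
      using retarget_distance[OF t] pos_lipschitz_mom[OF t] \<open>0 \<le> b\<close>
      by (intro mult_mono) auto
    then show "norm ((g (pos x' (retarget x' x p) t) - g (pos x p t))
          - (g (pos x' (retarget x' x q) t) - g (pos x q t)))
      \<le> \<beta> * norm ((pos x' (retarget x' x p) t - pos x p t)
          - (pos x' (retarget x' x q) t - pos x q t)) + b * (3 * norm (x' - x)) * (2 * h * norm (p - q))"
      using g2[of "pos x' (retarget x' x p) t" "pos x p t" "pos x' (retarget x' x q) t" "pos x q t"]
      by linarith
  qed
  then show ?thesis by (simp add: power2_eq_square algebra_simps)
qed

text \<open>Two rescaled differences of trajectories almost solve the same linear equation, so they are
  close to each other; the linearised equation itself need not be solved.\<close>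

lemma retarget_quotients_convergent:
  assumes smooth: "\<And>K B \<eta>. compact K \<Longrightarrow> (0::real) < \<eta> \<Longrightarrow> \<exists>N>0. \<forall>n\<ge>N. \<forall>m\<ge>N. \<forall>x\<in>K. \<forall>u. norm u \<le> B \<longrightarrow>
      norm (real n *\<^sub>R (g (x + (1 / real n) *\<^sub>R u) - g x) - real m *\<^sub>R (g (x + (1 / real m) *\<^sub>R u) - g x)) \<le> \<eta>"
  shows "convergent (\<lambda>n. real n *\<^sub>R (retarget x' x (p + (1 / real n) *\<^sub>R e) - retarget x' x p))"
proof -
  define P where "P n = p + (1 / real n) *\<^sub>R e" for n :: nat
  define R where "R n = retarget x' x (P n)" for n
  define r where "r = retarget x' x p"
  define \<rho> where "\<rho> n = real n *\<^sub>R (R n - r)" for n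
  have quotient_derivs:
    "((\<lambda>t. real n *\<^sub>R (pos y a t - pos y b t)) has_vector_derivative real n *\<^sub>R (mom y a t - mom y b t)) (at t)"
    "((\<lambda>t. real n *\<^sub>R (mom y a t - mom y b t)) has_vector_derivative real n *\<^sub>R (- g (pos y a t) - (- g (pos y b t)))) (at t)"
    for n y a b t
    by (intro bounded_linear.has_vector_derivative[OF bounded_linear_scaleR_right]
        newton_difference[OF newton_flow newton_flow])+
  have cont: "continuous_on S (pos y a)" for S y a
    using pos_deriv by (meson continuous_at_imp_continuous_on has_vector_derivative_continuous)
  \<comment> \<open>Bounds the rescaled position differences of both families: positions are 2
    h-Lipschitz in the momentum, and both families of rescaled momenta are bounded by the factor in
    parentheses.\<close>
  define B where "B = 2 * h * ((1 + 4 * \<beta> * h\<^sup>2) * norm e)"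
  have RB: "norm (real n *\<^sub>R (R n - r)) \<le> (1 + 4 * \<beta> * h\<^sup>2) * norm e" for n
  proof (cases "n = 0")
    case False
    have "norm (R n - r) \<le> norm (P n - p) + norm ((R n - P n) - (r - p))"
      using norm_triangle_ineq[of "P n - p" "(R n - P n) - (r - p)"] by (simp add: algebra_simps)
    also have "\<dots> \<le> (1 + 4 * \<beta> * h\<^sup>2) * norm (P n - p)"
      using retarget_lipschitz[of x' x "P n" p] by (simp add: R_def r_def algebra_simps)
    finally have "real n * norm (R n - r) \<le> real n * ((1 + 4 * \<beta> * h\<^sup>2) * norm (P n - p))"
      by (rule mult_left_mono) simp
    also have "norm (P n - p) = norm e / real n" by (simp add: P_def)
    finally show ?thesis using False by simp
  qed (use beta_nonneg in simp)
  have Pn: "norm (real n *\<^sub>R (P n - p)) \<le> (1 + 4 * \<beta> * h\<^sup>2) * norm e" for n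
    using beta_nonneg by (cases "n = 0") (auto simp: P_def algebra_simps)
  \<comment> \<open>This is the hypothesis of \<open>perturbed_bounds\<close> for the difference of
    the n-th and m-th rescaled differences, with error \<open>\<eta>\<close>.\<close>
  define near where "near y a b \<eta> n m \<longleftrightarrow> (\<forall>t\<in>{0..h}.
      norm (real n *\<^sub>R (- g (pos y (a n) t) - (- g (pos y b t))) - real m *\<^sub>R (- g (pos y (a m) t) - (- g (pos y b t))))
      \<le> \<beta> * norm (real n *\<^sub>R (pos y (a n) t - pos y b t) - real m *\<^sub>R (pos y (a m) t - pos y b t)) + \<eta>)" for y b and a :: "nat \<Rightarrow> 'a" and \<eta> and n m :: nat
  have nearly_linear: "\<exists>N>0. \<forall>n\<ge>N. \<forall>m\<ge>N. near y a b \<eta> n m"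
    if "0 < \<eta>" and a: "\<And>n. norm (real n *\<^sub>R (a n - b)) \<le> (1 + 4 * \<beta> * h\<^sup>2) * norm e" for y a b \<eta>
  proof -
    have "compact (pos y b ` {0..h})"
      by (intro compact_continuous_image cont) simp
    from smooth[OF this \<open>0 < \<eta>\<close>, of B] obtain N where N: "N > 0"
      "\<And>n m t u. n \<ge> N \<Longrightarrow> m \<ge> N \<Longrightarrow> t \<in> {0..h} \<Longrightarrow> norm u \<le> B \<Longrightarrow>
        norm (real n *\<^sub>R (g (pos y b t + (1 / real n) *\<^sub>R u) - g (pos y b t))
          - real m *\<^sub>R (g (pos y b t + (1 / real m) *\<^sub>R u) - g (pos y b t))) \<le> \<eta>"
      by blast
    have "norm (real n *\<^sub>R (- g (pos y (a n) t) - (- g (pos y b t))) - real m *\<^sub>R (- g (pos y (a m) t) - (- g (pos y b t))))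
      \<le> \<beta> * norm (real n *\<^sub>R (pos y (a n) t - pos y b t) - real m *\<^sub>R (pos y (a m) t - pos y b t)) + \<eta>"
      if nm: "n \<ge> N" "m \<ge> N" and t: "t \<in> {0..h}" for n m t
    proof -
      define X where "X = pos y b t"
      define u where "u k = real k *\<^sub>R (pos y (a k) t - X)" for k
      have uB: "norm (u m) \<le> B"
      proof -
        have "norm (u m) = real m * norm (pos y (a m) t - X)" by (simp add: u_def)
        also have "\<dots> \<le> real m * (2 * h * norm (a m - b))"
          unfolding X_def by (intro mult_left_mono pos_lipschitz_mom t) simp
        also have "\<dots> = 2 * h * norm (real m *\<^sub>R (a m - b))" by simp
        also have "\<dots> \<le> B" unfolding B_def by (intro mult_left_mono a) (use h_pos in simp)
        finally show ?thesis .
      qed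
      have pk: "pos y (a k) t = X + (1 / real k) *\<^sub>R u k" if "k > 0" for k
        using that by (simp add: u_def)
      have nm0: "n > 0" "m > 0" using nm N(1) by auto
      define F where "F k w = real k *\<^sub>R (g (X + (1 / real k) *\<^sub>R w) - g X)" for k w
      have "real n *\<^sub>R (- g (pos y (a n) t) - (- g X)) - real m *\<^sub>R (- g (pos y (a m) t) - (- g X))
          = - ((F n (u n) - F n (u m)) + (F n (u m) - F m (u m)))"
        unfolding F_def pk[OF nm0(1)] pk[OF nm0(2)] by (simp add: algebra_simps)
      then have "norm (real n *\<^sub>R (- g (pos y (a n) t) - (- g X)) - real m *\<^sub>R (- g (pos y (a m) t) - (- g X)))
          \<le> norm (F n (u n) - F n (u m)) + norm (F n (u m) - F m (u m))"
        by (metis norm_minus_cancel norm_triangle_ineq)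
      also have "norm (F n (u m) - F m (u m)) \<le> \<eta>"
        using N(2)[OF nm t uB] by (simp add: F_def X_def)
      also have "norm (F n (u n) - F n (u m)) \<le> \<beta> * norm (u n - u m)"
      proof -
        have "F n (u n) - F n (u m) = real n *\<^sub>R (g (X + (1 / real n) *\<^sub>R u n) - g (X + (1 / real n) *\<^sub>R u m))"
          by (simp add: F_def algebra_simps)
        also have "norm \<dots> \<le> real n * (\<beta> * norm ((1 / real n) *\<^sub>R (u n - u m)))"
        proof -
          have "norm (g (X + (1 / real n) *\<^sub>R u n) - g (X + (1 / real n) *\<^sub>R u m))
              \<le> \<beta> * norm ((1 / real n) *\<^sub>R (u n - u m))"
            using lip[of "X + (1 / real n) *\<^sub>R u n" "X + (1 / real n) *\<^sub>R u m"]
            by (simp add: scaleR_diff_right)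
          then show ?thesis unfolding norm_scaleR abs_of_nat by (rule mult_left_mono) simp
        qed
        also have "\<dots> = \<beta> * norm (u n - u m)" using nm0 by simp
        finally show ?thesis .
      qed
      finally show ?thesis unfolding u_def X_def by simp
    qed
    with N(1) show ?thesis unfolding near_def by blast
  qed
  have "Cauchy \<rho>"
  proof (rule CauchyI)
    fix \<epsilon> :: real assume "0 < \<epsilon>"
    \<comment> \<open>The endpoint gap, \<open>\<eta> * h\<^sup>2\<close>, enters the boundary-value
      bound doubled and is joined by another \<open>\<eta> * h\<^sup>2\<close>; dividing by
      \<open>h\<close> leaves 3 \<eta> h = 3/4 \<epsilon>.\<close>
    define \<eta> where "\<eta> = \<epsilon> / (4 * h)"
    have \<eta>: "0 < \<eta>" using \<open>0 < \<epsilon>\<close> h_pos by (simp add: \<eta>_def)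
    obtain N1 where N1: "N1 > 0" "\<And>n m. n \<ge> N1 \<Longrightarrow> m \<ge> N1 \<Longrightarrow> near x P p \<eta> n m"
      using nearly_linear[OF \<eta> Pn, of x] by blast
    obtain N2 where N2: "\<And>n m. n \<ge> N2 \<Longrightarrow> m \<ge> N2 \<Longrightarrow> near x' R r \<eta> n m"
      using nearly_linear[OF \<eta> RB, of x'] by blast
    have "norm (\<rho> n - \<rho> m) < \<epsilon>" if nm: "n \<ge> max N1 N2" "m \<ge> max N1 N2" for n m
    proof -
      define Q where "Q k t = real k *\<^sub>R (pos x (P k) t - pos x p t)" for k t
      define Q' where "Q' k t = real k *\<^sub>R (pos x' (R k) t - pos x' r t)" for k t
      have nm0: "n > 0" "m > 0" using nm N1(1) by auto
      have ends: "Q' k h = Q k h" for k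
        by (simp add: Q_def Q'_def R_def r_def pos_retarget)
      have n1: "N1 \<le> n" "N1 \<le> m" and n2: "N2 \<le> n" "N2 \<le> m" using nm by auto
      note near1 = N1(2)[OF n1, unfolded near_def, rule_format]
      note near2 = N2[OF n2, unfolded near_def, rule_format]
      \<comment> \<open>Both rescaled differences start at position 0 with momentum
        \<open>e\<close>, so their initial data cancel.\<close>
      have "norm (Q n h - Q m h) \<le> \<eta> * h\<^sup>2"
        unfolding Q_def
        using ivp_bound[OF has_vector_derivative_diff[OF quotient_derivs(1) quotient_derivs(1)]
            has_vector_derivative_diff[OF quotient_derivs(2) quotient_derivs(2)] near1, of h]
          nm nm0 \<eta> h_pos by (simp add: P_def)
      moreover have "h * norm (\<rho> n - \<rho> m) \<le> 2 * norm (Q' n h - Q' m h) + \<eta> * h\<^sup>2"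
        unfolding Q'_def \<rho>_def
        using bvp_initial_speed[OF has_vector_derivative_diff[OF quotient_derivs(1) quotient_derivs(1)]
            has_vector_derivative_diff[OF quotient_derivs(2) quotient_derivs(2)] near2]
          nm \<eta> by simp
      ultimately have "h * norm (\<rho> n - \<rho> m) \<le> h * (3 * \<eta> * h)"
        by (simp add: ends power2_eq_square algebra_simps)
      then have "norm (\<rho> n - \<rho> m) \<le> 3 * \<eta> * h" using h_pos by simp
      also have "\<dots> < \<epsilon>" using h_pos \<open>0 < \<epsilon>\<close> by (simp add: \<eta>_def)
      finally show ?thesis .
    qed
    then show "\<exists>M. \<forall>m\<ge>M. \<forall>n\<ge>M. norm (\<rho> m - \<rho> n) < \<epsilon>" by blast
  qed
  then show ?thesis
    unfolding \<rho>_def R_def r_def P_def by (rule Cauchy_convergent)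
qed

end

section \<open>The Hilbert space of square-summable sequences\<close>

typedef l2 = "{x :: nat \<Rightarrow> real. summable (\<lambda>i. (x i)\<^sup>2)}" morphisms coord l2_of
  by (rule exI[of _ "\<lambda>_. 0"]) simp

lemma summable_coord_square: "summable (\<lambda>i. (coord x i)\<^sup>2)"
  using coord[of x] by simp

lemma coord_l2_of: "summable (\<lambda>i. (f i)\<^sup>2) \<Longrightarrow> coord (l2_of f) = f"
  by (simp add: l2_of_inverse)

lemma l2_eqI: "(\<And>i. coord x i = coord y i) \<Longrightarrow> x = y"
  by (metis coord_inject ext)

lemma summable_square_add:
  fixes f g :: "nat \<Rightarrow> real"
  assumes "summable (\<lambda>i. (f i)\<^sup>2)" "summable (\<lambda>i. (g i)\<^sup>2)"
  shows "summable (\<lambda>i. (f i + g i)\<^sup>2)"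
proof (rule summable_comparison_test')
  show "summable (\<lambda>i. 2 * (f i)\<^sup>2 + 2 * (g i)\<^sup>2)"
    by (intro summable_add summable_mult assms)
  show "norm ((f n + g n)\<^sup>2) \<le> 2 * (f n)\<^sup>2 + 2 * (g n)\<^sup>2" for n
  proof -
    have "(f n + g n)\<^sup>2 + (f n - g n)\<^sup>2 = 2 * (f n)\<^sup>2 + 2 * (g n)\<^sup>2"
      by (simp add: power2_eq_square algebra_simps)
    then show ?thesis using zero_le_power2[of "f n - g n"] unfolding real_norm_def abs_power2 by linarith
  qed
qed

lemma summable_square_scale:
  fixes f :: "nat \<Rightarrow> real"
  shows "summable (\<lambda>i. (f i)\<^sup>2) \<Longrightarrow> summable (\<lambda>i. (c * f i)\<^sup>2)"
  by (simp add: power_mult_distrib summable_mult)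

lemma summable_coord_product: "summable (\<lambda>i. coord x i * coord y i)"
proof (rule summable_comparison_test')
  show "summable (\<lambda>i. (coord x i)\<^sup>2 + (coord y i)\<^sup>2)"
    by (intro summable_add summable_coord_square)
  show "norm (coord x n * coord y n) \<le> (coord x n)\<^sup>2 + (coord y n)\<^sup>2" for n
    using sum_squares_bound[of "\<bar>coord x n\<bar>" "\<bar>coord y n\<bar>"]
      mult_nonneg_nonneg[OF abs_ge_zero[of "coord x n"] abs_ge_zero[of "coord y n"]]
    by (simp add: abs_mult del: mult_nonneg_nonneg)
qed

instantiation l2 :: real_inner
begin

definition "0 = l2_of (\<lambda>_. 0)"
definition "x + y = l2_of (\<lambda>i. coord x i + coord y i)"
definition "x - y = l2_of (\<lambda>i. coord x i - coord y i)"
definition "- x = l2_of (\<lambda>i. - coord x i)"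
definition "c *\<^sub>R x = l2_of (\<lambda>i. c * coord x i)"
definition "inner x y = (\<Sum>i. coord x i * coord y i)"
definition "norm (x :: l2) = sqrt (inner x x)"
definition "sgn (x :: l2) = scaleR (inverse (norm x)) x"
definition "dist (x :: l2) y = norm (x - y)"
definition "uniformity = (INF e\<in>{0<..}. principal {(x :: l2, y). dist x y < e})"
definition "open U = (\<forall>x\<in>U. eventually (\<lambda>(x' :: l2, y). x' = x \<longrightarrow> y \<in> U) uniformity)"

lemma coord_zero [simp]: "coord 0 i = 0"
  by (simp add: zero_l2_def coord_l2_of)

lemma coord_add [simp]: "coord (x + y) i = coord x i + coord y i"
  by (simp add: plus_l2_def coord_l2_of summable_square_add summable_coord_square)

lemma coord_scaleR [simp]: "coord (c *\<^sub>R x) i = c * coord x i"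
  by (simp add: scaleR_l2_def coord_l2_of summable_square_scale summable_coord_square)

lemma coord_uminus [simp]: "coord (- x) i = - coord x i"
  by (simp add: uminus_l2_def coord_l2_of summable_coord_square)

lemma coord_diff [simp]: "coord (x - y) i = coord x i - coord y i"
  using summable_square_add[OF summable_coord_square[of x] summable_coord_square[of "- y"]]
  by (simp add: minus_l2_def coord_l2_of)

instance
proof
  fix x y z :: l2 and a b r :: real
  show "x + y + z = x + (y + z)" "x + y = y + x" "0 + x = x" "- x + x = 0" "x - y = x + - y"
    "a *\<^sub>R (x + y) = a *\<^sub>R x + a *\<^sub>R y" "(a + b) *\<^sub>R x = a *\<^sub>R x + b *\<^sub>R x"
    "a *\<^sub>R b *\<^sub>R x = (a * b) *\<^sub>R x" "1 *\<^sub>R x = x"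
    by (rule l2_eqI, simp add: algebra_simps)+
  show "dist x y = norm (x - y)" by (simp add: dist_l2_def)
  show "sgn x = scaleR (inverse (norm x)) x" by (simp add: sgn_l2_def)
  show "uniformity = (INF e\<in>{0<..}. principal {(x :: l2, y). dist x y < e})"
    by (simp add: uniformity_l2_def)
  show "open U = (\<forall>x\<in>U. eventually (\<lambda>(x', y). x' = x \<longrightarrow> y \<in> U) uniformity)" for U :: "l2 set"
    by (simp add: open_l2_def)
  show "inner x y = inner y x" by (simp add: inner_l2_def mult.commute)
  show "inner (x + y) z = inner x z + inner y z"
    by (simp add: inner_l2_def distrib_right suminf_add[symmetric] summable_coord_product)
  show "inner (r *\<^sub>R x) y = r * inner x y"
    by (simp add: inner_l2_def mult.assoc suminf_mult[symmetric] summable_coord_product)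
  show "0 \<le> inner x x"
    unfolding inner_l2_def by (intro suminf_nonneg summable_coord_product) simp
  show "(inner x x = 0) = (x = 0)"
  proof
    assume "inner x x = 0"
    then have "\<forall>i. coord x i * coord x i = 0"
      unfolding inner_l2_def by (subst (asm) suminf_eq_zero_iff) (auto intro: summable_coord_product)
    then show "x = 0" by (intro l2_eqI) simp
  qed (simp add: inner_l2_def)
  show "norm x = sqrt (inner x x)" by (simp add: norm_l2_def)
qed

end

lemma norm_l2_square: "(norm x)\<^sup>2 = (\<Sum>i. (coord x i)\<^sup>2)"
  by (simp only: power2_norm_eq_inner inner_l2_def) (simp only: power2_eq_square)

lemma sum_coord_le_norm: "finite I \<Longrightarrow> (\<Sum>i\<in>I. (coord x i)\<^sup>2) \<le> (norm x)\<^sup>2"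
  unfolding norm_l2_square by (intro sum_le_suminf summable_coord_square) auto

lemma abs_coord_le_norm: "\<bar>coord x i\<bar> \<le> norm x"
  using sum_coord_le_norm[of "{i}" x] by (simp add: power2_le_iff_abs_le)

lemma bounded_linear_coord: "bounded_linear (\<lambda>x. coord x i)"
  by (rule bounded_linear_intro[where K = 1]) (auto simp: abs_coord_le_norm)

lemma norm_l2_leI:
  assumes "\<And>N. (\<Sum>i<N. (coord x i)\<^sup>2) \<le> B\<^sup>2" "0 \<le> B"
  shows "norm x \<le> B"
proof -
  have "(norm x)\<^sup>2 \<le> B\<^sup>2"
    unfolding norm_l2_square by (intro suminf_le_const summable_coord_square assms)
  then show ?thesis using \<open>0 \<le> B\<close> by (simp add: power2_le_iff_abs_le)
qed

text \<open>The candidate is the coordinatewise limit. The Cauchy estimate is passed to the limit in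
  each finite partial sum; its independence of \<open>N\<close> yields both square-summability of
  the candidate and convergence in norm.\<close>

instance l2 :: complete_space
proof
  fix X :: "nat \<Rightarrow> l2" assume X: "Cauchy X"
  have "convergent (\<lambda>n. coord (X n) i)" for i
    by (intro Cauchy_convergent bounded_linear.Cauchy[OF bounded_linear_coord X])
  then obtain x where x: "\<And>i. (\<lambda>n. coord (X n) i) \<longlonglongrightarrow> x i"
    unfolding convergent_def by metis
  have tail: "(\<Sum>i<N. (coord (X m) i - x i)\<^sup>2) \<le> e\<^sup>2"
    if "\<And>n. n \<ge> M \<Longrightarrow> norm (X m - X n) < e" for m M N :: nat and e :: real
  proof (rule tendsto_upperbound)
    show "((\<lambda>n. \<Sum>i<N. (coord (X m) i - coord (X n) i)\<^sup>2) \<longlongrightarrow> (\<Sum>i<N. (coord (X m) i - x i)\<^sup>2)) sequentially"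
      by (intro tendsto_intros x)
    have "(\<Sum>i<N. (coord (X m) i - coord (X n) i)\<^sup>2) \<le> e\<^sup>2" if "n \<ge> M" for n
    proof -
      have "(\<Sum>i<N. (coord (X m) i - coord (X n) i)\<^sup>2) \<le> (norm (X m - X n))\<^sup>2"
        using sum_coord_le_norm[of "{..<N}" "X m - X n"] by simp
      also have "\<dots> \<le> e\<^sup>2"
        using \<open>\<And>n. n \<ge> M \<Longrightarrow> norm (X m - X n) < e\<close>[OF that] by (intro power_mono) auto
      finally show ?thesis .
    qed
    then show "\<forall>\<^sub>F n in sequentially. (\<Sum>i<N. (coord (X m) i - coord (X n) i)\<^sup>2) \<le> e\<^sup>2"
      unfolding eventually_sequentially by blast
  qed simp
  have ex: "\<exists>M. \<forall>m\<ge>M. \<forall>N. (\<Sum>i<N. (coord (X m) i - x i)\<^sup>2) \<le> e\<^sup>2" if "0 < e" for e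
  proof -
    obtain M where "\<And>m n. m \<ge> M \<Longrightarrow> n \<ge> M \<Longrightarrow> norm (X m - X n) < e"
      using X \<open>0 < e\<close> unfolding Cauchy_iff by blast
    then show ?thesis using tail by blast
  qed
  obtain m where m: "\<And>N. (\<Sum>i<N. (coord (X m) i - x i)\<^sup>2) \<le> 1\<^sup>2"
    using ex[of 1] by auto
  have "summable (\<lambda>i. (coord (X m) i - x i)\<^sup>2)"
    by (rule summableI_nonneg_bounded[where x = "1\<^sup>2"]) (use m in auto)
  \<comment> \<open>The sequence is \<open>x\<close> itself, written as a sum of two square-summable
    ones.\<close>
  then have "summable (\<lambda>i. (- 1 * (coord (X m) i - x i) + coord (X m) i)\<^sup>2)"
    by (intro summable_square_add summable_square_scale summable_coord_square)
  then have xl2: "coord (l2_of x) = x"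
    by (intro coord_l2_of) simp
  have "X \<longlonglongrightarrow> l2_of x"
  proof (rule metric_LIMSEQ_I)
    fix e :: real assume "0 < e"
    then obtain M where "\<And>m N. m \<ge> M \<Longrightarrow> (\<Sum>i<N. (coord (X m) i - x i)\<^sup>2) \<le> (e/2)\<^sup>2"
      using ex[of "e/2"] by auto
    then have "norm (X m - l2_of x) \<le> e/2" if "m \<ge> M" for m
      using that \<open>0 < e\<close> by (intro norm_l2_leI) (auto simp: xl2)
    then show "\<exists>M. \<forall>m\<ge>M. dist (X m) (l2_of x) < e"
      using \<open>0 < e\<close> by (intro exI[of _ M]) (force simp: dist_norm)
  qed
  then show "convergent X" by (auto simp: convergent_def)
qed

instance l2 :: banach ..

section \<open>Vectors of dimension d inside the sequence space\<close>

definition emb :: "nat \<Rightarrow> (nat \<Rightarrow> real) \<Rightarrow> l2" where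
  "emb d x = l2_of (\<lambda>i. if i < d then x i else 0)"

lemma coord_emb [simp]: "coord (emb d x) i = (if i < d then x i else 0)"
proof -
  have "summable (\<lambda>i. (if i < d then x i else 0)\<^sup>2)"
    by (rule summable_finite[of "{..<d}"]) auto
  then show ?thesis by (simp add: emb_def coord_l2_of)
qed

definition unit_vec :: "nat \<Rightarrow> l2" where
  "unit_vec k = emb (Suc k) (\<lambda>i. if i = k then 1 else 0)"

lemma coord_unit_vec [simp]: "coord (unit_vec k) i = (if i = k then 1 else 0)"
  by (simp add: unit_vec_def)

lemma norm_emb: "norm (emb d x) = L2_set x {..<d}"
proof -
  have "(norm (emb d x))\<^sup>2 = (\<Sum>i<d. (x i)\<^sup>2)"
    unfolding norm_l2_square by (subst suminf_finite[of "{..<d}"]) auto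
  then show ?thesis unfolding L2_set_def by (metis norm_ge_zero real_sqrt_unique)
qed

lemma norm_unit_vec [simp]: "norm (unit_vec k) = 1"
  by (simp add: unit_vec_def norm_emb L2_set_def if_distrib[of "\<lambda>x. x\<^sup>2"] cong: if_cong)

lemma emb_diff: "emb d x - emb d y = emb d (\<lambda>i. x i - y i)"
  by (rule l2_eqI) simp

lemma emb_eq_sum: "emb d x = (\<Sum>i<d. x i *\<^sub>R unit_vec i)"
proof (induction d)
  case 0
  then show ?case by (intro l2_eqI) simp
next
  case (Suc d)
  have "emb (Suc d) x = emb d x + x d *\<^sub>R unit_vec d"
    by (rule l2_eqI) (auto simp: less_Suc_eq)
  then show ?case using Suc by simp
qed

lemma norm_emb_coord_le: "norm (emb k (coord x)) \<le> norm x"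
proof (rule norm_l2_leI)
  fix N
  have "(\<Sum>i<N. (coord (emb k (coord x)) i)\<^sup>2) \<le> (\<Sum>i<N. (coord x i)\<^sup>2)"
    by (intro sum_mono) auto
  also have "\<dots> \<le> (norm x)\<^sup>2" by (rule sum_coord_le_norm) simp
  finally show "(\<Sum>i<N. (coord (emb k (coord x)) i)\<^sup>2) \<le> (norm x)\<^sup>2" .
qed simp

definition res :: "nat \<Rightarrow> l2 \<Rightarrow> nat \<Rightarrow> real" where
  "res d x = (\<lambda>i\<in>{..<d}. coord x i)"

lemma continuous_coord: "continuous_on S (\<lambda>x. coord x i)"
  by (intro linear_continuous_on bounded_linear_coord)

lemma continuous_res: "continuous_on UNIV (res d)"
  unfolding res_def
proof (rule continuous_on_coordinatewise_then_product)
  show "continuous_on UNIV (\<lambda>x. (\<lambda>i\<in>{..<d}. coord x i) i)" for i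
    by (cases "i < d") (auto intro: continuous_coord)
qed

lemma inner_emb: "inner (emb d a) w = (\<Sum>i<d. a i * coord w i)"
  unfolding inner_l2_def by (subst suminf_finite[of "{..<d}"]) auto

lemma emb_eqI: "(\<And>i. i < d \<Longrightarrow> x i = y i) \<Longrightarrow> emb d x = emb d y"
  by (rule l2_eqI) simp

lemma continuous_emb: "continuous_on UNIV (emb d)"
  unfolding emb_eq_sum[abs_def]
  by (intro continuous_intros continuous_on_product_coordinates)

text \<open>Continuity refers to the product topology on all of
  \<open>nat \<Rightarrow> real\<close>, the noise to the finite product of sigma-algebras.
  Coordinates below \<open>d\<close> are measurable for the latter, and the others are constantly
  \<open>undefined\<close> on its space.\<close>

lemma measurable_identity_PiM:
  assumes "\<And>i. sets (M i) = sets borel"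
  shows "(\<lambda>z. z) \<in> measurable (Pi\<^sub>M {..<d::nat} M) (borel :: (nat \<Rightarrow> real) measure)"
proof -
  have "(\<lambda>z n. z n) \<in> measurable (Pi\<^sub>M {..<d} M) (Pi\<^sub>M UNIV (\<lambda>_. borel :: real measure))"
  proof (rule measurable_abs_UNIV)
    fix n
    show "(\<lambda>z. z n) \<in> measurable (Pi\<^sub>M {..<d} M) (borel :: real measure)"
    proof (cases "n < d")
      case True
      then have "(\<lambda>z. z n) \<in> measurable (Pi\<^sub>M {..<d} M) (M n)" by simp
      then show ?thesis by (simp only: measurable_cong_sets[OF refl assms])
    next
      case False
      have "z n = undefined" if "z \<in> space (Pi\<^sub>M {..<d} M)" for z
        by (rule PiE_arb[OF that[unfolded space_PiM]]) (use False in simp)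
      then show ?thesis using measurable_cong[of "Pi\<^sub>M {..<d} M" "\<lambda>z. z n" "\<lambda>_. undefined" borel] by simp
    qed
  qed
  then show ?thesis by (simp only: measurable_cong_sets[OF refl sets_PiM_equal_borel])
qed

lemma measurable_emb:
  assumes "\<And>i. sets (M i) = sets borel"
  shows "emb d \<in> borel_measurable (Pi\<^sub>M {..<d} M)"
  using measurable_compose[OF measurable_identity_PiM[OF assms]
      borel_measurable_continuous_onI[OF continuous_emb]] by simp

section \<open>Gaussian changes of variables\<close>

lemma nn_integral_mono_emeasure:
  assumes sets: "sets M = sets N" and le: "\<And>A. A \<in> sets N \<Longrightarrow> emeasure M A \<le> emeasure N A"
  shows "integral\<^sup>N M f \<le> integral\<^sup>N N f"
  unfolding nn_integral_def
proof (rule SUP_mono)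
  note space = sets_eq_imp_space_eq[OF sets]
  fix g assume g: "g \<in> {g. simple_function M g \<and> g \<le> f}"
  then have sN: "simple_function N g"
    using simple_function_cong_algebra[OF sets[symmetric] space[symmetric]] by auto
  have "integral\<^sup>S M g \<le> integral\<^sup>S N g"
    unfolding simple_integral_def space
    by (intro sum_mono mult_left_mono le simple_functionD(2)[OF sN]) simp
  with g sN show "\<exists>g'\<in>{g. simple_function N g \<and> g \<le> f}. integral\<^sup>S M g \<le> integral\<^sup>S N g'"
    by blast
qed

lemma emeasure_le_lborel_bounded:
  fixes M :: "real measure"
  assumes sets: "sets M = sets borel"
    and Icc: "\<And>a b. a \<le> b \<Longrightarrow> emeasure M {a..b} \<le> ennreal (b - a)"
    and B: "B \<in> sets borel" "B \<subseteq> cbox a b"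
  shows "emeasure M B \<le> emeasure lborel B"
proof (rule ennreal_le_epsilon)
  fix e :: real assume "0 < e"
  have lm: "B \<in> lmeasurable"
    using B bounded_subset[OF bounded_cbox B(2)] by (intro bounded_set_imp_lmeasurable) auto
  obtain \<D> where \<D>: "countable \<D>" "\<And>K. K \<in> \<D> \<Longrightarrow> K \<subseteq> cbox a b \<and> K \<noteq> {} \<and> (\<exists>c d. K = cbox c d)"
    "pairwise (\<lambda>A B. interior A \<inter> interior B = {}) \<D>" "B \<subseteq> \<Union>\<D>"
    "measure lebesgue (\<Union>\<D>) \<le> measure lebesgue B + e"
    using measurable_outer_intervals_bounded[OF lm B(2) \<open>0 < e\<close>] by metis
  \<comment> \<open>The family may be finite, so it is enumerated with the empty set at the indices
    left over.\<close>
  define I where "I = to_nat_on \<D> ` \<D>"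
  define S where "S n = (if n \<in> I then from_nat_into \<D> n else {})" for n
  have S\<D>: "S n \<in> \<D>" if "n \<in> I" for n
    using that \<D>(1) by (auto simp: S_def I_def)
  have S_cases: "S n = {} \<or> (\<exists>c d. c \<le> d \<and> S n = {c..d})" for n
  proof (cases "n \<in> I")
    case True
    then obtain c d where "S n = cbox c d" "S n \<noteq> {}" using \<D>(2)[OF S\<D>] by blast
    then show ?thesis by auto
  qed (simp add: S_def)
  have US: "(\<Union>n. S n) = \<Union>\<D>"
    using \<D>(1) by (auto simp: S_def I_def)
  have S_lm: "S n \<in> lmeasurable" for n
    using S_cases[of n] by auto
  have S_eq: "emeasure M (S n) \<le> ennreal (measure lebesgue (S n))" for n
    using S_cases[of n] Icc by auto
  \<comment> \<open>Distinct covering intervals can share endpoints; their intersection is convex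
    with empty interior, hence null, which suffices for adding up lengths.\<close>
  have neg: "pairwise (\<lambda>m n. negligible (S m \<inter> S n)) UNIV"
  proof (rule pairwiseI)
    fix m n :: nat assume "m \<noteq> n"
    show "negligible (S m \<inter> S n)"
    proof (cases "m \<in> I \<and> n \<in> I")
      case True
      then have "S m \<noteq> S n"
        using \<open>m \<noteq> n\<close> \<D>(1) by (auto simp: S_def I_def)
      then have "interior (S m) \<inter> interior (S n) = {}"
        using \<D>(3) True S\<D> by (auto simp: pairwise_def)
      moreover have "convex (S m \<inter> S n)"
        using S_cases[of m] S_cases[of n] by (auto intro!: convex_Int)
      ultimately show ?thesis by (simp add: negligible_convex_interior)
    qed (auto simp: S_def)
  qed
  have "(\<lambda>n. measure lebesgue (S n)) sums measure lebesgue (\<Union>n. S n)"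
  proof (rule measure_countable_negligible_Union_bounded[OF S_lm neg])
    show "bounded (\<Union>n. S n)" unfolding US
      by (rule bounded_subset[OF bounded_cbox[of a b]]) (use \<D>(2) in blast)
  qed
  then have "(\<Sum>n. ennreal (measure lebesgue (S n))) = ennreal (measure lebesgue (\<Union>\<D>))"
    unfolding US by (intro suminf_ennreal_eq) auto
  have mS: "S n \<in> sets M" for n
    using S_cases[of n] by (auto simp: sets)
  have "emeasure M B \<le> emeasure M (\<Union>n. S n)"
    using \<D>(4) mS by (intro emeasure_mono) (auto simp: US[symmetric])
  also have "\<dots> \<le> (\<Sum>n. emeasure M (S n))"
    by (rule emeasure_subadditive_countably) (use mS in blast)
  also have "\<dots> \<le> (\<Sum>n. ennreal (measure lebesgue (S n)))"
    by (intro suminf_le S_eq) auto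
  also have "\<dots> = ennreal (measure lebesgue (\<Union>\<D>))" by fact
  also have "\<dots> \<le> ennreal (measure lebesgue B + e)" by (rule ennreal_leI[OF \<D>(5)])
  also have "\<dots> = emeasure lborel B + ennreal e"
  proof -
    have "emeasure lborel B = emeasure lebesgue B" using B by simp
    also have "\<dots> = ennreal (measure lebesgue B)" using lm by (simp add: emeasure_eq_measure2)
    finally show ?thesis using \<open>0 < e\<close> by simp
  qed
  finally show "emeasure M B \<le> emeasure lborel B + ennreal e" .
qed

lemma emeasure_le_lborel:
  fixes M :: "real measure"
  assumes sets: "sets M = sets borel"
    and Icc: "\<And>a b. a \<le> b \<Longrightarrow> emeasure M {a..b} \<le> ennreal (b - a)"
    and B: "B \<in> sets borel"
  shows "emeasure M B \<le> emeasure lborel B"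
proof -
  define A where "A n = B \<inter> cbox (- real n) (real n)" for n
  have inc: "incseq A" by (auto simp: A_def incseq_def)
  have A: "A n \<in> sets borel" for n using B by (simp add: A_def)
  have UA: "(\<Union>n. A n) = B"
  proof -
    have "\<exists>n. - real n \<le> x \<and> x \<le> real n" for x :: real
      using real_arch_simple[of "\<bar>x\<bar>"] by (metis abs_le_iff minus_le_iff)
    then show ?thesis by (auto simp: A_def)
  qed
  have "emeasure M B = (SUP n. emeasure M (A n))"
    using SUP_emeasure_incseq[of A M] A inc by (simp add: UA sets image_subset_iff)
  also have "\<dots> \<le> (SUP n. emeasure lborel (A n))"
  proof (rule SUP_mono)
    fix n
    show "\<exists>m\<in>UNIV. emeasure M (A n) \<le> emeasure lborel (A m)"
      by (rule bexI[of _ n], rule emeasure_le_lborel_bounded[OF sets Icc A, of _ "- real n" "real n"]) (auto simp: A_def)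
  qed
  also have "\<dots> = emeasure lborel B"
    using SUP_emeasure_incseq[of A lborel] A inc by (simp add: UA image_subset_iff)
  finally show ?thesis .
qed

text \<open>Fatou's lemma replaces the fundamental theorem of calculus, for which \<open>\<psi>\<close>, being merely
  measurable, is not regular enough.\<close>

lemma nn_integral_le_increment:
  fixes g \<psi> :: "real \<Rightarrow> real"
  assumes cont: "continuous_on UNIV g" and mono: "mono g" and [measurable]: "\<psi> \<in> borel_measurable borel"
    and low: "\<And>t e. 0 < e \<Longrightarrow> \<forall>\<^sub>F n in sequentially. \<psi> t - e \<le> real n * (g (t + 1 / real n) - g t)"
    and "a \<le> b"
  shows "(\<integral>\<^sup>+ t\<in>{a..b}. ennreal (\<psi> t) \<partial>lborel) \<le> ennreal (g b - g a)"
proof -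
  define q where "q n t = real n * (g (t + 1 / real n) - g t)" for n t
  have q0: "0 \<le> q n t" for n t
    using monoD[OF mono, of t "t + 1 / real n"] by (simp add: q_def)
  have contq: "continuous_on UNIV (q n)" for n
    unfolding q_def by (intro continuous_intros continuous_on_compose2[OF cont]) auto
  then have [measurable]: "q n \<in> borel_measurable borel" for n
    by (intro borel_measurable_continuous_onI)
  define G where "G = cum_integral g"
  have G: "(G has_vector_derivative g t) (at t)" for t
    unfolding G_def by (rule cum_integral_has_vector_derivative[OF cont])
  have GR: "(G has_real_derivative g t) (at t)" for t
    using G by (simp add: has_real_derivative_iff_has_vector_derivative)
  \<comment> \<open>For positive n this is the average of \<open>g\<close> over a window of length
    1/n to the right of \<open>b\<close>, minus the same at \<open>a\<close>; it tends to
    \<open>g b - g a\<close> by continuity.\<close>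
  define J where "J n = real n * (G (b + 1 / real n) - G b) - real n * (G (a + 1 / real n) - G a)" for n
  have int: "(q n has_integral J n) {a..b}" for n
  proof -
    have "((\<lambda>t. real n * (G (t + 1 / real n) - G t)) has_real_derivative q n t) (at t within {a..b})" for t
      unfolding q_def by (rule derivative_eq_intros has_field_derivative_at_within[OF DERIV_shift[THEN iffD1, OF GR]]
          has_field_derivative_at_within[OF GR] refl)+ (simp add: algebra_simps)
    then have "(q n has_integral (real n * (G (b + 1 / real n) - G b) - real n * (G (a + 1 / real n) - G a))) {a..b}"
      using \<open>a \<le> b\<close>
      by (intro fundamental_theorem_of_calculus)
        (auto simp: has_real_derivative_iff_has_vector_derivative)
    then show ?thesis by (simp add: J_def)
  qed
  have nn: "(\<integral>\<^sup>+ t\<in>{a..b}. ennreal (q n t) \<partial>lborel) = ennreal (J n)" for n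
  proof -
    have "integral\<^sup>N lborel (\<lambda>t. indicator {a..b} t * q n t) = J n"
    proof (rule nn_integral_has_integral_lborel)
      show "((\<lambda>t. indicator {a..b} t * q n t) has_integral J n) UNIV"
      proof -
        have "(\<lambda>t. indicator {a..b} t * q n t) = (\<lambda>t. if t \<in> {a..b} then q n t else 0)"
          by (auto simp: indicator_def)
        then show ?thesis using int[of n] by (simp only: has_integral_restrict_UNIV)
      qed
    qed (auto simp: q0)
    then show ?thesis
      by (simp add: ennreal_mult q0 mult.commute ennreal_indicator)
  qed
  have quot: "(\<lambda>n. real n * (G (s + 1 / real n) - G s)) \<longlonglongrightarrow> g s" for s
  proof -
    have "((\<lambda>h. (G (s + h) - G s) / h) \<longlongrightarrow> g s) (at 0)" using GR[of s] by (simp add: DERIV_def)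
    moreover have "filterlim (\<lambda>n. 1 / real n) (at 0) sequentially"
      by (auto simp: filterlim_at lim_1_over_n intro!: eventually_sequentiallyI[of 1])
    ultimately have "(\<lambda>n. (G (s + 1 / real n) - G s) / (1 / real n)) \<longlonglongrightarrow> g s"
      by (rule filterlim_compose)
    then show ?thesis by (simp add: mult.commute)
  qed
  have limJ: "J \<longlonglongrightarrow> g b - g a" unfolding J_def[abs_def] by (intro tendsto_diff quot)
  have "ennreal (\<psi> t) \<le> liminf (\<lambda>n. ennreal (q n t))" for t
    unfolding le_Liminf_iff
  proof (intro allI impI)
    fix y assume y: "y < ennreal (\<psi> t)"
    then have "y \<noteq> top" by auto
    then obtain r where r: "y = ennreal r" "0 \<le> r" by (cases y) auto
    then have "r < \<psi> t" using y by (simp add: ennreal_less_iff)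
    then have "\<forall>\<^sub>F n in sequentially. \<psi> t - (\<psi> t - r) / 2 \<le> q n t"
      unfolding q_def by (intro low) simp
    then show "\<forall>\<^sub>F n in sequentially. y < ennreal (q n t)"
    proof eventually_elim
      case (elim n)
      then have "r < q n t" using \<open>r < \<psi> t\<close> by (simp add: field_simps)
      then show ?case using r by (simp add: ennreal_less_iff)
    qed
  qed
  then have le: "ennreal (\<psi> t) * indicator {a..b} t \<le> liminf (\<lambda>n. ennreal (q n t) * indicator {a..b} t)" for t
    by (simp add: indicator_def)
  have "(\<integral>\<^sup>+ t\<in>{a..b}. ennreal (\<psi> t) \<partial>lborel)
      \<le> (\<integral>\<^sup>+ t. liminf (\<lambda>n. ennreal (q n t) * indicator {a..b} t) \<partial>lborel)"
    by (rule nn_integral_mono[OF le])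
  also have "\<dots> \<le> liminf (\<lambda>n. \<integral>\<^sup>+ t\<in>{a..b}. ennreal (q n t) \<partial>lborel)"
    by (rule nn_integral_liminf) measurable
  also have "\<dots> = ennreal (g b - g a)"
    unfolding nn by (intro lim_imp_Liminf tendsto_ennrealI limJ) simp
  finally show ?thesis .
qed

text \<open>The image under \<open>g\<close> of Lebesgue measure with density \<open>\<psi>\<close>
  has at most the length of each interval as mass, because preimages of intervals are intervals;
  hence it lies below Lebesgue measure. The slopes between 1/2 and 2 make \<open>g\<close> a
  continuous increasing bijection. Equality is out of reach since \<open>\<psi>\<close> only bounds
  the slope from below.\<close>

lemma nn_integral_substitution_le:
  fixes g \<psi> :: "real \<Rightarrow> real"
  assumes lower: "\<And>s t. s \<le> t \<Longrightarrow> (t - s) / 2 \<le> g t - g s"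
    and upper: "\<And>s t. s \<le> t \<Longrightarrow> g t - g s \<le> 2 * (t - s)"
    and psi[measurable]: "\<psi> \<in> borel_measurable borel"
    and low: "\<And>t e. 0 < e \<Longrightarrow> \<forall>\<^sub>F n in sequentially. \<psi> t - e \<le> real n * (g (t + 1 / real n) - g t)"
    and [measurable]: "F \<in> borel_measurable borel"
  shows "(\<integral>\<^sup>+ t. F (g t) * ennreal (\<psi> t) \<partial>lborel) \<le> (\<integral>\<^sup>+ t. F t \<partial>lborel)"
proof -
  have mono: "mono g"
    using lower by (intro monoI) (smt (verit) divide_nonneg_pos)
  have cont: "continuous_on S g" for S
  proof (rule lipschitz_continuous_on[where L = 2])
    show "norm (g x - g y) \<le> 2 * norm (x - y)" for x y
      using upper[of x y] upper[of y x] lower[of x y] lower[of y x]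
      by (cases "x \<le> y") (auto simp: abs_if)
  qed
  then have [measurable]: "g \<in> borel_measurable borel"
    by (intro borel_measurable_continuous_onI)
  have strict: "s \<le> t" if "g s \<le> g t" for s t
    using lower[of t s] that by (cases "s \<le> t") auto
  have surj: "\<exists>a. g a = c" for c
  proof -
    \<comment> \<open>With slope at least 1/2, a step of this length changes \<open>g\<close> by at
      least |c - g 0|.\<close>
    define r where "r = 2 * \<bar>c - g 0\<bar>"
    have "g (- r) \<le> c" "c \<le> g r" "- r \<le> r"
      using lower[of "- r" 0] lower[of 0 r] by (auto simp: r_def)
    then show ?thesis using IVT'[of g "- r" c r] cont by blast
  qed
  define M where "M = distr (density lborel \<psi>) borel g"
  have sM: "sets M = sets borel" by (simp add: M_def)
  have Icc: "emeasure M {c..d} \<le> ennreal (d - c)" if "c \<le> d" for c d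
  proof -
    obtain a b where ab: "g a = c" "g b = d" using surj by metis
    then have "a \<le> b" using strict that by blast
    have "g -` {c..d} = {a..b}"
    proof (intro set_eqI iffI)
      fix t assume "t \<in> g -` {c..d}"
      then show "t \<in> {a..b}" using strict[of a t] strict[of t b] ab by simp
    next
      fix t assume "t \<in> {a..b}"
      then show "t \<in> g -` {c..d}" using monoD[OF mono, of a t] monoD[OF mono, of t b] ab by simp
    qed
    then have "emeasure M {c..d} = (\<integral>\<^sup>+ t\<in>{a..b}. ennreal (\<psi> t) \<partial>lborel)"
      by (simp add: M_def emeasure_distr emeasure_density)
    also have "\<dots> \<le> ennreal (d - c)"
      using nn_integral_le_increment[OF cont mono psi low \<open>a \<le> b\<close>] ab by simp
    finally show ?thesis .
  qed
  have "(\<integral>\<^sup>+ t. F (g t) * ennreal (\<psi> t) \<partial>lborel) = (\<integral>\<^sup>+ t. F t \<partial>M)"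
    by (simp add: M_def nn_integral_distr nn_integral_density mult.commute)
  also have "\<dots> \<le> (\<integral>\<^sup>+ t. F t \<partial>lborel)"
    by (rule nn_integral_mono_emeasure) (auto simp: sM intro!: emeasure_le_lborel[OF sM Icc])
  finally show ?thesis .
qed

lemma nn_integral_gaussian_substitution_le:
  fixes g \<psi> :: "real \<Rightarrow> real"
  assumes lower: "\<And>s t. s \<le> t \<Longrightarrow> (t - s) / 2 \<le> g t - g s"
    and upper: "\<And>s t. s \<le> t \<Longrightarrow> g t - g s \<le> 2 * (t - s)"
    and [measurable]: "\<psi> \<in> borel_measurable borel"
    and low: "\<And>t e. 0 < e \<Longrightarrow> \<forall>\<^sub>F n in sequentially. \<psi> t - e \<le> real n * (g (t + 1 / real n) - g t)"
    and [measurable]: "F \<in> borel_measurable borel" "g \<in> borel_measurable borel"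
  shows "(\<integral>\<^sup>+ t. F (g t) * ennreal (std_normal_density (g t) / std_normal_density t * \<psi> t)
      \<partial>density lborel (\<lambda>x. ennreal (std_normal_density x)))
    \<le> (\<integral>\<^sup>+ t. F t \<partial>density lborel (\<lambda>x. ennreal (std_normal_density x)))"
proof -
  have pos: "0 < std_normal_density t" for t by (simp add: normal_density_pos)
  have "ennreal (std_normal_density t) * (F (g t) * ennreal (std_normal_density (g t) / std_normal_density t * \<psi> t))
      = (F (g t) * ennreal (std_normal_density (g t))) * ennreal (\<psi> t)" for t
  proof -
    have "ennreal (std_normal_density t) * ennreal (std_normal_density (g t) / std_normal_density t * \<psi> t)
        = ennreal (std_normal_density (g t) * \<psi> t)"
      using pos[of t] by (subst ennreal_mult'[symmetric]) auto
    also have "\<dots> = ennreal (std_normal_density (g t)) * ennreal (\<psi> t)"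
      by (rule ennreal_mult') simp
    finally show ?thesis by (simp add: mult_ac)
  qed
  then have "(\<integral>\<^sup>+ t. F (g t) * ennreal (std_normal_density (g t) / std_normal_density t * \<psi> t)
      \<partial>density lborel (\<lambda>x. ennreal (std_normal_density x)))
    = (\<integral>\<^sup>+ t. (F (g t) * ennreal (std_normal_density (g t))) * ennreal (\<psi> t) \<partial>lborel)"
    by (subst nn_integral_density) auto
  also have "\<dots> \<le> (\<integral>\<^sup>+ t. F t * ennreal (std_normal_density t) \<partial>lborel)"
    by (rule nn_integral_substitution_le[OF lower upper _ low]) auto
  also have "\<dots> = (\<integral>\<^sup>+ t. F t \<partial>density lborel (\<lambda>x. ennreal (std_normal_density x)))"
    by (subst nn_integral_density) (auto simp: mult.commute)
  finally show ?thesis .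
qed

text \<open>Origin of the 7: y = x - 2 L^2 has absolute value at most 3/2 L, and ln (1 + y) is at
  least y - 2 y^2, so that 2 L^2 + 9/2 L^2 is lost. The 2 L^2 on the right is the error of the slope
  in \<open>one_coordinate\<close>.\<close>

lemma one_plus_ge_exp:
  fixes x L :: real
  assumes x: "\<bar>x\<bar> \<le> L" and L: "L \<le> 1/4"
  shows "exp (x - 7 * L\<^sup>2) \<le> 1 + x - 2 * L\<^sup>2"
proof -
  have L0: "0 \<le> L" using x by linarith
  have LL: "L\<^sup>2 \<le> L / 4" unfolding power2_eq_square using mult_left_mono[OF L L0] by simp
  define y where "y = x - 2 * L\<^sup>2"
  have ay: "\<bar>y\<bar> \<le> 3/2 * L" using x LL L0 zero_le_power2[of L] unfolding y_def abs_le_iff by linarith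
  then have y: "\<bar>y\<bar> \<le> 1/2" using L by linarith
  have "y\<^sup>2 \<le> (3/2 * L)\<^sup>2" using ay by (rule power2_le_iff_abs_le[THEN iffD2, rotated]) (use L0 in simp)
  then have "y\<^sup>2 \<le> 9/4 * L\<^sup>2" by (simp add: power2_eq_square)
  moreover have "\<bar>ln (1 + y) - y\<bar> \<le> 2 * y\<^sup>2" by (rule abs_ln_one_plus_x_minus_x_bound[OF y])
  ultimately have "x - 7 * L\<^sup>2 \<le> ln (1 + y)" unfolding y_def abs_le_iff by (simp add: abs_le_iff)
  then have "exp (x - 7 * L\<^sup>2) \<le> 1 + y" using y by (simp add: ln_ge_iff abs_le_iff)
  then show ?thesis by (simp add: y_def)
qed

section \<open>Gaussian shifts, one coordinate at a time\<close>

abbreviation std_gaussian1 :: "real measure" where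
  "std_gaussian1 \<equiv> density lborel (\<lambda>x. ennreal (std_normal_density x))"

lemma prob_space_std_gaussian1: "prob_space std_gaussian1"
  by (rule prob_space_normal_density) simp

lemma measurable_proj: "i < d \<Longrightarrow> (\<lambda>x. x i) \<in> borel_measurable (std_gaussian d)"
  using measurable_component_singleton[of i "{..<d}" "\<lambda>_. std_gaussian1"] by (simp add: std_gaussian_def)

lemma measurable_coord_comp_emb:
  assumes "continuous_on UNIV F"
  shows "(\<lambda>z. coord (F (emb d z)) i) \<in> borel_measurable (std_gaussian d)"
proof -
  have "(\<lambda>y. coord (F y) i) \<in> borel_measurable borel"
    by (intro borel_measurable_continuous_onI continuous_on_compose2[OF continuous_coord[of UNIV] assms]) simp
  from measurable_compose[OF measurable_emb this] show ?thesis by (simp add: std_gaussian_def)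
qed

text \<open>\<open>D i\<close> is the i-th diagonal entry of the derivative of \<open>v\<close>,
  known only as a limit along steps 1/n, which is the form that the increment lemma
  consumes.\<close>

locale lipschitz_shift =
  fixes d :: nat and v :: "l2 \<Rightarrow> l2" and L :: real and D :: "nat \<Rightarrow> l2 \<Rightarrow> real"
  assumes lip: "\<And>x y. norm (v x - v y) \<le> L * norm (x - y)" and L0: "0 \<le> L" and L_le: "L \<le> 1/4"
    and D: "\<And>i x. i < d \<Longrightarrow>
      (\<lambda>n. real n * (coord (v (x + (1 / real n) *\<^sub>R unit_vec i)) i - coord (v x) i)) \<longlonglongrightarrow> D i x"
begin

sublocale product_sigma_finite "\<lambda>_ :: nat. std_gaussian1"
  by (intro product_sigma_finite.intro prob_space_imp_sigma_finite prob_space_std_gaussian1)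

lemma abs_D_le: assumes "i < d" shows "\<bar>D i x\<bar> \<le> L"
proof (rule tendsto_upperbound[OF tendsto_rabs[OF D[OF assms]]])
  have "\<bar>real n * (coord (v (x + (1 / real n) *\<^sub>R unit_vec i)) i - coord (v x) i)\<bar> \<le> L" if "n > 0" for n
  proof -
    have "\<bar>coord (v (x + (1 / real n) *\<^sub>R unit_vec i)) i - coord (v x) i\<bar> \<le> L * (1 / real n)"
      using abs_coord_le_norm[of "v (x + (1 / real n) *\<^sub>R unit_vec i) - v x" i]
        lip[of "x + (1 / real n) *\<^sub>R unit_vec i" x] by simp
    then have "real n * \<bar>coord (v (x + (1 / real n) *\<^sub>R unit_vec i)) i - coord (v x) i\<bar> \<le> real n * (L * (1 / real n))"
      by (rule mult_left_mono) simp
    then show ?thesis using that unfolding abs_mult by simp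
  qed
  then show "\<forall>\<^sub>F n in sequentially. \<bar>real n * (coord (v (x + (1 / real n) *\<^sub>R unit_vec i)) i - coord (v x) i)\<bar> \<le> L"
    by (intro eventually_sequentiallyI[of 1]) simp
qed simp

lemma continuous_v: "continuous_on S v"
  by (rule lipschitz_continuous_on[OF lip])

lemma measurable_coord [measurable]: "(\<lambda>x. coord x i) \<in> borel_measurable borel"
  by (intro borel_measurable_continuous_onI continuous_coord)

lemma measurable_v [measurable]: "v \<in> borel_measurable borel"
  by (intro borel_measurable_continuous_onI continuous_v)

lemma measurable_D [measurable]: assumes "i < d" shows "D i \<in> borel_measurable borel"
proof (rule borel_measurable_LIMSEQ_real[OF D[OF assms]])
  have "(\<lambda>x. v (x + (1 / real n) *\<^sub>R unit_vec i)) \<in> borel_measurable borel" for n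
    by (intro borel_measurable_continuous_onI continuous_on_compose2[OF continuous_v[of UNIV]] continuous_intros) auto
  note [measurable] = measurable_compose[OF this measurable_coord]
  show "(\<lambda>x. real n * (coord (v (x + (1 / real n) *\<^sub>R unit_vec i)) i - coord (v x) i)) \<in> borel_measurable borel" for n
    by measurable
qed

text \<open>Only the first \<open>k\<close> coordinates move, all by the values of \<open>v\<close>
  at the original point. Passing from \<open>k\<close> to \<open>Suc k\<close> thus alters one
  coordinate, and the full map becomes a composition of one-dimensional substitutions.\<close>

definition shift :: "nat \<Rightarrow> l2 \<Rightarrow> l2" where
  "shift k x = x + emb k (coord (v x))"

lemma coord_shift: "coord (shift k x) i = coord x i + (if i < k then coord (v x) i else 0)"
  by (simp add: shift_def)

lemma projected_lip: "norm (emb k (coord (v x)) - emb k (coord (v y))) \<le> L * norm (x - y)"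
proof -
  have "emb k (coord (v x)) - emb k (coord (v y)) = emb k (coord (v x - v y))"
    by (rule l2_eqI) simp
  then show ?thesis using norm_emb_coord_le[of k "v x - v y"] lip[of x y] by simp
qed

lemma shift_expanding: "norm (x - y) \<le> 4/3 * norm (shift k x - shift k y)"
proof -
  have "x - y = (shift k x - shift k y) - (emb k (coord (v x)) - emb k (coord (v y)))"
    by (simp add: shift_def)
  then have "norm (x - y) \<le> norm (shift k x - shift k y) + norm (emb k (coord (v x)) - emb k (coord (v y)))"
    by (metis norm_triangle_ineq4)
  also have "norm (emb k (coord (v x)) - emb k (coord (v y))) \<le> 1/4 * norm (x - y)"
    using projected_lip[of k x y] mult_right_mono[OF L_le norm_ge_zero[of "x - y"]] by linarith
  finally show ?thesis by simp
qed

lemma shift_bij: "\<exists>!x. shift k x = w"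
proof -
  have "\<exists>!x. w - emb k (coord (v x)) = x"
  proof (rule banach_fix_type[where c = "1/4"], simp, simp, intro allI)
    fix x y
    have "dist (w - emb k (coord (v x))) (w - emb k (coord (v y))) = norm (emb k (coord (v x)) - emb k (coord (v y)))"
      by (simp add: dist_norm norm_minus_commute)
    also have "\<dots> \<le> 1/4 * dist x y"
      using projected_lip[of k x y] mult_right_mono[OF L_le norm_ge_zero[of "x - y"]]
      unfolding dist_norm by linarith
    finally show "dist (w - emb k (coord (v x))) (w - emb k (coord (v y))) \<le> 1/4 * dist x y" .
  qed
  moreover have "w - emb k (coord (v x)) = x \<longleftrightarrow> shift k x = w" for x
    unfolding shift_def by (metis add_diff_cancel_right' diff_add_cancel)
  ultimately show ?thesis by simp
qed

definition unshift :: "nat \<Rightarrow> l2 \<Rightarrow> l2" where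
  "unshift k w = (THE x. shift k x = w)"

lemma shift_unshift: "shift k (unshift k w) = w"
  unfolding unshift_def by (rule theI'[OF shift_bij])

lemma unshift_shift: "unshift k (shift k x) = x"
  using shift_bij[of k "shift k x"] shift_unshift by blast

lemma unshift_lip: "norm (unshift k x - unshift k y) \<le> 4/3 * norm (x - y)"
  using shift_expanding[of "unshift k x" "unshift k y" k] by (simp add: shift_unshift)

lemma measurable_unshift: "unshift k \<in> borel_measurable borel"
  by (rule borel_measurable_continuous_onI) (rule lipschitz_continuous_on[OF unshift_lip])

text \<open>The ratio of the Gaussian densities after and before the shift of coordinate
  \<open>i\<close>, times the lower bound for its slope supplied by
  \<open>one_plus_ge_exp\<close>.\<close>

definition weight :: "nat \<Rightarrow> l2 \<Rightarrow> real" where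
  "weight i x = std_normal_density (coord x i + coord (v x) i) / std_normal_density (coord x i)
     * exp (D i x - 7 * L\<^sup>2)"

lemma measurable_weight [measurable]: assumes "i < d" shows "weight i \<in> borel_measurable borel"
proof -
  note [measurable] = measurable_D[OF assms] measurable_compose[OF measurable_v measurable_coord]
  show ?thesis unfolding weight_def[abs_def] by measurable
qed

lemma emb_measurable: "emb d \<in> borel_measurable (Pi\<^sub>M {..<d} (\<lambda>_. std_gaussian1))"
  by (rule measurable_emb) simp

text \<open>\<open>\<zeta> t\<close> recovers the original point from its image under
  \<open>shift k\<close>; its coordinate \<open>k\<close> has not moved yet and equals
  \<open>t\<close>. The slope of \<open>g\<close> differs from 1 + D k only because the earlier
  coordinates of the original point vary with \<open>t\<close>, an effect of second order in
  \<open>L\<close>.\<close>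

lemma one_coordinate:
  fixes x :: "nat \<Rightarrow> real"
  assumes k: "k < d" and f: "f \<in> borel_measurable std_gaussian1"
  defines "\<zeta> \<equiv> \<lambda>t. unshift k (emb d (x(k := t)))"
  defines "g \<equiv> \<lambda>t. t + coord (v (\<zeta> t)) k"
  shows "(\<integral>\<^sup>+ t. f (g t) * ennreal (weight k (\<zeta> t)) \<partial>std_gaussian1) \<le> (\<integral>\<^sup>+ t. f t \<partial>std_gaussian1)"
proof -
  have coord_\<zeta>: "coord (\<zeta> t) k = t" for t
    using coord_shift[of k "\<zeta> t" k] k by (simp add: \<zeta>_def shift_unshift)
  have emb_upd: "emb d (x(k := t)) - emb d (x(k := s)) = (t - s) *\<^sub>R unit_vec k" for s t
    by (rule l2_eqI) (use k in auto)
  have \<zeta>_lip: "norm (\<zeta> t - \<zeta> s) \<le> 4/3 * norm (t - s)" for s t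
    using unshift_lip[of k "emb d (x(k := t))" "emb d (x(k := s))"] by (simp add: \<zeta>_def emb_upd)
  have v\<zeta>: "norm (v (\<zeta> t) - v (\<zeta> s)) \<le> L * (4/3 * \<bar>t - s\<bar>)" for s t
    using lip[of "\<zeta> t" "\<zeta> s"] mult_left_mono[OF \<zeta>_lip[of t s] L0] by simp
  have cv: "\<bar>coord (v (\<zeta> t)) k - coord (v (\<zeta> s)) k\<bar> \<le> 1/3 * \<bar>t - s\<bar>" for s t
  proof -
    have "\<bar>coord (v (\<zeta> t)) k - coord (v (\<zeta> s)) k\<bar> \<le> norm (v (\<zeta> t) - v (\<zeta> s))"
      using abs_coord_le_norm[of "v (\<zeta> t) - v (\<zeta> s)" k] by simp
    also have "\<dots> \<le> L * (4/3 * \<bar>t - s\<bar>)" by (rule v\<zeta>)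
    also have "\<dots> \<le> 1/4 * (4/3 * \<bar>t - s\<bar>)" by (rule mult_right_mono[OF L_le]) simp
    finally show ?thesis by simp
  qed
  have cont\<zeta>: "continuous_on S \<zeta>" for S
    by (rule lipschitz_continuous_on[OF \<zeta>_lip])
  have [measurable]: "\<zeta> \<in> borel_measurable borel"
    by (intro borel_measurable_continuous_onI cont\<zeta>)
  note [measurable] = measurable_D[OF k] measurable_weight[OF k] measurable_compose[OF measurable_v measurable_coord]
  define \<psi> where "\<psi> t = exp (D k (\<zeta> t) - 7 * L\<^sup>2)" for t
  have "(\<integral>\<^sup>+ t. f (g t) * ennreal (weight k (\<zeta> t)) \<partial>std_gaussian1)
      = (\<integral>\<^sup>+ t. f (g t) * ennreal (std_normal_density (g t) / std_normal_density t * \<psi> t) \<partial>std_gaussian1)"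
    by (simp add: weight_def coord_\<zeta> g_def \<psi>_def)
  also have "\<dots> \<le> (\<integral>\<^sup>+ t. f t \<partial>std_gaussian1)"
  proof (rule nn_integral_gaussian_substitution_le)
    show "(t - s) / 2 \<le> g t - g s" if "s \<le> t" for s t
    proof -
      have c: "\<bar>coord (v (\<zeta> t)) k - coord (v (\<zeta> s)) k\<bar> \<le> (t - s) / 3" using cv[of t s] that by simp
      show ?thesis
        using abs_le_D1[OF c] abs_le_D2[OF c] that unfolding g_def by (simp add: field_simps)
    qed
    show "g t - g s \<le> 2 * (t - s)" if "s \<le> t" for s t
    proof -
      have c: "\<bar>coord (v (\<zeta> t)) k - coord (v (\<zeta> s)) k\<bar> \<le> (t - s) / 3" using cv[of t s] that by simp
      show ?thesis
        using abs_le_D1[OF c] abs_le_D2[OF c] that unfolding g_def by (simp add: field_simps)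
    qed
    show "\<psi> \<in> borel_measurable borel" unfolding \<psi>_def[abs_def] by measurable
    show "g \<in> borel_measurable borel" unfolding g_def by measurable
    show "f \<in> borel_measurable borel" using f by simp
    fix t e :: real assume "0 < e"
    define r where "r n = real n * (coord (v (\<zeta> t + (1 / real n) *\<^sub>R unit_vec k)) k - coord (v (\<zeta> t)) k)" for n
    have "r \<longlonglongrightarrow> D k (\<zeta> t)" unfolding r_def[abs_def] by (rule D[OF k])
    then have ev: "\<forall>\<^sub>F n in sequentially. D k (\<zeta> t) - e < r n"
      by (rule order_tendstoD) (use \<open>0 < e\<close> in simp)
    \<comment> \<open>A step \<tau> moves \<open>\<zeta>\<close> by \<tau> times the unit vector, up
      to an error of norm 4/3 L \<tau>; applying \<open>v\<close> costs another factor
      \<open>L\<close>, and 4/3 L^2 is rounded to 2 L^2.\<close>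
    have inc: "1 - 2 * L\<^sup>2 + r n \<le> real n * (g (t + 1 / real n) - g t)" if "n > 0" for n
    proof -
      define \<tau> where "\<tau> = 1 / real n"
      have \<tau>: "0 < \<tau>" "real n * \<tau> = 1" using that by (auto simp: \<tau>_def)
      have "\<zeta> (t + \<tau>) - (\<zeta> t + \<tau> *\<^sub>R unit_vec k)
          = - (emb k (coord (v (\<zeta> (t + \<tau>)))) - emb k (coord (v (\<zeta> t))))"
      proof -
        have "(shift k (\<zeta> (t + \<tau>)) - shift k (\<zeta> t)) = \<tau> *\<^sub>R unit_vec k"
          using emb_upd[of "t + \<tau>" t] by (simp add: \<zeta>_def shift_unshift)
        then show ?thesis by (simp add: shift_def algebra_simps)
      qed
      then have "norm (\<zeta> (t + \<tau>) - (\<zeta> t + \<tau> *\<^sub>R unit_vec k)) \<le> L * norm (\<zeta> (t + \<tau>) - \<zeta> t)"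
        using projected_lip[of k "\<zeta> (t + \<tau>)" "\<zeta> t"] by (simp only: norm_minus_cancel)
      also have "\<dots> \<le> L * (4/3 * \<tau>)"
        using \<zeta>_lip[of "t + \<tau>" t] \<tau> by (intro mult_left_mono L0) simp
      finally have "norm (v (\<zeta> (t + \<tau>)) - v (\<zeta> t + \<tau> *\<^sub>R unit_vec k)) \<le> L * (L * (4/3 * \<tau>))"
        using lip[of "\<zeta> (t + \<tau>)" "\<zeta> t + \<tau> *\<^sub>R unit_vec k"] L0
        by (meson mult_left_mono order_trans)
      also have "\<dots> \<le> 2 * L\<^sup>2 * \<tau>"
        using \<tau> L0 by (simp add: power2_eq_square)
      finally have "- (2 * L\<^sup>2 * \<tau>) \<le> coord (v (\<zeta> (t + \<tau>))) k - coord (v (\<zeta> t + \<tau> *\<^sub>R unit_vec k)) k"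
        using abs_coord_le_norm[of "v (\<zeta> (t + \<tau>)) - v (\<zeta> t + \<tau> *\<^sub>R unit_vec k)" k]
        by simp
      then have "\<tau> - 2 * L\<^sup>2 * \<tau> + (coord (v (\<zeta> t + \<tau> *\<^sub>R unit_vec k)) k - coord (v (\<zeta> t)) k) \<le> g (t + \<tau>) - g t"
        by (simp add: g_def)
      then have "real n * (\<tau> - 2 * L\<^sup>2 * \<tau> + (coord (v (\<zeta> t + \<tau> *\<^sub>R unit_vec k)) k - coord (v (\<zeta> t)) k))
          \<le> real n * (g (t + \<tau>) - g t)" by (rule mult_left_mono) simp
      also have "real n * (\<tau> - 2 * L\<^sup>2 * \<tau> + (coord (v (\<zeta> t + \<tau> *\<^sub>R unit_vec k)) k - coord (v (\<zeta> t)) k))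
          = (real n * \<tau>) - 2 * L\<^sup>2 * (real n * \<tau>) + r n"
        by (simp add: r_def \<tau>_def algebra_simps)
      finally show ?thesis unfolding \<tau>(2) by (simp add: \<tau>_def)
    qed
    have \<psi>_le: "\<psi> t \<le> 1 + D k (\<zeta> t) - 2 * L\<^sup>2"
      unfolding \<psi>_def by (rule one_plus_ge_exp[OF abs_D_le[OF k] L_le])
    show "\<forall>\<^sub>F n in sequentially. \<psi> t - e \<le> real n * (g (t + 1 / real n) - g t)"
      using ev eventually_gt_at_top[of 0]
    proof eventually_elim
      case (elim n)
      then show ?case using inc[of n] \<psi>_le by linarith
    qed
  qed
  finally show ?thesis .
qed

text \<open>The induction varies \<open>f\<close>: the last substitution, with its weight, is
  absorbed into a new integrand on the points already moved, to which the induction hypothesis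
  applies. Integrating over coordinate \<open>k\<close> first then reduces that integrand to
  \<open>one_coordinate\<close>. This triangular factorisation takes the place of a
  determinant.\<close>

lemma gaussian_shift_partial:
  assumes "k \<le> d" and f: "f \<in> borel_measurable (Pi\<^sub>M {..<d} (\<lambda>_. std_gaussian1))"
  shows "(\<integral>\<^sup>+ z. f (res d (shift k (emb d z))) * (\<Prod>i<k. ennreal (weight i (emb d z))) \<partial>Pi\<^sub>M {..<d} (\<lambda>_. std_gaussian1))
    \<le> (\<integral>\<^sup>+ z. f z \<partial>Pi\<^sub>M {..<d} (\<lambda>_. std_gaussian1))"
  using assms
proof (induction k arbitrary: f)
  case 0
  have "res d (shift 0 (emb d z)) = z" if "z \<in> space (Pi\<^sub>M {..<d} (\<lambda>_. std_gaussian1))" for z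
    using that by (auto simp: res_def coord_shift space_PiM PiE_def extensional_def)
  then show ?case by (intro nn_integral_mono) simp
next
  case (Suc k)
  then have k: "k < d" "k \<le> d" by auto
  let ?\<gamma> = "Pi\<^sub>M {..<d} (\<lambda>_. std_gaussian1)"
  note [measurable] = \<open>f \<in> borel_measurable ?\<gamma>\<close>
  define y where "y w = unshift k (emb d w)" for w
  \<comment> \<open>The weight and the shift of coordinate \<open>k\<close> depend on the original
    point, which \<open>unshift k\<close> recovers from the moved one.\<close>
  define h where "h w = f (w(k := w k + coord (v (y w)) k)) * ennreal (weight k (y w))" for w
  have y[measurable]: "y \<in> borel_measurable ?\<gamma>"
    unfolding y_def[abs_def] by (rule measurable_compose[OF emb_measurable measurable_unshift])
  have wk[measurable]: "(\<lambda>w. w k) \<in> borel_measurable ?\<gamma>"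
    using measurable_component_singleton[of k "{..<d}" "\<lambda>_. std_gaussian1"] k by simp
  have upd[measurable]: "(\<lambda>w. w(k := w k + coord (v (y w)) k)) \<in> measurable ?\<gamma> ?\<gamma>"
  proof (rule measurable_fun_upd[where J = "{..<d}"])
    show "{..<d} = {..<d} \<union> {k}" using k by auto
    have "(\<lambda>w. coord (v (y w)) k) \<in> borel_measurable ?\<gamma>"
      by (rule measurable_compose[OF y measurable_compose[OF measurable_v measurable_coord]])
    then show "(\<lambda>w. w k + coord (v (y w)) k) \<in> measurable ?\<gamma> std_gaussian1" by simp
  qed simp
  have hm: "h \<in> borel_measurable ?\<gamma>"
    unfolding h_def[abs_def]
    by (intro borel_measurable_times_ennreal measurable_compose[OF upd] Suc.prems
        measurable_compose[OF measurable_compose[OF y measurable_weight[OF k(1)]]] ) simp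
  have step: "f (res d (shift (Suc k) (emb d z))) * ennreal (weight k (emb d z)) = h (res d (shift k (emb d z)))" for z
  proof -
    have e: "emb d (res d (shift k (emb d z))) = shift k (emb d z)"
      using k by (intro l2_eqI) (auto simp: res_def coord_shift)
    then have yz: "y (res d (shift k (emb d z))) = emb d z"
      by (simp add: y_def unshift_shift)
    have "(res d (shift k (emb d z)))(k := res d (shift k (emb d z)) k + coord (v (emb d z)) k) = res d (shift (Suc k) (emb d z))"
      using k by (auto simp: res_def coord_shift fun_eq_iff less_Suc_eq)
    then show ?thesis by (simp add: h_def yz)
  qed
  have "(\<integral>\<^sup>+ z. f (res d (shift (Suc k) (emb d z))) * (\<Prod>i<Suc k. ennreal (weight i (emb d z))) \<partial>?\<gamma>)
      = (\<integral>\<^sup>+ z. h (res d (shift k (emb d z))) * (\<Prod>i<k. ennreal (weight i (emb d z))) \<partial>?\<gamma>)"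
    by (simp add: step[symmetric] mult_ac)
  also have "\<dots> \<le> (\<integral>\<^sup>+ w. h w \<partial>?\<gamma>)" by (rule Suc.IH[OF k(2) hm])
  also have "\<dots> \<le> (\<integral>\<^sup>+ w. f w \<partial>?\<gamma>)"
  proof -
    define I where "I = {..<d} - {k}"
    have I: "finite I" "k \<notin> I" "{..<d} = insert k I" using k by (auto simp: I_def)
    have "(\<integral>\<^sup>+ t. h (x(k := t)) \<partial>std_gaussian1) \<le> (\<integral>\<^sup>+ t. f (x(k := t)) \<partial>std_gaussian1)"
      if x: "x \<in> space (Pi\<^sub>M I (\<lambda>_. std_gaussian1))" for x
    proof -
      have "(\<lambda>t. x(k := t)) \<in> measurable std_gaussian1 ?\<gamma>"
        by (rule measurable_fun_upd[where J = I]) (use I x in auto)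
      then have "(\<lambda>t. f (x(k := t))) \<in> borel_measurable std_gaussian1"
        by (rule measurable_compose) (rule Suc.prems)
      from one_coordinate[OF k(1) this, of x] show ?thesis by (simp add: h_def y_def)
    qed
    then have "(\<integral>\<^sup>+ x. (\<integral>\<^sup>+ t. h (x(k := t)) \<partial>std_gaussian1) \<partial>Pi\<^sub>M I (\<lambda>_. std_gaussian1))
        \<le> (\<integral>\<^sup>+ x. (\<integral>\<^sup>+ t. f (x(k := t)) \<partial>std_gaussian1) \<partial>Pi\<^sub>M I (\<lambda>_. std_gaussian1))"
      by (rule nn_integral_mono)
    then show ?thesis
      using product_nn_integral_insert[OF I(1,2), of h] product_nn_integral_insert[OF I(1,2), of f]
        hm Suc.prems(2) by (simp add: I(3))
  qed
  finally show ?case .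
qed

theorem gaussian_shift:
  assumes f: "f \<in> borel_measurable (std_gaussian d)"
  shows "(\<integral>\<^sup>+ z. f (\<lambda>i\<in>{..<d}. z i + coord (v (emb d z)) i) * (\<Prod>i<d. ennreal (weight i (emb d z))) \<partial>std_gaussian d)
    \<le> (\<integral>\<^sup>+ z. f z \<partial>std_gaussian d)"
proof -
  have "res d (shift d (emb d z)) = (\<lambda>i\<in>{..<d}. z i + coord (v (emb d z)) i)" for z
    by (auto simp: res_def coord_shift fun_eq_iff)
  then show ?thesis
    using gaussian_shift_partial[of d f] f by (simp add: std_gaussian_def)
qed

lemma weight_eq_exp:
  "weight i x = exp (D i x - 7 * L\<^sup>2 - coord x i * coord (v x) i - (coord (v x) i)\<^sup>2 / 2)"
proof -
  have "std_normal_density (s + t) / std_normal_density s = exp (- (s * t) - t\<^sup>2 / 2)" for s t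
  proof -
    have "std_normal_density (s + t) / std_normal_density s = exp (- (s + t)\<^sup>2 / 2) / exp (- s\<^sup>2 / 2)"
      by (simp add: std_normal_density_def)
    also have "\<dots> = exp (- (s * t) - t\<^sup>2 / 2)"
      by (simp add: exp_diff[symmetric] power2_eq_square field_simps)
    finally show ?thesis .
  qed
  then show ?thesis by (simp add: weight_def exp_add[symmetric] algebra_simps)
qed

corollary gaussian_shift_exp:
  assumes f: "f \<in> borel_measurable (std_gaussian d)"
  shows "(\<integral>\<^sup>+ z. f (\<lambda>i\<in>{..<d}. z i + coord (v (emb d z)) i) * ennreal (exp (\<Sum>i<d. D i (emb d z) - 7 * L\<^sup>2
      - z i * coord (v (emb d z)) i - (coord (v (emb d z)) i)\<^sup>2 / 2)) \<partial>std_gaussian d)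
    \<le> (\<integral>\<^sup>+ z. f z \<partial>std_gaussian d)"
proof -
  have "ennreal (exp (\<Sum>i<d. D i (emb d z) - 7 * L\<^sup>2 - z i * coord (v (emb d z)) i - (coord (v (emb d z)) i)\<^sup>2 / 2))
      = (\<Prod>i<d. ennreal (weight i (emb d z)))" for z
    by (subst prod_ennreal) (auto simp: weight_eq_exp exp_sum intro!: arg_cong[where f = ennreal] prod.cong)
  then show ?thesis using gaussian_shift[OF f] by simp
qed

end

section \<open>Renyi divergence of perturbed Gaussian images\<close>

text \<open>Young's inequality with exponents q / (q - 1) and q for the factors s^q w and w^(1 - q),
  chosen so that the powers of \<open>w\<close> cancel in the product.\<close>

lemma young_powr:
  fixes s w q :: real
  assumes "1 < q" "0 \<le> s" "0 < w"
  shows "s powr (q - 1) \<le> (1 - 1 / q) * (s powr q * w) + (1 / q) * w powr (1 - q)"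
proof (cases "s = 0")
  case False
  then have s: "0 < s" using assms by simp
  have "(s powr q * w) powr (1 - 1 / q) * (w powr (1 - q)) powr (1 / q)
      \<le> (1 - 1 / q) * (s powr q * w) + (1 / q) * w powr (1 - q)"
    by (rule Youngs_inequality_0) (use assms s in \<open>auto simp: field_simps\<close>)
  moreover have "(s powr q * w) powr (1 - 1 / q) * (w powr (1 - q)) powr (1 / q) = s powr (q - 1)"
  proof -
    have "(s powr q * w) powr (1 - 1 / q) * (w powr (1 - q)) powr (1 / q)
        = s powr (q * (1 - 1 / q)) * (w powr (1 - 1 / q) * w powr ((1 - q) * (1 / q)))"
      using assms s by (simp add: powr_mult powr_powr)
    also have "w powr (1 - 1 / q) * w powr ((1 - q) * (1 / q)) = w powr 0"
      unfolding powr_add[symmetric] by (rule arg_cong[where f = "(powr) w"]) (use assms in \<open>simp add: field_simps\<close>)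
    also have "q * (1 - 1 / q) = q - 1" using assms by (simp add: field_simps)
    finally show ?thesis using assms by simp
  qed
  ultimately show ?thesis by simp
qed (use assms in simp)

text \<open>With \<open>r\<close> the density, the integral of r^q under \<nu> is that of r^(q - 1)
  under \<mu>, hence an integral along \<open>\<Theta>\<close> under \<open>\<kappa>\<close>.
  Young's inequality splits it into r^q W, which \<open>change\<close> returns to the original
  moment with the factor 1 - 1/q, and W^(1 - q), which \<open>moment\<close> bounds. Absorbing the
  first part bounds the moment while the density itself stays unknown.\<close>

lemma renyi_div_pushforward_le:
  fixes \<kappa> :: "'a measure" and N :: "'b measure" and q B :: real
  assumes "prob_space \<kappa>" and q: "1 < q" and B: "0 \<le> B"
    and \<Psi>[measurable]: "\<Psi> \<in> measurable \<kappa> N" and \<Theta>[measurable]: "\<Theta> \<in> measurable \<kappa> \<kappa>"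
    and W[measurable]: "W \<in> borel_measurable \<kappa>" and W_pos: "\<And>x. (0::real) < W x"
    and change: "\<And>f. f \<in> borel_measurable \<kappa> \<Longrightarrow> (\<integral>\<^sup>+ x. f (\<Theta> x) * ennreal (W x) \<partial>\<kappa>) \<le> (\<integral>\<^sup>+ x. f x \<partial>\<kappa>)"
    and moment: "(\<integral>\<^sup>+ x. ennreal (W x powr (1 - q)) \<partial>\<kappa>) \<le> ennreal (exp ((q - 1) * B))"
  shows "renyi_div q (distr \<kappa> N (\<lambda>x. \<Psi> (\<Theta> x))) (distr \<kappa> N \<Psi>) \<le> ereal B"
proof -
  define \<mu> where "\<mu> = distr \<kappa> N (\<lambda>x. \<Psi> (\<Theta> x))"
  define \<nu> where "\<nu> = distr \<kappa> N \<Psi>"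
  interpret \<nu>: prob_space \<nu>
    unfolding \<nu>_def by (rule prob_space.prob_space_distr[OF \<open>prob_space \<kappa>\<close> \<Psi>])
  have sets[measurable_cong, simp]: "sets \<mu> = sets N" "sets \<nu> = sets N" by (simp_all add: \<mu>_def \<nu>_def)
  have int\<mu>: "(\<integral>\<^sup>+ y. f y \<partial>\<mu>) = (\<integral>\<^sup>+ x. f (\<Psi> (\<Theta> x)) \<partial>\<kappa>)"
    and int\<nu>: "(\<integral>\<^sup>+ y. f y \<partial>\<nu>) = (\<integral>\<^sup>+ x. f (\<Psi> x) \<partial>\<kappa>)" if [measurable]: "f \<in> borel_measurable N" for f
    by (simp_all add: \<mu>_def \<nu>_def nn_integral_distr)
  have ac: "absolutely_continuous \<nu> \<mu>"
    unfolding absolutely_continuous_def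
  proof
    fix A assume A: "A \<in> null_sets \<nu>"
    then have [measurable]: "A \<in> sets N" by (auto simp: null_sets_def)
    have "(\<integral>\<^sup>+ x. indicator A (\<Psi> (\<Theta> x)) * ennreal (W x) \<partial>\<kappa>) \<le> (\<integral>\<^sup>+ x. indicator A (\<Psi> x) \<partial>\<kappa>)"
      by (rule change[of "\<lambda>x. indicator A (\<Psi> x)"]) measurable
    also have "\<dots> = emeasure \<nu> A" using int\<nu>[of "indicator A"] by simp
    also have "\<dots> = 0" using A by auto
    finally have "(\<integral>\<^sup>+ x. indicator A (\<Psi> (\<Theta> x)) * ennreal (W x) \<partial>\<kappa>) = 0" by simp
    then have "AE x in \<kappa>. indicator A (\<Psi> (\<Theta> x)) * ennreal (W x) = 0"
      by (subst (asm) nn_integral_0_iff_AE) auto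
    then have ae: "AE x in \<kappa>. (indicator A (\<Psi> (\<Theta> x)) :: ennreal) = 0"
      using W_pos by (auto simp: ennreal_eq_0_iff not_le[symmetric] elim!: eventually_mono)
    have "emeasure \<mu> A = (\<integral>\<^sup>+ x. indicator A (\<Psi> (\<Theta> x)) \<partial>\<kappa>)" using int\<mu>[of "indicator A"] by simp
    also have "\<dots> = 0" using ae by (subst nn_integral_0_iff_AE) auto
    finally show "A \<in> null_sets \<mu>" by (simp add: null_sets_def)
  qed
  define \<rho> where "\<rho> = RN_deriv \<nu> \<mu>"
  define r where "r y = enn2real (\<rho> y)" for y
  have [measurable]: "\<rho> \<in> borel_measurable N"
    using borel_measurable_RN_deriv[of \<nu> \<mu>] by (simp add: \<rho>_def)
  then have [measurable]: "r \<in> borel_measurable N" unfolding r_def by measurable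
  have dens: "density \<nu> \<rho> = \<mu>"
    unfolding \<rho>_def by (rule \<nu>.density_RN_deriv[OF ac]) simp
  \<comment> \<open>Absorption requires a finite moment, so the density is truncated at n; Fatou's
    lemma removes the truncation at the end.\<close>
  define J where "J n = (\<integral>\<^sup>+ y. ennreal (min (r y) (real n) powr q) \<partial>\<nu>)" for n
  have J_le: "J n \<le> ennreal (exp ((q - 1) * B))" for n
  proof -
    define s where "s y = min (r y) (real n)" for y
    have s0: "0 \<le> s y" for y by (simp add: s_def r_def)
    have [measurable]: "s \<in> borel_measurable N" unfolding s_def by measurable
    have "J n \<le> (\<integral>\<^sup>+ y. ennreal (real n powr q) \<partial>\<nu>)"
      unfolding J_def s_def[symmetric]
      by (intro nn_integral_mono ennreal_leI powr_mono2) (use q s0 in \<open>auto simp: s_def\<close>)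
    then have fin: "J n < top" by (auto simp: \<nu>.emeasure_space_1 intro: le_less_trans)
    have "J n \<le> (\<integral>\<^sup>+ y. ennreal (s y powr (q - 1)) * \<rho> y \<partial>\<nu>)"
      unfolding J_def s_def[symmetric]
    proof (rule nn_integral_mono)
      fix y
      have "s y powr q = s y powr (q - 1) * s y"
        using s0[of y] powr_mult_base[of "s y" "q - 1"] by (cases "s y = 0") (auto simp: mult.commute)
      then have "ennreal (s y powr q) = ennreal (s y powr (q - 1)) * ennreal (s y)"
        by (simp add: ennreal_mult s0)
      also have "ennreal (s y) \<le> \<rho> y"
        by (cases "\<rho> y") (auto simp: s_def r_def ennreal_leI)
      finally show "ennreal (s y powr q) \<le> ennreal (s y powr (q - 1)) * \<rho> y"
        by (simp add: mult_left_mono)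
    qed
    also have "\<dots> = (\<integral>\<^sup>+ y. ennreal (s y powr (q - 1)) \<partial>\<mu>)"
      unfolding dens[symmetric] by (subst nn_integral_density) (auto simp: mult.commute)
    also have "\<dots> = (\<integral>\<^sup>+ x. ennreal (s (\<Psi> (\<Theta> x)) powr (q - 1)) \<partial>\<kappa>)"
      by (rule int\<mu>) measurable
    also have "\<dots> \<le> (\<integral>\<^sup>+ x. ennreal (1 - 1 / q) * (ennreal (s (\<Psi> (\<Theta> x)) powr q) * ennreal (W x))
        + ennreal (1 / q) * ennreal (W x powr (1 - q)) \<partial>\<kappa>)"
    proof (rule nn_integral_mono)
      fix x
      have "ennreal (s (\<Psi> (\<Theta> x)) powr (q - 1))
          \<le> ennreal ((1 - 1 / q) * (s (\<Psi> (\<Theta> x)) powr q * W x) + (1 / q) * W x powr (1 - q))"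
        by (intro ennreal_leI young_powr q s0 W_pos)
      also have "\<dots> = ennreal (1 - 1 / q) * (ennreal (s (\<Psi> (\<Theta> x)) powr q) * ennreal (W x))
          + ennreal (1 / q) * ennreal (W x powr (1 - q))"
      proof -
        have "ennreal (a * (t * w) + b * e) = ennreal a * (ennreal t * ennreal w) + ennreal b * ennreal e"
          if "0 \<le> a" "0 \<le> b" "0 \<le> t" "0 \<le> w" "0 \<le> e" for a b t w e
          using that by (simp add: ennreal_mult ennreal_plus)
        then show ?thesis using q W_pos[of x] by (simp add: less_imp_le del: times_divide_eq_left)
      qed
      finally show "ennreal (s (\<Psi> (\<Theta> x)) powr (q - 1))
          \<le> ennreal (1 - 1 / q) * (ennreal (s (\<Psi> (\<Theta> x)) powr q) * ennreal (W x))
            + ennreal (1 / q) * ennreal (W x powr (1 - q))" .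
    qed
    also have "\<dots> = ennreal (1 - 1 / q) * (\<integral>\<^sup>+ x. ennreal (s (\<Psi> (\<Theta> x)) powr q) * ennreal (W x) \<partial>\<kappa>)
        + ennreal (1 / q) * (\<integral>\<^sup>+ x. ennreal (W x powr (1 - q)) \<partial>\<kappa>)"
      by (subst nn_integral_add) (auto simp: nn_integral_cmult)
    also have "\<dots> \<le> ennreal (1 - 1 / q) * J n + ennreal (1 / q) * ennreal (exp ((q - 1) * B))"
    proof (intro add_mono mult_left_mono moment)
      have "(\<integral>\<^sup>+ x. ennreal (s (\<Psi> (\<Theta> x)) powr q) * ennreal (W x) \<partial>\<kappa>) \<le> (\<integral>\<^sup>+ x. ennreal (s (\<Psi> x) powr q) \<partial>\<kappa>)"
        by (rule change[of "\<lambda>x. ennreal (s (\<Psi> x) powr q)"]) measurable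
      also have "\<dots> = J n" unfolding J_def s_def[symmetric] by (rule int\<nu>[symmetric]) measurable
      finally show "(\<integral>\<^sup>+ x. ennreal (s (\<Psi> (\<Theta> x)) powr q) * ennreal (W x) \<partial>\<kappa>) \<le> J n" .
    qed auto
    finally have main: "J n \<le> ennreal (1 - 1 / q) * J n + ennreal (1 / q) * ennreal (exp ((q - 1) * B))" .
    obtain j where j: "J n = ennreal j" "0 \<le> j" using fin by (cases "J n") auto
    have "j \<le> (1 - 1 / q) * j + (1 / q) * exp ((q - 1) * B)"
      using main q j by (simp add: ennreal_mult[symmetric] ennreal_plus[symmetric] ennreal_le_iff del: ennreal_plus)
    then have "j \<le> exp ((q - 1) * B)" using q by (simp add: field_simps)
    then show ?thesis using j by (simp add: ennreal_leI)
  qed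
  have "renyi_integral q \<mu> \<nu> \<le> (\<integral>\<^sup>+ y. liminf (\<lambda>n. ennreal (min (r y) (real n) powr q)) \<partial>\<nu>)"
    unfolding renyi_integral_def \<rho>_def[symmetric] r_def[symmetric]
  proof (rule nn_integral_mono, rule Liminf_bounded)
    fix y
    have "\<forall>\<^sub>F n in sequentially. r y \<le> real n"
      using eventually_ge_at_top[of "nat \<lceil>r y\<rceil>"] by eventually_elim linarith
    then show "\<forall>\<^sub>F n in sequentially. ennreal (r y powr q) \<le> ennreal (min (r y) (real n) powr q)"
      by eventually_elim simp
  qed
  also have "\<dots> \<le> liminf J"
    unfolding J_def[abs_def] by (rule nn_integral_liminf) measurable
  also have "\<dots> \<le> liminf (\<lambda>n :: nat. ennreal (exp ((q - 1) * B)))"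
    by (intro Liminf_mono always_eventually allI J_le)
  also have "\<dots> = ennreal (exp ((q - 1) * B))" by (simp add: Liminf_const)
  finally have I: "renyi_integral q \<mu> \<nu> \<le> ennreal (exp ((q - 1) * B))" .
  then have fin: "renyi_integral q \<mu> \<nu> \<noteq> \<infinity>" by (auto simp: top_unique)
  define j where "j = enn2real (renyi_integral q \<mu> \<nu>)"
  have j: "0 \<le> j" "j \<le> exp ((q - 1) * B)"
    using I by (auto simp: j_def intro!: enn2real_leI)
  \<comment> \<open>For j = 0 the convention \<open>ln 0 = 0\<close> turns the claim into
    non-negativity of \<open>B\<close>.\<close>
  have "ln j \<le> (q - 1) * B"
  proof (cases "j = 0")
    case False
    then have "ln j \<le> ln (exp ((q - 1) * B))" using j by (intro ln_mono) auto
    then show ?thesis by simp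
  qed (use q B in simp)
  then have "1 / (q - 1) * ln j \<le> B" using q by (simp add: field_simps)
  then show ?thesis
    unfolding \<mu>_def[symmetric] \<nu>_def[symmetric] renyi_div_def using ac fin by (simp add: j_def)
qed

section \<open>Perturbing a pair of independent noises\<close>

lemma prob_space_std_gaussian: "prob_space (std_gaussian d)"
  unfolding std_gaussian_def by (rule prob_space_PiM) (rule prob_space_std_gaussian1)

text \<open>For the second noise: its shift depends on the first noise only, so conditionally it is
  a translation, and the change of variables is of Cameron-Martin type.\<close>

lemma lipschitz_shift_const: "lipschitz_shift d (\<lambda>_. c) 0 (\<lambda>_ _. 0)"
  by standard auto

definition gaussian_map :: "nat \<Rightarrow> (l2 \<Rightarrow> l2) \<Rightarrow> (l2 \<Rightarrow> l2) \<Rightarrow>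
    (nat \<Rightarrow> real) \<times> (nat \<Rightarrow> real) \<Rightarrow> (nat \<Rightarrow> real) \<times> (nat \<Rightarrow> real)" where
  "gaussian_map d v u = (\<lambda>(x, y). (\<lambda>i\<in>{..<d}. x i + coord (v (emb d x)) i, \<lambda>i\<in>{..<d}. y i + coord (u (emb d x)) i))"

text \<open>Logarithm of the product of all coordinate weights of both noises; the second noise
  contributes with divergence and Lipschitz constant 0.\<close>

definition log_weight :: "nat \<Rightarrow> (l2 \<Rightarrow> l2) \<Rightarrow> (l2 \<Rightarrow> l2) \<Rightarrow> (nat \<Rightarrow> l2 \<Rightarrow> real) \<Rightarrow> real \<Rightarrow>
    (nat \<Rightarrow> real) \<times> (nat \<Rightarrow> real) \<Rightarrow> real" where
  "log_weight d v u D L = (\<lambda>(x, y).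
     (\<Sum>i<d. D i (emb d x) - 7 * L\<^sup>2 - x i * coord (v (emb d x)) i - (coord (v (emb d x)) i)\<^sup>2 / 2)
     + (\<Sum>i<d. - (y i * coord (u (emb d x)) i) - (coord (u (emb d x)) i)\<^sup>2 / 2))"

context lipschitz_shift
begin

context
  fixes u :: "l2 \<Rightarrow> l2" assumes u: "continuous_on UNIV u"
begin

lemmas measurable_coord_u = measurable_coord_comp_emb[OF u]
lemmas measurable_coord_v = measurable_coord_comp_emb[OF continuous_v]

lemma measurable_gaussian_map:
  "gaussian_map d v u \<in> measurable (std_gaussian d \<Otimes>\<^sub>M std_gaussian d) (std_gaussian d \<Otimes>\<^sub>M std_gaussian d)"
proof -
  note [measurable] = measurable_coord_u measurable_coord_v measurable_proj
  have 1: "(\<lambda>z. \<lambda>i\<in>{..<d}. fst z i + coord (v (emb d (fst z))) i)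
      \<in> measurable (std_gaussian d \<Otimes>\<^sub>M std_gaussian d) (Pi\<^sub>M {..<d} (\<lambda>_. std_gaussian1))"
    by (rule measurable_restrict) (simp; measurable)
  have 2: "(\<lambda>z. \<lambda>i\<in>{..<d}. snd z i + coord (u (emb d (fst z))) i)
      \<in> measurable (std_gaussian d \<Otimes>\<^sub>M std_gaussian d) (Pi\<^sub>M {..<d} (\<lambda>_. std_gaussian1))"
    by (rule measurable_restrict) (simp; measurable)
  show ?thesis
    using measurable_Pair[OF 1 2] by (simp add: gaussian_map_def case_prod_beta' std_gaussian_def)
qed

lemma measurable_log_weight:
  "log_weight d v u D L \<in> borel_measurable (std_gaussian d \<Otimes>\<^sub>M std_gaussian d)"
proof -
  note [measurable] = measurable_coord_u measurable_coord_v measurable_proj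
  have [measurable]: "i < d \<Longrightarrow> (\<lambda>x. D i (emb d x)) \<in> borel_measurable (std_gaussian d)" for i
    using measurable_compose[OF emb_measurable measurable_D] by (simp add: std_gaussian_def)
  show ?thesis unfolding log_weight_def case_prod_beta' by measurable
qed

text \<open>For a fixed first noise the second is translated by a constant, which reduces the inner
  integral to \<open>F\<close> at the shifted first noise; the change of variables for
  \<open>v\<close> is then applied to \<open>F\<close>.\<close>

lemma gaussian_map_change:
  assumes f[measurable]: "f \<in> borel_measurable (std_gaussian d \<Otimes>\<^sub>M std_gaussian d)"
  shows "(\<integral>\<^sup>+ z. f (gaussian_map d v u z) * ennreal (exp (log_weight d v u D L z)) \<partial>(std_gaussian d \<Otimes>\<^sub>M std_gaussian d))
    \<le> (\<integral>\<^sup>+ z. f z \<partial>(std_gaussian d \<Otimes>\<^sub>M std_gaussian d))"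
proof -
  interpret G: prob_space "std_gaussian d" by (rule prob_space_std_gaussian)
  note [measurable] = measurable_gaussian_map measurable_log_weight
  define A where "A x = (\<Sum>i<d. D i (emb d x) - 7 * L\<^sup>2 - x i * coord (v (emb d x)) i - (coord (v (emb d x)) i)\<^sup>2 / 2)" for x
  define S where "S x = (\<lambda>i\<in>{..<d}. x i + coord (v (emb d x)) i)" for x
  define T where "T c y = (\<lambda>i\<in>{..<d}. y i + coord c i)" for c y
  define C where "C c y = (\<Sum>i<d. - (y i * coord c i) - (coord c i)\<^sup>2 / 2)" for c y
  define F where "F x = (\<integral>\<^sup>+ y. f (x, y) \<partial>std_gaussian d)" for x
  have Fm: "F \<in> borel_measurable (std_gaussian d)" unfolding F_def by measurable
  have Sm: "S \<in> measurable (std_gaussian d) (std_gaussian d)"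
  proof -
    note [measurable] = measurable_coord_v measurable_proj
    have "S \<in> measurable (std_gaussian d) (Pi\<^sub>M {..<d} (\<lambda>_. std_gaussian1))"
      unfolding S_def by (rule measurable_restrict) (simp; measurable)
    then show ?thesis by (simp add: std_gaussian_def)
  qed
  have inner: "(\<integral>\<^sup>+ y. f (S x, T c y) * ennreal (exp (C c y)) \<partial>std_gaussian d) \<le> F (S x)"
    if x: "x \<in> space (std_gaussian d)" for x c
  proof -
    have "S x \<in> space (std_gaussian d)" using measurable_space[OF Sm x] .
    then have "(\<lambda>y. f (S x, y)) \<in> borel_measurable (std_gaussian d)" by measurable
    from lipschitz_shift.gaussian_shift_exp[OF lipschitz_shift_const this, of c]
    show ?thesis by (simp add: F_def T_def C_def)
  qed
  have "(\<integral>\<^sup>+ z. f (gaussian_map d v u z) * ennreal (exp (log_weight d v u D L z)) \<partial>(std_gaussian d \<Otimes>\<^sub>M std_gaussian d))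
      = (\<integral>\<^sup>+ x. (\<integral>\<^sup>+ y. f (gaussian_map d v u (x, y)) * ennreal (exp (log_weight d v u D L (x, y))) \<partial>std_gaussian d) \<partial>std_gaussian d)"
    by (subst G.nn_integral_fst[symmetric]) auto
  also have "\<dots> = (\<integral>\<^sup>+ x. (\<integral>\<^sup>+ y. f (S x, T (u (emb d x)) y) * ennreal (exp (C (u (emb d x)) y)) * ennreal (exp (A x)) \<partial>std_gaussian d) \<partial>std_gaussian d)"
    by (simp add: gaussian_map_def log_weight_def S_def T_def A_def C_def exp_add ennreal_mult mult_ac)
  also have "\<dots> \<le> (\<integral>\<^sup>+ x. F (S x) * ennreal (exp (A x)) \<partial>std_gaussian d)"
  proof (rule nn_integral_mono)
    fix x assume x: "x \<in> space (std_gaussian d)"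
    have "(\<lambda>y. (x, y)) \<in> measurable (std_gaussian d) (std_gaussian d \<Otimes>\<^sub>M std_gaussian d)"
      using x by measurable
    from measurable_compose[OF this measurable_compose[OF measurable_gaussian_map f]]
    have [measurable]: "(\<lambda>y. f (S x, T (u (emb d x)) y)) \<in> borel_measurable (std_gaussian d)"
      by (simp add: gaussian_map_def S_def T_def)
    note [measurable] = measurable_proj
    have [measurable]: "C c \<in> borel_measurable (std_gaussian d)" for c unfolding C_def[abs_def] by measurable
    show "(\<integral>\<^sup>+ y. f (S x, T (u (emb d x)) y) * ennreal (exp (C (u (emb d x)) y)) * ennreal (exp (A x)) \<partial>std_gaussian d)
        \<le> F (S x) * ennreal (exp (A x))"
      by (subst nn_integral_multc) (auto intro!: mult_right_mono inner[OF x])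
  qed
  also have "\<dots> \<le> (\<integral>\<^sup>+ x. F x \<partial>std_gaussian d)"
    using gaussian_shift_exp[OF Fm] by (simp add: S_def A_def)
  also have "\<dots> = (\<integral>\<^sup>+ z. f z \<partial>(std_gaussian d \<Otimes>\<^sub>M std_gaussian d))"
    unfolding F_def by (rule G.nn_integral_fst) measurable
  finally show ?thesis .
qed

end

lemma lipschitz_shift_scale:
  assumes "\<bar>c\<bar> * L \<le> 1/4"
  shows "lipschitz_shift d (\<lambda>x. c *\<^sub>R v x) (\<bar>c\<bar> * L) (\<lambda>i x. c * D i x)"
proof
  show "norm (c *\<^sub>R v x - c *\<^sub>R v y) \<le> \<bar>c\<bar> * L * norm (x - y)" for x y
    unfolding scaleR_diff_right[symmetric] norm_scaleR mult.assoc by (rule mult_left_mono[OF lip]) simp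
  show "0 \<le> \<bar>c\<bar> * L" using L0 by simp
  show "(\<lambda>n. real n * (coord (c *\<^sub>R v (x + (1 / real n) *\<^sub>R unit_vec i)) i - coord (c *\<^sub>R v x) i)) \<longlonglongrightarrow> c * D i x"
    if "i < d" for i x
  proof -
    have "(\<lambda>n. c * (real n * (coord (v (x + (1 / real n) *\<^sub>R unit_vec i)) i - coord (v x) i))) \<longlonglongrightarrow> c * D i x"
      by (intro tendsto_mult_left D that)
    then show ?thesis by (simp add: algebra_simps)
  qed
qed (use assms in simp)

text \<open>With c = - (q - 1), the weight to the power 1 - q has the same divergence and noise
  terms as the weight of the map built from c v and c u. The squares do not match: a term with
  coefficient q - 1 meets one with (q - 1)^2, and together they leave q (q - 1) times half the
  squared shifts plus 7 d L^2. The integral of the scaled weight is at most 1 by its own change of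
  variables, for which (q - 1) L must be at most 1/4.\<close>

theorem renyi_div_gaussian_map_le:
  assumes q: "1 < q" "(q - 1) * L \<le> 1/4" and u: "continuous_on UNIV u"
    and a: "\<And>x. norm (v x) \<le> a" and b: "\<And>x. norm (u x) \<le> b"
    and \<Psi>: "\<Psi> \<in> measurable (std_gaussian d \<Otimes>\<^sub>M std_gaussian d) N"
  shows "renyi_div q (distr (std_gaussian d \<Otimes>\<^sub>M std_gaussian d) N (\<lambda>z. \<Psi> (gaussian_map d v u z)))
      (distr (std_gaussian d \<Otimes>\<^sub>M std_gaussian d) N \<Psi>)
    \<le> ereal (q * ((a\<^sup>2 + b\<^sup>2) / 2 + 7 * real d * L\<^sup>2))"
proof -
  let ?\<kappa> = "std_gaussian d \<Otimes>\<^sub>M std_gaussian d"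
  define B where "B = q * ((a\<^sup>2 + b\<^sup>2) / 2 + 7 * real d * L\<^sup>2)"
  define c where "c = - (q - 1)"
  let ?W = "log_weight d (\<lambda>x. c *\<^sub>R v x) (\<lambda>x. c *\<^sub>R u x) (\<lambda>i x. c * D i x) (\<bar>c\<bar> * L)"
  interpret G: prob_space "std_gaussian d" by (rule prob_space_std_gaussian)
  interpret pair_prob_space "std_gaussian d" "std_gaussian d" ..
  have \<kappa>: "prob_space ?\<kappa>" by (rule P.prob_space_axioms)
  have c: "\<bar>c\<bar> = q - 1" using q by (simp add: c_def)
  interpret scaled: lipschitz_shift d "\<lambda>x. c *\<^sub>R v x" "\<bar>c\<bar> * L" "\<lambda>i x. c * D i x"
    by (rule lipschitz_shift_scale) (use q c in simp)
  have uc: "continuous_on UNIV (\<lambda>x. c *\<^sub>R u x)" by (intro continuous_intros u)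
  have pointwise: "(1 - q) * log_weight d v u D L z
      \<le> ?W z + (q - 1) * B" for z
  proof -
    obtain x y where z: "z = (x, y)" by (cases z)
    define V where "V i = coord (v (emb d x)) i" for i
    define U where "U i = coord (u (emb d x)) i" for i
    define Y where "Y i = D i (emb d x)" for i
    have V: "(\<Sum>i<d. (V i)\<^sup>2) \<le> a\<^sup>2"
      unfolding V_def using sum_coord_le_norm[of "{..<d}" "v (emb d x)"] power_mono[OF a[of "emb d x"] norm_ge_zero, of 2] by simp
    have U: "(\<Sum>i<d. (U i)\<^sup>2) \<le> b\<^sup>2"
      unfolding U_def using sum_coord_le_norm[of "{..<d}" "u (emb d x)"] power_mono[OF b[of "emb d x"] norm_ge_zero, of 2] by simp
    have "(1 - q) * log_weight d v u D L z
        = (\<Sum>i<d. (1 - q) * (Y i - 7 * L\<^sup>2 - x i * V i - (V i)\<^sup>2 / 2))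
          + (\<Sum>i<d. (1 - q) * (- (y i * U i) - (U i)\<^sup>2 / 2))"
      by (simp add: log_weight_def z V_def U_def Y_def distrib_left sum_distrib_left)
    also have "\<dots> = (\<Sum>i<d. (c * Y i - 7 * (\<bar>c\<bar> * L)\<^sup>2 - x i * (c * V i) - (c * V i)\<^sup>2 / 2)
            + q * (q - 1) * ((V i)\<^sup>2 / 2 + 7 * L\<^sup>2))
          + (\<Sum>i<d. (- (y i * (c * U i)) - (c * U i)\<^sup>2 / 2) + q * (q - 1) * ((U i)\<^sup>2 / 2))"
      by (intro arg_cong2[where f = "(+)"] sum.cong refl) (simp_all add: c_def power2_eq_square field_simps)
    also have "\<dots> = ?W z
          + q * (q - 1) * ((\<Sum>i<d. (V i)\<^sup>2) / 2 + (\<Sum>i<d. (U i)\<^sup>2) / 2 + 7 * real d * L\<^sup>2)"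
    proof -
      have split: "(\<Sum>i<d. A i + k * ((V i)\<^sup>2 / 2 + e)) + (\<Sum>i<d. A' i + k * ((U i)\<^sup>2 / 2))
          = (\<Sum>i<d. A i) + (\<Sum>i<d. A' i) + k * ((\<Sum>i<d. (V i)\<^sup>2) / 2 + (\<Sum>i<d. (U i)\<^sup>2) / 2 + real d * e)"
        for A A' k e
        by (simp add: sum.distrib distrib_left mult.left_commute flip: sum_distrib_left sum_divide_distrib)
      show ?thesis unfolding split by (simp add: log_weight_def z V_def U_def Y_def)
    qed
    also have "\<dots> \<le> ?W z
          + q * (q - 1) * ((a\<^sup>2 + b\<^sup>2) / 2 + 7 * real d * L\<^sup>2)"
      using V U q by (intro add_left_mono mult_left_mono) auto
    finally show ?thesis by (simp add: B_def mult_ac)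
  qed
  have "renyi_div q (distr ?\<kappa> N (\<lambda>z. \<Psi> (gaussian_map d v u z))) (distr ?\<kappa> N \<Psi>) \<le> ereal B"
  proof (rule renyi_div_pushforward_le[where W = "\<lambda>z. exp (log_weight d v u D L z)"])
    show "0 \<le> B" using q by (simp add: B_def)
    show "(\<lambda>z. exp (log_weight d v u D L z)) \<in> borel_measurable ?\<kappa>"
      using measurable_log_weight[OF u] by measurable
    have "(\<integral>\<^sup>+ z. ennreal (exp (log_weight d v u D L z) powr (1 - q)) \<partial>?\<kappa>)
        \<le> (\<integral>\<^sup>+ z. ennreal (exp ((q - 1) * B)) *
           (1 * ennreal (exp (?W z))) \<partial>?\<kappa>)"
    proof (rule nn_integral_mono)
      fix z
      have "exp (log_weight d v u D L z) powr (1 - q)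
          \<le> exp (?W z + (q - 1) * B)"
        using pointwise[of z] by (simp add: powr_def)
      then show "ennreal (exp (log_weight d v u D L z) powr (1 - q)) \<le> ennreal (exp ((q - 1) * B)) *
           (1 * ennreal (exp (?W z)))"
        by (simp add: exp_add ennreal_mult[symmetric] ennreal_leI mult.commute)
    qed
    also have "\<dots> \<le> ennreal (exp ((q - 1) * B)) * 1"
    proof (subst nn_integral_cmult)
      show "(\<lambda>z. 1 * ennreal (exp (?W z)))
          \<in> borel_measurable ?\<kappa>"
        using scaled.measurable_log_weight[OF uc] by measurable
      have "(\<integral>\<^sup>+ z. 1 * ennreal (exp (?W z)) \<partial>?\<kappa>)
          \<le> (\<integral>\<^sup>+ z. 1 \<partial>?\<kappa>)"
        by (rule scaled.gaussian_map_change[OF uc, of "\<lambda>_. 1"]) simp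
      also have "\<dots> = 1" by (simp add: P.emeasure_space_1)
      finally show "ennreal (exp ((q - 1) * B)) * (\<integral>\<^sup>+ z. 1 * ennreal (exp (?W z)) \<partial>?\<kappa>)
          \<le> ennreal (exp ((q - 1) * B)) * 1"
        by (rule mult_left_mono) simp
    qed
    finally show "(\<integral>\<^sup>+ z. ennreal (exp (log_weight d v u D L z) powr (1 - q)) \<partial>?\<kappa>) \<le> ennreal (exp ((q - 1) * B))"
      by simp
  qed (use \<kappa> q \<Psi> measurable_gaussian_map[OF u] gaussian_map_change[OF u] in auto)
  then show ?thesis by (simp add: B_def)
qed

end

section \<open>Differential calculus in coordinates\<close>

lemma signed_mvt:
  fixes f :: "real \<Rightarrow> real"
  assumes "\<And>t. (f has_real_derivative f' t) (at t)"
  shows "\<exists>s. \<bar>s\<bar> \<le> \<bar>b\<bar> \<and> f b - f 0 = b * f' s"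
proof -
  consider "b = 0" | "0 < b" | "b < 0" by linarith
  then show ?thesis
  proof cases
    case 1 then show ?thesis by auto
  next
    case 2
    from MVT2[OF this, of f f'] assms obtain s where "0 < s" "s < b" "f b - f 0 = (b - 0) * f' s" by auto
    then show ?thesis by (intro exI[of _ s]) auto
  next
    case 3
    from MVT2[OF this, of f f'] assms obtain s where "b < s" "s < 0" "f 0 - f b = (0 - b) * f' s" by auto
    then show ?thesis by (intro exI[of _ s]) auto
  qed
qed

text \<open>A continuously differentiable function of d variables, lifted to the sequence space: the
  first conjunct states independence of the remaining coordinates.\<close>

definition has_partials :: "nat \<Rightarrow> (l2 \<Rightarrow> real) \<Rightarrow> (nat \<Rightarrow> l2 \<Rightarrow> real) \<Rightarrow> bool" where
  "has_partials d F c \<longleftrightarrow> (\<forall>z. F (emb d (coord z)) = F z) \<and>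
     (\<forall>i<d. continuous_on UNIV (c i) \<and> (\<forall>z. ((\<lambda>t. F (z + t *\<^sub>R unit_vec i)) has_real_derivative c i z) (at 0)))"

lemma C1_on_Rn_has_partials:
  assumes "C1_on_Rn d f"
  shows "has_partials d (\<lambda>z. f (res d z)) (\<lambda>i z. partial i f (res d z))"
  unfolding has_partials_def
proof (intro conjI allI impI)
  fix z show "f (res d (emb d (coord z))) = f (res d z)"
    by (rule arg_cong[where f = f]) (auto simp: res_def)
next
  have range: "res d z \<in> Rn d" for z by (auto simp: res_def Rn_def)
  fix i assume i: "i < d"
  show "continuous_on UNIV (\<lambda>z. partial i f (res d z))"
    using assms i range by (intro continuous_on_compose2[OF _ continuous_res]) (auto simp: C1_on_Rn_def)
  fix z
  let ?x = "res d z"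
  have "((\<lambda>t. f (?x(i := t))) has_real_derivative partial i f ?x) (at (?x i))"
    using assms i range[of z] by (simp add: C1_on_Rn_def partial_def DERIV_deriv_iff_real_differentiable)
  then have "((\<lambda>t. f (?x(i := t + ?x i))) has_real_derivative partial i f ?x) (at 0)"
    using DERIV_shift[of "\<lambda>t. f (?x(i := t))" "partial i f ?x" 0 "?x i"] by simp
  moreover have "?x(i := t + ?x i) = res d (z + t *\<^sub>R unit_vec i)" for t
    using i by (auto simp: res_def fun_eq_iff)
  ultimately show "((\<lambda>t. f (res d (z + t *\<^sub>R unit_vec i))) has_real_derivative partial i f ?x) (at 0)"
    by simp
qed

text \<open>The increment is made one coordinate at a time with a mean-value point for each. Such a
  point deviates from \<open>z\<close> by the part of \<open>w\<close> already added plus a multiple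
  of one unit vector, together at most 2 |w|.\<close>

lemma has_partials_mvt:
  assumes P: "has_partials d F c"
  shows "\<exists>p. (\<forall>k<d. norm (p k - z) \<le> 2 * norm w) \<and> F (z + w) - F z = (\<Sum>k<d. c k (p k) * coord w k)"
proof -
  define y where "y k = z + emb k (coord w)" for k
  have der: "((\<lambda>t. F (u + t *\<^sub>R unit_vec k)) has_real_derivative c k (u + t *\<^sub>R unit_vec k)) (at t)" if "k < d" for u k t
  proof -
    have "((\<lambda>s. F ((u + t *\<^sub>R unit_vec k) + s *\<^sub>R unit_vec k)) has_real_derivative c k (u + t *\<^sub>R unit_vec k)) (at 0)"
      using P that by (auto simp: has_partials_def)
    then show ?thesis
      using DERIV_shift[of "\<lambda>t. F (u + t *\<^sub>R unit_vec k)" "c k (u + t *\<^sub>R unit_vec k)" 0 t]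
      by (simp add: algebra_simps)
  qed
  have "\<exists>s. k < d \<longrightarrow> \<bar>s\<bar> \<le> \<bar>coord w k\<bar> \<and> F (y (Suc k)) - F (y k) = coord w k * c k (y k + s *\<^sub>R unit_vec k)" for k
  proof (cases "k < d")
    case True
    have "y (Suc k) = y k + coord w k *\<^sub>R unit_vec k"
      by (rule l2_eqI) (auto simp: y_def less_Suc_eq)
    then show ?thesis
      using signed_mvt[OF der[OF True, of "y k"], of "coord w k"] by auto
  qed simp
  then obtain s where s: "\<And>k. k < d \<Longrightarrow> \<bar>s k\<bar> \<le> \<bar>coord w k\<bar>"
    "\<And>k. k < d \<Longrightarrow> F (y (Suc k)) - F (y k) = coord w k * c k (y k + s k *\<^sub>R unit_vec k)"
    by metis
  have "norm (y k + s k *\<^sub>R unit_vec k - z) \<le> 2 * norm w" if "k < d" for k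
  proof -
    have "norm (y k + s k *\<^sub>R unit_vec k - z) \<le> norm (emb k (coord w)) + norm (s k *\<^sub>R unit_vec k)"
      using norm_triangle_ineq[of "emb k (coord w)" "s k *\<^sub>R unit_vec k"] by (simp add: y_def)
    also have "\<dots> \<le> norm w + norm w"
      using norm_emb_coord_le[of k w] s(1)[OF that] abs_coord_le_norm[of w k] by (intro add_mono) auto
    finally show ?thesis by simp
  qed
  moreover have "F (z + w) - F z = (\<Sum>k<d. c k (y k + s k *\<^sub>R unit_vec k) * coord w k)"
  proof -
    have dep: "F (emb d (coord u)) = F u" for u using P by (simp add: has_partials_def)
    have "emb d (coord (z + w)) = emb d (coord (y d))" by (rule emb_eqI) (simp add: y_def)
    then have "F (z + w) = F (y d)" using dep by metis
    moreover have "y 0 = z" by (rule l2_eqI) (simp add: y_def)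
    ultimately have "F (z + w) - F z = F (y d) - F (y 0)" by simp
    also have "\<dots> = (\<Sum>k<d. F (y (Suc k)) - F (y k))" by (rule sum_lessThan_telescope[symmetric])
    also have "\<dots> = (\<Sum>k<d. c k (y k + s k *\<^sub>R unit_vec k) * coord w k)"
      using s(2) by (intro sum.cong) (auto simp: mult.commute)
    finally show ?thesis .
  qed
  ultimately show ?thesis by (intro exI[of _ "\<lambda>k. y k + s k *\<^sub>R unit_vec k"]) blast
qed

text \<open>The mean-value points collapse to the base point as the increment tends to 0, and the
  partial derivatives are continuous.\<close>

lemma has_partials_directional:
  assumes P: "has_partials d F c"
  shows "((\<lambda>s. F (z + s *\<^sub>R w)) has_real_derivative (\<Sum>k<d. c k (z + s *\<^sub>R w) * coord w k)) (at s)"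
proof -
  define x where "x = z + s *\<^sub>R w"
  have "\<exists>p. (\<forall>k<d. norm (p k - x) \<le> 2 * norm (h *\<^sub>R w)) \<and> F (x + h *\<^sub>R w) - F x = (\<Sum>k<d. c k (p k) * coord (h *\<^sub>R w) k)" for h
    by (rule has_partials_mvt[OF P])
  then obtain p where p: "\<And>h k. k < d \<Longrightarrow> norm (p h k - x) \<le> 2 * norm (h *\<^sub>R w)"
    "\<And>h. F (x + h *\<^sub>R w) - F x = (\<Sum>k<d. c k (p h k) * coord (h *\<^sub>R w) k)"
    by metis
  have lim: "((\<lambda>h. c k (p h k)) \<longlongrightarrow> c k x) (at 0)" if "k < d" for k
  proof -
    have "((\<lambda>h. p h k - x) \<longlongrightarrow> 0) (at 0)"
    proof (rule Lim_null_comparison)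
      show "\<forall>\<^sub>F h in at 0. norm (p h k - x) \<le> 2 * norm (h *\<^sub>R w)" using p(1)[OF that] by simp
      show "((\<lambda>h. 2 * norm (h *\<^sub>R w)) \<longlongrightarrow> 0) (at 0)" by (auto intro!: tendsto_eq_intros)
    qed
    then have "((\<lambda>h. p h k) \<longlongrightarrow> x) (at 0)" by (simp add: LIM_zero_iff)
    moreover have "continuous_on UNIV (c k)" using P that by (simp add: has_partials_def)
    ultimately show ?thesis by (auto intro: continuous_on_tendsto_compose)
  qed
  have "((\<lambda>h. \<Sum>k<d. c k (p h k) * coord w k) \<longlongrightarrow> (\<Sum>k<d. c k x * coord w k)) (at 0)"
    by (intro tendsto_sum tendsto_mult_right lim) simp
  moreover have "\<forall>\<^sub>F h in at 0. (\<Sum>k<d. c k (p h k) * coord w k) = (F (x + h *\<^sub>R w) - F x) / h"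
    unfolding p(2) eventually_at_filter by (simp add: sum_divide_distrib)
  ultimately have "((\<lambda>h. (F (x + h *\<^sub>R w) - F x) / h) \<longlongrightarrow> (\<Sum>k<d. c k x * coord w k)) (at 0)"
    by (rule Lim_transform_eventually)
  then show ?thesis unfolding DERIV_def by (simp add: x_def algebra_simps)
qed

text \<open>Here \<open>y\<close> may leave \<open>K\<close>, and in the sequence space
  \<open>K\<close> has no compact neighbourhood on which uniform continuity could be used; hence the
  argument by sequences.\<close>

lemma continuous_uniformly_near_compact:
  fixes c :: "'a::metric_space \<Rightarrow> real"
  assumes K: "compact K" and c: "continuous_on UNIV c" and "0 < e"
  shows "\<exists>r>0. \<forall>x\<in>K. \<forall>y. dist y x < r \<longrightarrow> \<bar>c y - c x\<bar> < e"
proof (rule ccontr)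
  assume neg: "\<not> ?thesis"
  have "\<exists>x y. x \<in> K \<and> dist y x < inverse (real (Suc n)) \<and> e \<le> \<bar>c y - c x\<bar>" for n
  proof -
    have "0 < inverse (real (Suc n))" by simp
    then have "\<not> (\<forall>x\<in>K. \<forall>y. dist y x < inverse (real (Suc n)) \<longrightarrow> \<bar>c y - c x\<bar> < e)"
      using neg by blast
    then show ?thesis by (auto simp: not_less)
  qed
  then obtain x y where xy: "\<And>n. x n \<in> K" "\<And>n. dist (y n) (x n) < inverse (real (Suc n))" "\<And>n. e \<le> \<bar>c (y n) - c (x n)\<bar>"
    by metis
  obtain l \<sigma> where l: "l \<in> K" "strict_mono \<sigma>" "(x \<circ> \<sigma>) \<longlonglongrightarrow> l"
    using K xy(1) unfolding compact_def by metis
  have "(\<lambda>n. dist (y n) (x n)) \<longlonglongrightarrow> 0"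
    by (rule tendsto_sandwich[OF _ _ tendsto_const LIMSEQ_inverse_real_of_nat])
      (use xy(2) in \<open>auto intro: always_eventually less_imp_le\<close>)
  from LIMSEQ_subseq_LIMSEQ[OF this l(2)]
  have d0: "(\<lambda>n. dist (y (\<sigma> n)) (x (\<sigma> n))) \<longlonglongrightarrow> 0" by (simp add: o_def)
  have xl: "(\<lambda>n. x (\<sigma> n)) \<longlonglongrightarrow> l" using l(3) by (simp add: o_def)
  have yl: "(\<lambda>n. y (\<sigma> n)) \<longlonglongrightarrow> l"
  proof (rule metric_tendsto_imp_tendsto)
    show "(\<lambda>n. dist (y (\<sigma> n)) (x (\<sigma> n)) + dist (x (\<sigma> n)) l) \<longlonglongrightarrow> 0"
      using tendsto_add[OF d0 tendsto_dist_iff[THEN iffD1, OF xl]] by simp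
    show "\<forall>\<^sub>F n in sequentially. dist (y (\<sigma> n)) l \<le> dist (dist (y (\<sigma> n)) (x (\<sigma> n)) + dist (x (\<sigma> n)) l) 0"
      by (intro always_eventually allI) (simp add: dist_triangle)
  qed
  have "(\<lambda>n. \<bar>c (y (\<sigma> n)) - c (x (\<sigma> n))\<bar>) \<longlonglongrightarrow> \<bar>c l - c l\<bar>"
    by (intro tendsto_rabs tendsto_diff continuous_on_tendsto_compose[OF c xl] continuous_on_tendsto_compose[OF c yl]) auto
  then have "e \<le> \<bar>c l - c l\<bar>"
    by (rule tendsto_lowerbound) (use xy(3) in \<open>auto intro: always_eventually\<close>)
  then show False using \<open>0 < e\<close> by simp
qed

text \<open>Comparing both quadratic bounds at the two points \<open>x + (y - x)/2 \<plusminus> s\<close> avoids the symmetry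
  of the Hessian.\<close>

lemma lipschitz_gradient_of_quadratic_bounds:
  fixes W :: "'a::real_inner \<Rightarrow> real" and G :: "'a \<Rightarrow> 'a"
  assumes T: "\<And>x w. \<bar>W (x + w) - W x - inner (G x) w\<bar> \<le> \<beta> / 2 * (norm w)\<^sup>2"
  shows "norm (G x - G y) \<le> \<beta> * norm (x - y)"
proof (cases "G x = G y \<or> x = y")
  case True
  have "0 \<le> \<beta> / 2 * (norm (x - y))\<^sup>2" using order_trans[OF abs_ge_zero T] .
  then have "x \<noteq> y \<Longrightarrow> 0 \<le> \<beta>" by (simp add: zero_le_mult_iff)
  with True show ?thesis by (cases "x = y") auto
next
  case False
  define r where "r = (1/2) *\<^sub>R (y - x)"
  define e where "e = G y - G x"
  \<comment> \<open>The direction that detects \<open>e\<close> in full, with the length of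
    \<open>r\<close> so that both squares in \<open>key\<close> have the same size.\<close>
  define s where "s = (norm r / norm e) *\<^sub>R e"
  have e: "norm e > 0" and r: "norm r > 0" using False by (auto simp: e_def r_def)
  have ns: "norm s = norm r" using e by (simp add: s_def)
  have es: "inner e s = norm r * norm e"
    using e by (simp add: s_def power2_norm_eq_inner[symmetric] power2_eq_square)
  have par: "(norm (r + s'))\<^sup>2 + (norm (s' - r))\<^sup>2 = 2 * (norm r)\<^sup>2 + 2 * (norm s')\<^sup>2" for s'
    by (simp add: power2_norm_eq_inner inner_add_left inner_add_right inner_diff_left inner_diff_right inner_commute)
  have z: "x + (r + s') = y + (s' - r)" for s'
    by (simp add: r_def algebra_simps flip: scaleR_add_left)
  have key: "\<bar>W y - W x - inner (G x) (r + s') + inner (G y) (s' - r)\<bar> \<le> \<beta> * ((norm r)\<^sup>2 + (norm s')\<^sup>2)" for s'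
  proof -
    have "\<bar>W (x + (r + s')) - W x - inner (G x) (r + s')\<bar> + \<bar>W (x + (r + s')) - W y - inner (G y) (s' - r)\<bar>
        \<le> \<beta> / 2 * (norm (r + s'))\<^sup>2 + \<beta> / 2 * (norm (s' - r))\<^sup>2"
      using T[of x "r + s'"] T[of y "s' - r"] unfolding z by (rule add_mono)
    also have "\<dots> = \<beta> / 2 * ((norm (r + s'))\<^sup>2 + (norm (s' - r))\<^sup>2)" by (simp add: algebra_simps)
    also have "\<dots> = \<beta> * ((norm r)\<^sup>2 + (norm s')\<^sup>2)" unfolding par by (simp add: algebra_simps)
    finally show ?thesis by linarith
  qed
  have "2 * inner e s = (W y - W x - inner (G x) (r + s) + inner (G y) (s - r))
      - (W y - W x - inner (G x) (r + - s) + inner (G y) (- s - r))"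
    by (simp add: e_def inner_add_right inner_diff_right inner_diff_left)
  also have "\<dots> \<le> 2 * (\<beta> * ((norm r)\<^sup>2 + (norm s)\<^sup>2))"
    using key[of s] key[of "- s"] unfolding norm_minus_cancel by linarith
  also have "\<dots> = 4 * \<beta> * (norm r * norm r)" by (simp add: ns power2_eq_square)
  finally have "norm r * norm e \<le> norm r * (2 * \<beta> * norm r)" unfolding es by (simp add: mult_ac)
  then have "norm e \<le> 2 * \<beta> * norm r" using r by simp
  also have "\<dots> = \<beta> * norm (x - y)" by (simp add: r_def norm_minus_commute)
  finally show ?thesis by (simp add: e_def norm_minus_commute)
qed

section \<open>Potentials with bounded Hessian\<close>

locale hessian_bounded =
  fixes d :: nat and W :: "l2 \<Rightarrow> real" and g :: "nat \<Rightarrow> l2 \<Rightarrow> real" and H :: "nat \<Rightarrow> nat \<Rightarrow> l2 \<Rightarrow> real" and \<beta> :: real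
  assumes g: "has_partials d W g" and H: "\<And>i. i < d \<Longrightarrow> has_partials d (g i) (\<lambda>j. H j i)"
    and quadratic: "\<And>y w. \<bar>\<Sum>i<d. (\<Sum>j<d. H j i y * coord w j) * coord w i\<bar> \<le> \<beta> * (norm w)\<^sup>2"
begin

definition G :: "l2 \<Rightarrow> l2" where
  "G y = emb d (\<lambda>i. g i y)"

lemma inner_G_deriv:
  "((\<lambda>s. inner (G (z + s *\<^sub>R w)) u) has_real_derivative (\<Sum>i<d. (\<Sum>j<d. H j i (z + s *\<^sub>R w) * coord w j) * coord u i)) (at s)"
  unfolding G_def inner_emb
  by (intro DERIV_sum DERIV_cmult_right has_partials_directional[OF H]) simp

lemma quadratic_approximation: "\<bar>W (x + w) - W x - inner (G x) w\<bar> \<le> \<beta> / 2 * (norm w)\<^sup>2"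
proof -
  have X: "((\<lambda>s. W (x + s *\<^sub>R w)) has_vector_derivative inner (G (x + t *\<^sub>R w)) w) (at t)" for t
    using has_partials_directional[OF g, of x w t]
    by (simp add: has_real_derivative_iff_has_vector_derivative[symmetric] G_def inner_emb)
  have P: "((\<lambda>s. inner (G (x + s *\<^sub>R w)) w) has_vector_derivative
      (\<Sum>i<d. (\<Sum>j<d. H j i (x + t *\<^sub>R w) * coord w j) * coord w i)) (at t)" for t
    using inner_G_deriv[of x w w t] by (simp add: has_real_derivative_iff_has_vector_derivative[symmetric])
  from second_order_taylor(2)[OF X P, of 1 "\<beta> * (norm w)\<^sup>2" 1] quadratic show ?thesis by simp
qed

lemma G_lipschitz: "norm (G x - G y) \<le> \<beta> * norm (x - y)"
  by (rule lipschitz_gradient_of_quadratic_bounds[OF quadratic_approximation])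

text \<open>With a = x - y, the point u is replaced by v + a, at a cost of \<beta> |(x - y) - (u -
  v)| by the Lipschitz bound. What remains is a second difference over the parallelogram y, y + a,
  v, v + a: the Hessian changes by at most b |a| across it and acts along the side v - y.\<close>

lemma G_second_difference:
  assumes Hlip: "\<And>y y' e w. \<bar>\<Sum>i<d. (\<Sum>j<d. (H j i y - H j i y') * coord e j) * coord w i\<bar>
      \<le> b * norm (y - y') * norm e * norm w"
  shows "norm ((G x - G y) - (G u - G v)) \<le> \<beta> * norm ((x - y) - (u - v)) + b * norm (x - y) * norm (y - v)"
proof -
  define a where "a = x - y"
  define e where "e = v - y"
  define w where "w = (G (v + a) - G v) - (G (y + a) - G y)"
  \<comment> \<open>The second difference \<open>w\<close> is tested against itself, so the
    increment of this function from 0 to 1 is the squared norm of \<open>w\<close>.\<close>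
  define \<phi> where "\<phi> s = inner (G ((y + a) + s *\<^sub>R e)) w - inner (G (y + s *\<^sub>R e)) w" for s
  have \<phi>: "(\<phi> has_real_derivative (\<Sum>i<d. (\<Sum>j<d. (H j i ((y + a) + s *\<^sub>R e) - H j i (y + s *\<^sub>R e)) * coord e j) * coord w i)) (at s)" for s
  proof -
    have "(\<phi> has_real_derivative (\<Sum>i<d. (\<Sum>j<d. H j i ((y + a) + s *\<^sub>R e) * coord e j) * coord w i)
        - (\<Sum>i<d. (\<Sum>j<d. H j i (y + s *\<^sub>R e) * coord e j) * coord w i)) (at s)"
      unfolding \<phi>_def by (intro DERIV_diff inner_G_deriv)
    then show ?thesis by (simp add: left_diff_distrib sum_subtractf)
  qed
  from signed_mvt[OF this, of 1] obtain s where
    "\<phi> 1 - \<phi> 0 = (\<Sum>i<d. (\<Sum>j<d. (H j i ((y + a) + s *\<^sub>R e) - H j i (y + s *\<^sub>R e)) * coord e j) * coord w i)"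
    by auto
  also have "\<dots> \<le> b * norm a * norm e * norm w"
    using abs_le_D1[OF Hlip[of "(y + a) + s *\<^sub>R e" "y + s *\<^sub>R e" e w]] by simp
  finally have "\<phi> 1 - \<phi> 0 \<le> b * norm a * norm e * norm w" .
  moreover have "\<phi> 1 - \<phi> 0 = norm w * norm w"
  proof -
    have ye: "y + a + e = v + a" "y + e = v" by (simp_all add: e_def)
    have "\<phi> 1 - \<phi> 0 = inner w w" by (simp add: \<phi>_def w_def inner_diff_left ye)
    then show ?thesis by (simp add: power2_norm_eq_inner[symmetric] power2_eq_square)
  qed
  ultimately have w: "norm w \<le> b * norm a * norm e"
  proof (cases "w = 0")
    case True
    \<comment> \<open>For w = 0 only the sign of the right side is at stake; it is read off the
      hypothesis with a test vector of norm 1.\<close>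
    define w' where "w' = unit_vec 0"
    have "0 \<le> b * norm ((y + a) - y) * norm e * norm w'" using order_trans[OF abs_ge_zero Hlip] .
    then show ?thesis using True by (simp add: w'_def)
  qed simp
  have "(G x - G y) - (G u - G v) = (G (v + a) - G u) - w" by (simp add: w_def a_def)
  then have "norm ((G x - G y) - (G u - G v)) \<le> norm (G (v + a) - G u) + norm w"
    by (metis norm_triangle_ineq4)
  also have "\<dots> \<le> \<beta> * norm ((v + a) - u) + b * norm a * norm e" by (intro add_mono G_lipschitz w)
  also have "(v + a) - u = (x - y) - (u - v)" by (simp add: a_def)
  finally show ?thesis by (simp add: a_def e_def norm_minus_commute)
qed

text \<open>Both quotients are compared with the directional derivative along \<open>u\<close>:
  their mean-value points lie within 2 |B| / n of \<open>x\<close>, where each Hessian entry is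
  uniformly close to its value on \<open>K\<close>. The result is the smoothness assumption of
  \<open>retarget_quotients_convergent\<close>.\<close>

lemma G_quotients_uniform:
  assumes K: "compact K" and "0 < \<eta>"
  shows "\<exists>N>0. \<forall>n\<ge>N. \<forall>m\<ge>N. \<forall>x\<in>K. \<forall>u. norm u \<le> B \<longrightarrow>
      norm (real n *\<^sub>R (G (x + (1 / real n) *\<^sub>R u) - G x) - real m *\<^sub>R (G (x + (1 / real m) *\<^sub>R u) - G x)) \<le> \<eta>"
proof -
  \<comment> \<open>Budget for a crude sum over all d^2 entries, taken twice; the 1 keeps the
    denominator positive when d or B is 0.\<close>
  define \<epsilon> where "\<epsilon> = \<eta> / (2 * (real d * real d * \<bar>B\<bar>) + 1)"
  have \<epsilon>: "0 < \<epsilon>" using \<open>0 < \<eta>\<close> by (auto simp: \<epsilon>_def intro!: divide_pos_pos add_nonneg_pos)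
  have \<epsilon>_le: "2 * (real d * (real d * (\<epsilon> * \<bar>B\<bar>))) \<le> \<eta>"
  proof -
    have "2 * (real d * (real d * (\<epsilon> * \<bar>B\<bar>))) \<le> \<epsilon> * (2 * (real d * real d * \<bar>B\<bar>) + 1)"
      using \<epsilon> by (simp add: algebra_simps)
    also have "\<dots> = \<eta>" unfolding \<epsilon>_def
      using add_nonneg_pos[of "2 * (real d * real d * \<bar>B\<bar>)" 1] by simp
    finally show ?thesis .
  qed
  have "\<exists>r>0. \<forall>x\<in>K. \<forall>y. dist y x < r \<longrightarrow> \<bar>H j i y - H j i x\<bar> < \<epsilon>" if "i < d" "j < d" for i j
    using H[OF that(1)] that(2) by (intro continuous_uniformly_near_compact[OF K _ \<epsilon>]) (simp add: has_partials_def)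
  then obtain r where r: "\<And>i j. i < d \<Longrightarrow> j < d \<Longrightarrow> 0 < r i j"
    "\<And>i j x y. i < d \<Longrightarrow> j < d \<Longrightarrow> x \<in> K \<Longrightarrow> dist y x < r i j \<Longrightarrow> \<bar>H j i y - H j i x\<bar> < \<epsilon>"
    by metis
  \<comment> \<open>Inserting 1 keeps the set nonempty in dimension 0.\<close>
  define \<rho> where "\<rho> = Min (insert 1 ((\<lambda>(i, j). r i j) ` ({..<d} \<times> {..<d})))"
  have \<rho>: "0 < \<rho>" "\<And>i j. i < d \<Longrightarrow> j < d \<Longrightarrow> \<rho> \<le> r i j"
    unfolding \<rho>_def using r(1) by (auto simp: Min_gr_iff intro!: Min_le)
  obtain N0 :: nat where N0: "2 * \<bar>B\<bar> / \<rho> < real N0" using reals_Archimedean2 by blast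
  define N where "N = Suc N0"
  have N: "2 * \<bar>B\<bar> / real n < \<rho>" if "n \<ge> N" for n
  proof -
    have "2 * \<bar>B\<bar> / \<rho> < real n" using N0 that by (simp add: N_def)
    then show ?thesis using \<rho>(1) that by (simp add: field_simps N_def)
  qed
  have close: "\<bar>real n * (g i (x + (1 / real n) *\<^sub>R u) - g i x) - (\<Sum>j<d. H j i x * coord u j)\<bar> \<le> real d * (\<epsilon> * \<bar>B\<bar>)"
    if "n \<ge> N" "x \<in> K" "norm u \<le> B" "i < d" for n x u i
  proof -
    have n: "n > 0" using that by (simp add: N_def)
    obtain p where p: "\<And>j. j < d \<Longrightarrow> norm (p j - x) \<le> 2 * norm ((1 / real n) *\<^sub>R u)"
      "g i (x + (1 / real n) *\<^sub>R u) - g i x = (\<Sum>j<d. H j i (p j) * coord ((1 / real n) *\<^sub>R u) j)"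
      using has_partials_mvt[OF H[OF \<open>i < d\<close>]] by metis
    have "real n * (g i (x + (1 / real n) *\<^sub>R u) - g i x) = (\<Sum>j<d. H j i (p j) * coord u j)"
      unfolding p(2) using n by (simp add: sum_distrib_left)
    then have "\<bar>real n * (g i (x + (1 / real n) *\<^sub>R u) - g i x) - (\<Sum>j<d. H j i x * coord u j)\<bar>
        = \<bar>\<Sum>j<d. (H j i (p j) - H j i x) * coord u j\<bar>"
      by (simp add: left_diff_distrib sum_subtractf)
    also have "\<dots> \<le> (\<Sum>j<d. \<bar>(H j i (p j) - H j i x) * coord u j\<bar>)" by (rule sum_abs)
    also have "\<dots> \<le> (\<Sum>j<d. \<epsilon> * \<bar>B\<bar>)"
    proof (rule sum_mono)
      fix j assume "j \<in> {..<d}"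
      then have j: "j < d" by simp
      have "norm (p j - x) \<le> 2 * \<bar>B\<bar> / real n"
        using p(1)[OF j] \<open>norm u \<le> B\<close> n by (auto simp: field_simps intro: order_trans)
      then have "dist (p j) x < r i j"
        using N[OF \<open>n \<ge> N\<close>] \<rho>(2)[OF \<open>i < d\<close> j] by (simp add: dist_norm)
      from r(2)[OF \<open>i < d\<close> j \<open>x \<in> K\<close> this]
      show "\<bar>(H j i (p j) - H j i x) * coord u j\<bar> \<le> \<epsilon> * \<bar>B\<bar>"
        unfolding abs_mult using abs_coord_le_norm[of u j] \<open>norm u \<le> B\<close> \<epsilon> by (intro mult_mono) auto
    qed
    finally show ?thesis by simp
  qed
  have "norm (real n *\<^sub>R (G (x + (1 / real n) *\<^sub>R u) - G x) - real m *\<^sub>R (G (x + (1 / real m) *\<^sub>R u) - G x)) \<le> \<eta>"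
    if "n \<ge> N" "m \<ge> N" "x \<in> K" "norm u \<le> B" for n m x u
  proof -
    define q where "q n i = real n * (g i (x + (1 / real n) *\<^sub>R u) - g i x)" for n i
    have "real n *\<^sub>R (G (x + (1 / real n) *\<^sub>R u) - G x) - real m *\<^sub>R (G (x + (1 / real m) *\<^sub>R u) - G x)
        = emb d (\<lambda>i. q n i - q m i)"
      by (rule l2_eqI) (simp add: G_def q_def)
    then have "norm (real n *\<^sub>R (G (x + (1 / real n) *\<^sub>R u) - G x) - real m *\<^sub>R (G (x + (1 / real m) *\<^sub>R u) - G x))
        \<le> (\<Sum>i<d. \<bar>q n i - q m i\<bar>)"
      using L2_set_le_sum_abs[of "\<lambda>i. q n i - q m i" "{..<d}"] by (simp add: norm_emb)
    also have "\<dots> \<le> (\<Sum>i<d. 2 * (real d * (\<epsilon> * \<bar>B\<bar>)))"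
    proof (rule sum_mono)
      fix i assume "i \<in> {..<d}"
      then have "i < d" by simp
      with close[OF that(1,3,4)] close[OF that(2,3,4)]
      show "\<bar>q n i - q m i\<bar> \<le> 2 * (real d * (\<epsilon> * \<bar>B\<bar>))" unfolding q_def by (smt (verit))
    qed
    also have "\<dots> = 2 * (real d * (real d * (\<epsilon> * \<bar>B\<bar>)))" by simp
    also have "\<dots> \<le> \<eta>" by (rule \<epsilon>_le)
    finally show ?thesis .
  qed
  then show ?thesis by (intro exI[of _ N]) (auto simp: N_def)
qed

end

section \<open>The OHO kernel\<close>

lemma enorm_eq_norm_emb: "enorm d x = norm (emb d x)"
  by (simp add: enorm_def norm_emb)

lemma edist_eq_norm_emb: "edist d x y = norm (emb d x - emb d y)"
  by (simp add: edist_def enorm_eq_norm_emb emb_diff)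

lemma res_in_Rn: "res d x \<in> Rn d"
  by (auto simp: res_def Rn_def)

lemma res_emb: "x \<in> Rn d \<Longrightarrow> res d (emb d x) = x"
  by (auto simp: res_def Rn_def PiE_def extensional_def)

lemma emb_res: "emb d (res d x) = emb d (coord x)"
  by (rule emb_eqI) (simp add: res_def)

text \<open>A supremum of reals bounds its members only if they are bounded above, which the sum of
  the absolute entries ensures; the rest is scaling to unit norm.\<close>

lemma enorm_mat_vec_le:
  assumes "w \<in> Rn d"
  shows "enorm d (mat_vec d A w) \<le> op_norm d A * enorm d w"
proof -
  have bdd: "bdd_above ((\<lambda>v. enorm d (mat_vec d A v)) ` {v \<in> Rn d. enorm d v \<le> 1})"
  proof (rule bdd_aboveI2)
    fix v assume v: "v \<in> {v \<in> Rn d. enorm d v \<le> 1}"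
    have "\<bar>mat_vec d A v i\<bar> \<le> (\<Sum>j<d. \<bar>A i j\<bar>)" if "i < d" for i
    proof -
      have "\<bar>mat_vec d A v i\<bar> \<le> (\<Sum>j<d. \<bar>A i j * v j\<bar>)" using that by (simp add: mat_vec_def sum_abs)
      also have "\<dots> \<le> (\<Sum>j<d. \<bar>A i j\<bar> * 1)"
      proof (rule sum_mono)
        fix j assume "j \<in> {..<d}"
        then have "\<bar>v j\<bar> \<le> 1"
          using v abs_coord_le_norm[of "emb d v" j] by (simp add: enorm_eq_norm_emb)
        then show "\<bar>A i j * v j\<bar> \<le> \<bar>A i j\<bar> * 1" unfolding abs_mult by (intro mult_left_mono) auto
      qed
      finally show ?thesis by simp
    qed
    then have "(\<Sum>i<d. \<bar>mat_vec d A v i\<bar>) \<le> (\<Sum>i<d. \<Sum>j<d. \<bar>A i j\<bar>)" by (intro sum_mono) simp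
    then show "enorm d (mat_vec d A v) \<le> (\<Sum>i<d. \<Sum>j<d. \<bar>A i j\<bar>)"
      unfolding enorm_def using L2_set_le_sum_abs order_trans by blast
  qed
  show ?thesis
  proof (cases "enorm d w = 0")
    case True
    then have e: "emb d w = 0" by (simp add: enorm_eq_norm_emb)
    have "w j = 0" if "j < d" for j
      using coord_emb[of d w j] that unfolding e by simp
    then have "mat_vec d A w i = 0" if "i < d" for i using that by (simp add: mat_vec_def)
    then have "enorm d (mat_vec d A w) = 0" by (simp add: enorm_def L2_set_def)
    then show ?thesis using True by simp
  next
    case False
    define n where "n = enorm d w"
    have n: "0 < n" using False by (simp add: n_def enorm_eq_norm_emb)
    define v where "v = (\<lambda>i\<in>{..<d}. w i / n)"
    have scale: "enorm d (\<lambda>i. c * f i) = \<bar>c\<bar> * enorm d f" for c f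
    proof -
      have "emb d (\<lambda>i. c * f i) = c *\<^sub>R emb d f" by (rule l2_eqI) simp
      then show ?thesis by (simp add: enorm_eq_norm_emb)
    qed
    have cong: "enorm d f = enorm d f'" if "\<And>i. i < d \<Longrightarrow> f i = f' i" for f f'
      unfolding enorm_eq_norm_emb using emb_eqI[of d f f'] that by simp
    have "enorm d v = enorm d (\<lambda>i. (1 / n) * w i)" by (rule cong) (simp add: v_def)
    also have "\<dots> = 1" unfolding scale using n by (simp add: n_def[symmetric])
    finally have "v \<in> {v \<in> Rn d. enorm d v \<le> 1}" by (auto simp: v_def Rn_def)
    then have "enorm d (mat_vec d A v) \<le> op_norm d A"
      unfolding op_norm_def by (intro cSUP_upper bdd)
    moreover have "enorm d (mat_vec d A w) = enorm d (\<lambda>i. n * mat_vec d A v i)"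
      by (rule cong) (use n in \<open>simp add: mat_vec_def v_def sum_distrib_left\<close>)
    ultimately show ?thesis unfolding scale n_def[symmetric] using n by (simp add: mult.commute)
  qed
qed

lemma hessian_bilinear:
  "(\<Sum>i<d. (\<Sum>j<d. A j i * coord e j) * coord w i) = (\<Sum>j<d. coord e j * mat_vec d A (res d w) j)"
proof -
  have "(\<Sum>i<d. (\<Sum>j<d. A j i * coord e j) * coord w i) = (\<Sum>j<d. \<Sum>i<d. A j i * coord e j * coord w i)"
    unfolding sum_distrib_right by (rule sum.swap)
  also have "\<dots> = (\<Sum>j<d. coord e j * mat_vec d A (res d w) j)"
    by (intro sum.cong refl) (simp add: mat_vec_def res_def sum_distrib_left mult_ac)
  finally show ?thesis .
qed

lemma C2_hessian_bounded:
  assumes C2: "C2_on_Rn d V" and "0 \<le> \<beta>"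
    and loewner: "\<And>x. x \<in> Rn d \<Longrightarrow> loewner_le d (scaled_id (- \<beta>)) (hessian V x) \<and>
      loewner_le d (hessian V x) (scaled_id \<beta>)"
  shows "hessian_bounded d (\<lambda>y. V (res d y)) (\<lambda>i y. partial i V (res d y)) (\<lambda>j i y. hessian V (res d y) j i) \<beta>"
proof
  show "has_partials d (\<lambda>y. V (res d y)) (\<lambda>i y. partial i V (res d y))"
    using C2 by (intro C1_on_Rn_has_partials) (simp add: C2_on_Rn_def)
  show "has_partials d (\<lambda>y. partial i V (res d y)) (\<lambda>j y. hessian V (res d y) j i)" if "i < d" for i
    unfolding hessian_def using C2 that by (intro C1_on_Rn_has_partials) (simp add: C2_on_Rn_def)
  fix y w
  have id: "(\<Sum>i<d. v i * mat_vec d (scaled_id b) v i) = b * (\<Sum>i<d. (v i)\<^sup>2)" for b v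
  proof -
    have "mat_vec d (scaled_id b) v i = b * v i" if "i < d" for i
      using that by (simp add: mat_vec_def scaled_id_def if_distrib[of "\<lambda>c. c * _"] cong: if_cong)
    then show ?thesis by (simp add: sum_distrib_left power2_eq_square mult_ac)
  qed
  define Q where "Q = (\<Sum>i<d. res d w i * mat_vec d (hessian V (res d y)) (res d w) i)"
  define n where "n = (\<Sum>i<d. (res d w i)\<^sup>2)"
  have "\<bar>Q\<bar> \<le> \<beta> * n"
    using loewner[OF res_in_Rn, of y] res_in_Rn[of d w] id[of "res d w"]
    unfolding loewner_le_def Q_def n_def abs_le_iff by force
  also have "n \<le> (norm w)\<^sup>2"
    using sum_coord_le_norm[of "{..<d}" w] by (simp add: n_def res_def)
  finally have "\<bar>Q\<bar> \<le> \<beta> * (norm w)\<^sup>2" using \<open>0 \<le> \<beta>\<close> by (simp add: mult_left_mono)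
  moreover have "(\<Sum>i<d. (\<Sum>j<d. hessian V (res d y) j i * coord w j) * coord w i) = Q"
    unfolding hessian_bilinear Q_def by (intro sum.cong refl) (simp add: res_def)
  ultimately show "\<bar>\<Sum>i<d. (\<Sum>j<d. hessian V (res d y) j i * coord w j) * coord w i\<bar> \<le> \<beta> * (norm w)\<^sup>2"
    by simp
qed

text \<open>The form is the inner product of \<open>e\<close> with the Hessian difference applied to
  \<open>w\<close>, so Cauchy-Schwarz applies. This is the assumption of
  \<open>G_second_difference\<close>.\<close>

lemma hessian_lipschitz_bilinear:
  assumes "0 \<le> b"
    and op: "\<And>x y. x \<in> Rn d \<Longrightarrow> y \<in> Rn d \<Longrightarrow> op_norm d (\<lambda>i j. hessian V x i j - hessian V y i j) \<le> b * edist d x y"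
  shows "\<bar>\<Sum>i<d. (\<Sum>j<d. (hessian V (res d y) j i - hessian V (res d y') j i) * coord e j) * coord w i\<bar>
    \<le> b * norm (y - y') * norm e * norm w"
proof -
  define A where "A i j = hessian V (res d y) i j - hessian V (res d y') i j" for i j
  define m where "m = emb d (mat_vec d A (res d w))"
  have "norm m \<le> op_norm d A * enorm d (res d w)"
    unfolding m_def enorm_eq_norm_emb[symmetric] by (rule enorm_mat_vec_le[OF res_in_Rn])
  also have "\<dots> \<le> (b * norm (y - y')) * norm w"
  proof (rule mult_mono)
    have "op_norm d A \<le> b * edist d (res d y) (res d y')"
      unfolding A_def by (rule op[OF res_in_Rn res_in_Rn])
    also have "edist d (res d y) (res d y') \<le> norm (y - y')"
    proof -
      have "emb d (coord y) - emb d (coord y') = emb d (coord (y - y'))" by (rule l2_eqI) simp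
      then show ?thesis using norm_emb_coord_le[of d "y - y'"] by (simp add: edist_eq_norm_emb emb_res)
    qed
    finally show "op_norm d A \<le> b * norm (y - y')" using \<open>0 \<le> b\<close> by (simp add: mult_left_mono)
    show "enorm d (res d w) \<le> norm w" by (simp add: enorm_eq_norm_emb emb_res norm_emb_coord_le)
  qed (use \<open>0 \<le> b\<close> in \<open>auto simp: enorm_eq_norm_emb\<close>)
  finally have m: "norm m \<le> b * norm (y - y') * norm w" .
  have "(\<Sum>i<d. (\<Sum>j<d. A j i * coord e j) * coord w i) = inner m e"
    unfolding hessian_bilinear m_def inner_emb by (simp add: mult.commute)
  then have "\<bar>\<Sum>i<d. (\<Sum>j<d. A j i * coord e j) * coord w i\<bar> \<le> norm m * norm e"
    by (simp add: Cauchy_Schwarz_ineq2)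
  also have "\<dots> \<le> b * norm (y - y') * norm w * norm e" by (rule mult_right_mono[OF m]) simp
  finally show ?thesis by (simp add: A_def mult_ac)
qed

section \<open>The kernel as an image of Gaussian noise\<close>

locale oho = short_time \<beta> h for \<beta> h :: real +
  fixes d :: nat and V :: "(nat \<Rightarrow> real) \<Rightarrow> real" and \<gamma> :: real
  assumes C2: "C2_on_Rn d V" and gamma_pos: "0 < \<gamma>" and friction: "h * \<gamma> \<le> 1"
    and loewner: "\<And>x. x \<in> Rn d \<Longrightarrow> loewner_le d (scaled_id (- \<beta>)) (hessian V x) \<and>
      loewner_le d (hessian V x) (scaled_id \<beta>)"
begin

sublocale hess: hessian_bounded d "\<lambda>y. V (res d y)" "\<lambda>i y. partial i V (res d y)"
    "\<lambda>j i y. hessian V (res d y) j i" \<beta>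
  by (rule C2_hessian_bounded[OF C2 beta_nonneg loewner])

sublocale newton_flow \<beta> h hess.G
  by standard (rule hess.G_lipschitz)

text \<open>The dynamics is run on the whole sequence space. It commutes with this projection, which
  keeps trajectories and retargeted momenta of embedded vectors among the embedded vectors.\<close>

definition proj :: "l2 \<Rightarrow> l2" where
  "proj y = emb d (coord y)"

lemma proj_emb [simp]: "proj (emb d x) = emb d x"
  by (rule l2_eqI) (simp add: proj_def)

lemma proj_linear: "proj (x + y) = proj x + proj y" "proj (x - y) = proj x - proj y" "proj (c *\<^sub>R x) = c *\<^sub>R proj x"
  by (rule l2_eqI, simp add: proj_def)+

lemma bounded_linear_proj: "bounded_linear proj"
  by (rule bounded_linear_intro[where K = 1]) (auto simp: proj_linear, simp add: proj_def norm_emb_coord_le)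

lemma newton_proj: "newton hess.G (\<lambda>t. proj (pos x p t)) (\<lambda>t. proj (mom x p t))"
  unfolding newton_def
proof (intro allI conjI)
  fix t
  show "((\<lambda>t. proj (pos x p t)) has_vector_derivative proj (mom x p t)) (at t)"
    by (rule bounded_linear.has_vector_derivative[OF bounded_linear_proj pos_deriv])
  have "((\<lambda>t. proj (mom x p t)) has_vector_derivative proj (- hess.G (pos x p t))) (at t)"
    by (rule bounded_linear.has_vector_derivative[OF bounded_linear_proj mom_deriv])
  moreover have "res d (proj y) = res d y" for y by (auto simp: res_def proj_def)
  then have "proj (- hess.G y) = - hess.G (proj y)" for y
    by (intro l2_eqI) (simp add: proj_def hess.G_def)
  ultimately show "((\<lambda>t. proj (mom x p t)) has_vector_derivative - hess.G (proj (pos x p t))) (at t)"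
    by simp
qed

lemma pos_proj: "proj (pos x p h) = pos (proj x) (proj p) h"
  using newton_eq_flow(1)[OF newton_proj] by simp

text \<open>The projected momentum reaches the same endpoint, so uniqueness in the shooting problem
  identifies the two.\<close>

lemma proj_retarget:
  assumes "proj x' = x'" "proj x = x" "proj p = p"
  shows "proj (retarget x' x p) = retarget x' x p"
proof -
  have "pos x' (proj (retarget x' x p)) h = proj (pos x' (retarget x' x p) h)"
    using pos_proj[of x' "retarget x' x p"] assms by simp
  also have "\<dots> = pos x p h" using pos_proj[of x p] assms by (simp add: pos_retarget)
  finally show ?thesis using shooting[of x' "pos x p h"] pos_retarget[of x' x p] by blast
qed

text \<open>The definite description requires a unique state at time \<open>h\<close>: every
  coordinate trajectory embeds into a solution of the Newton equation, whose state at
  \<open>h\<close> is determined by its initial data.\<close>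

lemma ham_flow_eq:
  assumes "x \<in> Rn d" "p \<in> Rn d"
  shows "ham_flow d V h (x, p) = (res d (pos (emb d x) (emb d p) h), res d (mom (emb d x) (emb d p) h))"
  unfolding ham_flow_def
proof (rule the_equality)
  define X where "X t = res d (pos (emb d x) (emb d p) t)" for t
  define P where "P t = res d (mom (emb d x) (emb d p) t)" for t
  have "ham_trajectory d V X P"
    unfolding ham_trajectory_def
  proof (intro allI conjI impI)
    fix t i assume i: "i < d"
    show "((\<lambda>s. X s i) has_real_derivative P t i) (at t)"
      unfolding has_real_derivative_iff_has_vector_derivative
      using bounded_linear.has_vector_derivative[OF bounded_linear_coord pos_deriv] i
      by (simp add: X_def P_def res_def)
    show "((\<lambda>s. P s i) has_real_derivative - partial i V (X t)) (at t)"
      unfolding has_real_derivative_iff_has_vector_derivative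
      using bounded_linear.has_vector_derivative[OF bounded_linear_coord[of i] mom_deriv[of "emb d x" "emb d p" t]] i
      by (simp add: X_def P_def res_def[of d "mom _ _ _"] hess.G_def)
  qed (simp_all add: X_def P_def res_in_Rn)
  moreover have "X 0 = x" "P 0 = p" using assms by (simp_all add: X_def P_def res_emb)
  ultimately show "\<exists>X P. ham_trajectory d V X P \<and> (X 0, P 0) = (x, p) \<and>
      (X h, P h) = (res d (pos (emb d x) (emb d p) h), res d (mom (emb d x) (emb d p) h))"
    by (intro exI[of _ X] exI[of _ P]) (simp add: X_def P_def)
next
  fix w assume "\<exists>X P. ham_trajectory d V X P \<and> (X 0, P 0) = (x, p) \<and> (X h, P h) = w"
  then obtain X P where T: "ham_trajectory d V X P" and init: "X 0 = x" "P 0 = p" and w: "w = (X h, P h)"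
    by auto
  have emb_deriv: "((\<lambda>t. emb d (f t)) has_vector_derivative emb d f') (at t)"
    if "\<And>i. i < d \<Longrightarrow> ((\<lambda>s. f s i) has_real_derivative f' i) (at t)" for f f' t
    unfolding emb_eq_sum
    by (intro has_vector_derivative_sum has_vector_derivative_scaleR[THEN has_vector_derivative_eq_rhs]
        has_vector_derivative_const that) (auto intro: that)
  have "newton hess.G (\<lambda>t. emb d (X t)) (\<lambda>t. emb d (P t))"
    unfolding newton_def
  proof (intro allI conjI)
    fix t
    show "((\<lambda>t. emb d (X t)) has_vector_derivative emb d (P t)) (at t)"
      using T by (intro emb_deriv) (auto simp: ham_trajectory_def)
    have "((\<lambda>t. emb d (P t)) has_vector_derivative emb d (\<lambda>i. - partial i V (X t))) (at t)"
      using T by (intro emb_deriv) (auto simp: ham_trajectory_def)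
    moreover have "res d (emb d (X t)) = X t" using T by (intro res_emb) (simp add: ham_trajectory_def)
    then have "emb d (\<lambda>i. - partial i V (X t)) = - hess.G (emb d (X t))"
      by (intro l2_eqI) (simp add: hess.G_def)
    ultimately show "((\<lambda>t. emb d (P t)) has_vector_derivative - hess.G (emb d (X t))) (at t)" by simp
  qed
  note E = newton_eq_flow[OF this]
  have "X h \<in> Rn d" "P h \<in> Rn d" using T by (auto simp: ham_trajectory_def)
  then show "w = (res d (pos (emb d x) (emb d p) h), res d (mom (emb d x) (emb d p) h))"
    using E init w by (metis res_emb)
qed

definition decay :: real where "decay = exp (- \<gamma> * h / 2)"
definition noise :: real where "noise = sqrt (1 - exp (- \<gamma> * h))"

lemma decay_bounds: "0 < decay" "decay \<le> 1"
  using gamma_pos h_pos by (auto simp: decay_def)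

text \<open>The lower bound on the noise variance is where the factor \<gamma> h in the denominators
  of the theorem comes from.\<close>

lemma noise_pos: "0 < noise" and noise_square: "\<gamma> * h / 2 \<le> noise\<^sup>2"
proof -
  define t where "t = \<gamma> * h"
  have t: "0 < t" "t \<le> 1" using gamma_pos h_pos friction by (auto simp: t_def mult.commute)
  have "exp (- t) \<le> 1 - t / 2"
  proof -
    \<comment> \<open>The product is 1 + (t - t^2) / 2, and t lies between 0 and 1.\<close>
    have "1 \<le> (1 - t / 2) * (1 + t)"
      using t mult_left_le[of t t] by (simp add: algebra_simps)
    also have "\<dots> \<le> (1 - t / 2) * exp t"
      using t exp_ge_add_one_self[of t] by (intro mult_left_mono) auto
    finally show ?thesis by (simp add: exp_minus field_simps)
  qed
  then have "t / 2 \<le> 1 - exp (- t)" by simp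
  then show "0 < noise" "\<gamma> * h / 2 \<le> noise\<^sup>2" using t by (auto simp: noise_def t_def)
qed

definition kick :: "(nat \<Rightarrow> real) \<Rightarrow> l2 \<Rightarrow> l2" where
  "kick p y = decay *\<^sub>R emb d p + noise *\<^sub>R y"

lemma OHO_update_eq:
  assumes "x \<in> Rn d"
  shows "OHO_update d V \<gamma> h (x, p) (\<xi>1, \<xi>2) =
    (res d (pos (emb d x) (kick p (emb d \<xi>1)) h),
     \<lambda>i\<in>{..<d}. decay * coord (mom (emb d x) (kick p (emb d \<xi>1)) h) i + noise * \<xi>2 i)"
proof -
  have O: "O_step d \<gamma> h p \<xi> = (\<lambda>i\<in>{..<d}. decay * p i + noise * \<xi> i)" for p \<xi>
    by (simp add: O_step_def decay_def noise_def)
  have "O_step d \<gamma> h p \<xi>1 \<in> Rn d" by (auto simp: O Rn_def)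
  moreover have "emb d (O_step d \<gamma> h p \<xi>1) = kick p (emb d \<xi>1)"
    by (rule l2_eqI) (simp add: O kick_def)
  ultimately have "ham_flow d V h (x, O_step d \<gamma> h p \<xi>1)
      = (res d (pos (emb d x) (kick p (emb d \<xi>1)) h), res d (mom (emb d x) (kick p (emb d \<xi>1)) h))"
    using ham_flow_eq[OF assms] by simp
  then show ?thesis by (auto simp: OHO_update_def O res_def fun_eq_iff)
qed

lemma continuous_pos: "continuous_on UNIV (\<lambda>y. pos x (kick p y) h)"
  and continuous_mom: "continuous_on UNIV (\<lambda>y. mom x (kick p y) h)"
proof -
  have kick: "continuous_on UNIV (kick p)" unfolding kick_def by (intro continuous_intros)
  have "norm (pos x p h - pos x p' h) \<le> 2 * h * norm (p - p')" for p p'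
    by (rule pos_lipschitz_mom) (use h_pos in simp)
  from lipschitz_continuous_on[OF this, of UNIV]
  show "continuous_on UNIV (\<lambda>y. pos x (kick p y) h)"
    by (rule continuous_on_compose2[OF _ kick]) simp
  from lipschitz_continuous_on[OF mom_lipschitz_mom, of UNIV]
  show "continuous_on UNIV (\<lambda>y. mom x (kick p y) h)"
    by (rule continuous_on_compose2[OF _ kick]) simp
qed

lemma measurable_OHO_update:
  assumes "x \<in> Rn d"
  shows "OHO_update d V \<gamma> h (x, p) \<in> measurable (std_gaussian d \<Otimes>\<^sub>M std_gaussian d) (Rn_borel d \<Otimes>\<^sub>M Rn_borel d)"
proof -
  have 1: "(\<lambda>z. \<lambda>i\<in>{..<d}. coord (pos (emb d x) (kick p (emb d (fst z))) h) i)
      \<in> measurable (std_gaussian d \<Otimes>\<^sub>M std_gaussian d) (Rn_borel d)"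
    unfolding Rn_borel_def by (intro measurable_restrict measurable_compose[OF measurable_fst measurable_coord_comp_emb[OF continuous_pos]])
  have 2: "(\<lambda>z. \<lambda>i\<in>{..<d}. decay * coord (mom (emb d x) (kick p (emb d (fst z))) h) i + noise * snd z i)
      \<in> measurable (std_gaussian d \<Otimes>\<^sub>M std_gaussian d) (Rn_borel d)"
    unfolding Rn_borel_def
    by (intro measurable_restrict borel_measurable_add borel_measurable_times borel_measurable_const
        measurable_compose[OF measurable_fst measurable_coord_comp_emb[OF continuous_mom]]
        measurable_compose[OF measurable_snd measurable_proj]) auto
  have "OHO_update d V \<gamma> h (x, p) = (\<lambda>z. (\<lambda>i\<in>{..<d}. coord (pos (emb d x) (kick p (emb d (fst z))) h) i,
      \<lambda>i\<in>{..<d}. decay * coord (mom (emb d x) (kick p (emb d (fst z))) h) i + noise * snd z i))"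
    by (rule ext, case_tac z) (simp add: OHO_update_eq[OF assms] res_def)
  then show ?thesis using measurable_Pair[OF 1 2] by simp
qed

text \<open>One step from (x0, p0) is rewritten as a step from (x0', p0') driven by perturbed
  noises, which makes both kernels images of Gaussians under the same update. The Lipschitz constant
  \<open>L\<close> stays a parameter, since the two assertions of the theorem use different
  ones.\<close>

lemma renyi_div_OHO_le:
  assumes x0: "x0 \<in> Rn d" and x0': "x0' \<in> Rn d" and q: "1 < q"
    and L: "0 \<le> L" "L \<le> 1/4" "(q - 1) * L \<le> 1/4"
    and lipR: "\<And>p r. norm ((retarget (emb d x0') (emb d x0) p - p) - (retarget (emb d x0') (emb d x0) r - r)) \<le> L * norm (p - r)"
  shows "renyi_div q (OHO d V \<gamma> h (x0, p0)) (OHO d V \<gamma> h (x0', p0'))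
    \<le> ereal (q * (17 * (edist d x0' x0)\<^sup>2 / (\<gamma> * h ^ 3) + 2 * (edist d p0' p0)\<^sup>2 / (\<gamma> * h) + 7 * real d * L\<^sup>2))"
proof -
  define x where "x = emb d x0"
  define x' where "x' = emb d x0'"
  define R where "R = retarget x' x"
  define X where "X = edist d x0' x0"
  define Y where "Y = edist d p0' p0"
  have X: "norm (x' - x) = X" "0 \<le> X" by (simp_all add: X_def x_def x'_def edist_eq_norm_emb)
  have Y: "norm (emb d p0' - emb d p0) = Y" "0 \<le> Y" by (simp_all add: Y_def edist_eq_norm_emb)
  \<comment> \<open>Solves kick p0' (y + v y) = R (kick p0 y); the next definition solves for the
    second noise that compensates the gap between the final momenta.\<close>
  define v where "v y = (1 / noise) *\<^sub>R (R (kick p0 y) - decay *\<^sub>R emb d p0') - y" for y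
  define u where "u y = (decay / noise) *\<^sub>R (mom x (kick p0 y) h - mom x' (R (kick p0 y)) h)" for y
  \<comment> \<open>From \<open>retarget_speed\<close> and \<open>retarget_final_speed\<close>, with
    \<open>decay\<close> bounded by 1.\<close>
  define a where "a = (2 * X / h + Y) / noise"
  define b where "b = 3 * X / h / noise"
  have v_diff: "v y - v z = (1 / noise) *\<^sub>R ((R (kick p0 y) - kick p0 y) - (R (kick p0 z) - kick p0 z))" for y z
    using noise_pos by (simp add: v_def kick_def algebra_simps)
  have kick_diff: "kick p0 y - kick p0 z = noise *\<^sub>R (y - z)" for y z
    by (simp add: kick_def algebra_simps)
  have v_lip: "norm (v y - v z) \<le> L * norm (y - z)" for y z
  proof -
    have "norm (v y - v z) \<le> (1 / noise) * (L * norm (kick p0 y - kick p0 z))"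
      unfolding v_diff norm_scaleR using noise_pos lipR[of "kick p0 y" "kick p0 z"]
      by (simp add: R_def x_def x'_def divide_right_mono)
    also have "\<dots> = L * norm (y - z)" using noise_pos by (simp add: kick_diff)
    finally show ?thesis .
  qed
  define D where "D i y = lim (\<lambda>n. real n * (coord (v (y + (1 / real n) *\<^sub>R unit_vec i)) i - coord (v y) i))" for i y
  interpret shift: lipschitz_shift d v L D
  proof
    fix i y
    let ?Q = "\<lambda>n. real n * (coord (v (y + (1 / real n) *\<^sub>R unit_vec i)) i - coord (v y) i)"
    define \<rho> where "\<rho> n = real n *\<^sub>R (R (kick p0 y + (1 / real n) *\<^sub>R (noise *\<^sub>R unit_vec i)) - R (kick p0 y))" for n
    have "convergent \<rho>"
      unfolding \<rho>_def R_def by (rule retarget_quotients_convergent[OF hess.G_quotients_uniform])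
    then obtain r where "\<rho> \<longlonglongrightarrow> r" by (auto simp: convergent_def)
    \<comment> \<open>The - 1 is the derivative of the term - y in \<open>v\<close>, and the factor
      \<open>noise\<close> in the direction comes from \<open>kick\<close>.\<close>
    then have "(\<lambda>n. (1 / noise) * coord (\<rho> n) i - 1) \<longlonglongrightarrow> (1 / noise) * coord r i - 1"
      by (intro tendsto_intros bounded_linear.tendsto[OF bounded_linear_coord])
    moreover have "\<forall>\<^sub>F n in sequentially. (1 / noise) * coord (\<rho> n) i - 1
        = ?Q n"
    proof (rule eventually_sequentiallyI[of 1])
      fix n :: nat assume n: "1 \<le> n"
      have k: "kick p0 (y + (1 / real n) *\<^sub>R unit_vec i) = kick p0 y + (1 / real n) *\<^sub>R (noise *\<^sub>R unit_vec i)"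
        by (simp add: kick_def algebra_simps)
      have "v (y + (1 / real n) *\<^sub>R unit_vec i) - v y
          = (1 / noise) *\<^sub>R (R (kick p0 y + (1 / real n) *\<^sub>R (noise *\<^sub>R unit_vec i)) - R (kick p0 y)) - (1 / real n) *\<^sub>R unit_vec i"
        by (simp add: v_def k algebra_simps)
      then have "real n *\<^sub>R (v (y + (1 / real n) *\<^sub>R unit_vec i) - v y) = (1 / noise) *\<^sub>R \<rho> n - unit_vec i"
        using n by (simp add: \<rho>_def scaleR_diff_right)
      then have "coord (real n *\<^sub>R (v (y + (1 / real n) *\<^sub>R unit_vec i) - v y)) i = coord ((1 / noise) *\<^sub>R \<rho> n - unit_vec i) i"
        by simp
      then show "(1 / noise) * coord (\<rho> n) i - 1 = ?Q n"
        by simp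
    qed
    ultimately have l: "(\<lambda>n. ?Q n) \<longlonglongrightarrow> (1 / noise) * coord r i - 1"
      by (rule Lim_transform_eventually)
    show "(\<lambda>n. ?Q n) \<longlonglongrightarrow> D i y"
      unfolding D_def limI[OF l] by (rule l)
  qed (use v_lip L in auto)
  have va: "norm (v y) \<le> a" for y
  proof -
    have "v y = (1 / noise) *\<^sub>R ((R (kick p0 y) - kick p0 y) - decay *\<^sub>R (emb d p0' - emb d p0))"
      using noise_pos by (simp add: v_def kick_def algebra_simps)
    then have "norm (v y) = (1 / noise) * norm ((R (kick p0 y) - kick p0 y) - decay *\<^sub>R (emb d p0' - emb d p0))"
      using noise_pos by simp
    also have "\<dots> \<le> (1 / noise) * (2 * X / h + Y)"
    proof (rule mult_left_mono)
      have "norm ((R (kick p0 y) - kick p0 y) - decay *\<^sub>R (emb d p0' - emb d p0))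
          \<le> norm (R (kick p0 y) - kick p0 y) + decay * Y"
        using norm_triangle_ineq4[of "R (kick p0 y) - kick p0 y" "decay *\<^sub>R (emb d p0' - emb d p0)"] decay_bounds
        by (simp add: Y)
      also have "\<dots> \<le> 2 * X / h + 1 * Y"
        using retarget_speed[of x' x "kick p0 y"] decay_bounds Y(2) by (intro add_mono mult_right_mono) (auto simp: R_def X)
      finally show "norm ((R (kick p0 y) - kick p0 y) - decay *\<^sub>R (emb d p0' - emb d p0)) \<le> 2 * X / h + Y" by simp
    qed (use noise_pos in simp)
    finally show ?thesis by (simp add: a_def)
  qed
  have ub: "norm (u y) \<le> b" for y
  proof -
    have "norm (u y) = (decay / noise) * norm (mom x (kick p0 y) h - mom x' (R (kick p0 y)) h)"
      using noise_pos decay_bounds by (simp add: u_def)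
    also have "\<dots> \<le> (1 / noise) * (3 * X / h)"
      using retarget_final_speed[of x "kick p0 y" x'] noise_pos decay_bounds
      by (intro mult_mono divide_right_mono) (auto simp: R_def X)
    finally show ?thesis by (simp add: b_def mult.commute)
  qed
  have "continuous_on UNIV u"
  proof -
    have "norm (R p - R r) \<le> (1 + L) * norm (p - r)" for p r
    proof -
      have "R p - R r = (p - r) + ((R p - p) - (R r - r))" by simp
      then have "norm (R p - R r) \<le> norm (p - r) + norm ((R p - p) - (R r - r))" by (metis norm_triangle_ineq)
      then show ?thesis using lipR[of p r] by (simp add: R_def x_def x'_def algebra_simps)
    qed
    then have "continuous_on UNIV R" by (rule lipschitz_continuous_on)
    moreover have "continuous_on UNIV (kick p0)" unfolding kick_def by (intro continuous_intros)
    ultimately have "continuous_on UNIV (\<lambda>y. R (kick p0 y))"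
      by (rule continuous_on_compose2) simp
    then have "continuous_on UNIV (\<lambda>y. mom x' (R (kick p0 y)) h)"
      by (rule continuous_on_compose2[OF lipschitz_continuous_on[OF mom_lipschitz_mom, of UNIV]]) simp
    then show ?thesis unfolding u_def by (intro continuous_intros continuous_mom)
  qed
  note bound = shift.renyi_div_gaussian_map_le[OF q L(3) this va ub measurable_OHO_update[OF x0', of p0']]
  have "OHO_update d V \<gamma> h (x0, p0) z = OHO_update d V \<gamma> h (x0', p0') (gaussian_map d v u z)" for z
  proof -
    obtain \<xi>1 \<xi>2 where z: "z = (\<xi>1, \<xi>2)" by (cases z)
    define P where "P = kick p0 (emb d \<xi>1)"
    define \<eta>1 where "\<eta>1 = (\<lambda>i\<in>{..<d}. \<xi>1 i + coord (v (emb d \<xi>1)) i)"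
    \<comment> \<open>Since \<open>v\<close> at an embedded vector is again embedded, restricting
      the shifted noise to d coordinates loses nothing.\<close>
    have "proj P = P" by (simp add: P_def kick_def proj_linear)
    then have "proj (R P) = R P" unfolding R_def by (intro proj_retarget) (simp_all add: x_def x'_def)
    then have "proj (v (emb d \<xi>1)) = v (emb d \<xi>1)"
      by (simp add: v_def proj_linear P_def[symmetric])
    moreover have "emb d \<eta>1 = emb d \<xi>1 + proj (v (emb d \<xi>1))"
      by (rule l2_eqI) (simp add: \<eta>1_def proj_def)
    moreover have "v (emb d \<xi>1) = (1 / noise) *\<^sub>R (R P - decay *\<^sub>R emb d p0') - emb d \<xi>1"
      by (simp add: v_def P_def)
    ultimately have "emb d \<eta>1 = (1 / noise) *\<^sub>R (R P - decay *\<^sub>R emb d p0')" by simp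
    then have k: "kick p0' (emb d \<eta>1) = R P"
      using noise_pos by (simp add: kick_def)
    define \<eta>2 where "\<eta>2 = (\<lambda>i\<in>{..<d}. \<xi>2 i + coord (u (emb d \<xi>1)) i)"
    have source: "OHO_update d V \<gamma> h (x0, p0) z
        = (res d (pos x P h), \<lambda>i\<in>{..<d}. decay * coord (mom x P h) i + noise * \<xi>2 i)"
      by (simp only: z OHO_update_eq[OF x0] x_def P_def)
    have shifted: "gaussian_map d v u z = (\<eta>1, \<eta>2)"
      by (simp only: z gaussian_map_def prod.case \<eta>1_def \<eta>2_def)
    have target: "OHO_update d V \<gamma> h (x0', p0') (\<eta>1, \<eta>2)
        = (res d (pos x' (R P) h), \<lambda>i\<in>{..<d}. decay * coord (mom x' (R P) h) i + noise * \<eta>2 i)"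
      by (simp only: OHO_update_eq[OF x0'] k x'_def)
    have "pos x' (R P) h = pos x P h" by (simp only: R_def pos_retarget)
    moreover have "(\<lambda>i\<in>{..<d}. decay * coord (mom x P h) i + noise * \<xi>2 i)
        = (\<lambda>i\<in>{..<d}. decay * coord (mom x' (R P) h) i + noise * \<eta>2 i)"
    proof (rule restrict_ext)
      fix i assume "i \<in> {..<d}"
      then have "noise * \<eta>2 i = noise * \<xi>2 i + decay * (coord (mom x P h) i - coord (mom x' (R P) h) i)"
        using noise_pos by (simp add: \<eta>2_def u_def P_def[symmetric] distrib_left)
      then show "decay * coord (mom x P h) i + noise * \<xi>2 i = decay * coord (mom x' (R P) h) i + noise * \<eta>2 i"
        by (simp add: right_diff_distrib)
    qed
    ultimately show ?thesis unfolding source shifted target by simp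
  qed
  then have "OHO d V \<gamma> h (x0, p0) = distr (std_gaussian d \<Otimes>\<^sub>M std_gaussian d) (Rn_borel d \<Otimes>\<^sub>M Rn_borel d)
      (\<lambda>z. OHO_update d V \<gamma> h (x0', p0') (gaussian_map d v u z))"
    unfolding OHO_def by (intro arg_cong[where f = "distr _ _"] ext)
  with bound have "renyi_div q (OHO d V \<gamma> h (x0, p0)) (OHO d V \<gamma> h (x0', p0'))
      \<le> ereal (q * ((a\<^sup>2 + b\<^sup>2) / 2 + 7 * real d * L\<^sup>2))"
    by (simp add: OHO_def)
  also have "\<dots> \<le> ereal (q * (17 * X\<^sup>2 / (\<gamma> * h ^ 3) + 2 * Y\<^sup>2 / (\<gamma> * h) + 7 * real d * L\<^sup>2))"
  proof -
    define S where "S = X / h"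
    have ab: "a = (2 * S + Y) / noise" "b = 3 * S / noise" by (simp_all add: a_def b_def S_def)
    have "a\<^sup>2 + b\<^sup>2 = ((2 * S + Y)\<^sup>2 + (3 * S)\<^sup>2) / noise\<^sup>2"
      by (simp only: ab power_divide) (simp only: add_divide_distrib)
    \<comment> \<open>The left numerator is 13 S^2 + 4 S Y + Y^2, and 4 S Y is at most 4 S^2 + Y^2.
      The factor 2 from the noise bound later cancels the 1/2 in front of the squares.\<close>
    also have "\<dots> \<le> (17 * S\<^sup>2 + 2 * Y\<^sup>2) / noise\<^sup>2"
      using zero_le_power2[of "2 * S - Y"]
      by (intro divide_right_mono) (simp_all add: power2_eq_square algebra_simps)
    also have "\<dots> \<le> (17 * S\<^sup>2 + 2 * Y\<^sup>2) / (\<gamma> * h / 2)"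
      using noise_square noise_pos gamma_pos h_pos by (intro divide_left_mono) auto
    also have "\<dots> = 2 * (17 * X\<^sup>2 / (\<gamma> * h ^ 3) + 2 * Y\<^sup>2 / (\<gamma> * h))"
      using gamma_pos h_pos by (simp add: S_def power2_eq_square power3_eq_cube field_simps)
    finally show ?thesis using q by (intro ereal_less_eq(3)[THEN iffD2] mult_left_mono) auto
  qed
  finally show ?thesis by (simp add: X_def Y_def)
qed

end

section \<open>Choice of constants and assembly\<close>

lemma oho_setting:
  assumes "0 \<le> \<beta>" "0 < \<gamma>" "1 < q" "0 < h" "C2_on_Rn d V"
    and loewner: "\<And>x. x \<in> Rn d \<Longrightarrow> loewner_le d (scaled_id (- \<beta>)) (hessian V x) \<and>
      loewner_le d (hessian V x) (scaled_id \<beta>)"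
    and small: "h * (sqrt \<beta> * sqrt q) \<le> 1/4" "h * \<gamma> \<le> 1/4"
  shows "oho \<beta> h d V \<gamma>" "q * (\<beta> * h\<^sup>2) \<le> 1/16" "\<beta> * h\<^sup>2 \<le> 1/16"
proof -
  have eq: "(h * (sqrt \<beta> * sqrt q))\<^sup>2 = q * (\<beta> * h\<^sup>2)"
    using assms by (simp add: power_mult_distrib mult_ac)
  \<comment> \<open>Squaring the threshold 1/4 gives q \<beta> h^2 \<le> 1/16, just what makes L = 4
    \<beta> h^2 satisfy L \<le> 1/4 and (q - 1) L \<le> 1/4.\<close>
  have "(h * (sqrt \<beta> * sqrt q))\<^sup>2 \<le> (1/4)\<^sup>2"
    using assms by (intro power_mono small) auto
  then show 1: "q * (\<beta> * h\<^sup>2) \<le> 1/16" unfolding eq by (simp add: power2_eq_square)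
  have "1 * (\<beta> * h\<^sup>2) \<le> q * (\<beta> * h\<^sup>2)" using assms by (intro mult_right_mono) auto
  with 1 show 2: "\<beta> * h\<^sup>2 \<le> 1/16" by simp
  show "oho \<beta> h d V \<gamma>"
    by standard (use assms 2 in auto)
qed

lemma renyi_div_OHO_le_dimension:
  assumes "0 \<le> \<beta>" "0 < \<gamma>" and q: "1 < q" and "0 < h" "C2_on_Rn d V"
    and "\<And>x. x \<in> Rn d \<Longrightarrow> loewner_le d (scaled_id (- \<beta>)) (hessian V x) \<and>
      loewner_le d (hessian V x) (scaled_id \<beta>)"
    and "h * (sqrt \<beta> * sqrt q) \<le> 1/4" "h * \<gamma> \<le> 1/4"
    and x0: "x0 \<in> Rn d" "x0' \<in> Rn d"
  shows "renyi_div q (OHO d V \<gamma> h (x0, p0)) (OHO d V \<gamma> h (x0', p0'))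
    \<le> ereal (252 * (q * (edist d x0' x0)\<^sup>2 / (\<gamma> * h ^ 3) + q * (edist d p0' p0)\<^sup>2 / (\<gamma> * h)
      + \<beta>\<^sup>2 * real d * h ^ 4 * q))"
proof -
  note S = oho_setting[OF assms(1-8)]
  interpret oho \<beta> h d V \<gamma> by (rule S(1))
  have L: "0 \<le> 4 * \<beta> * h\<^sup>2" "4 * \<beta> * h\<^sup>2 \<le> 1/4" "(q - 1) * (4 * \<beta> * h\<^sup>2) \<le> 1/4"
    using S(2,3) mult_nonneg_nonneg[OF \<open>0 \<le> \<beta>\<close> zero_le_power2[of h]] by (simp_all add: algebra_simps)
  define A where "A = (edist d x0' x0)\<^sup>2 / (\<gamma> * h ^ 3)"
  define B where "B = (edist d p0' p0)\<^sup>2 / (\<gamma> * h)"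
  have AB: "0 \<le> A" "0 \<le> B" using assms by (auto simp: A_def B_def)
  have "renyi_div q (OHO d V \<gamma> h (x0, p0)) (OHO d V \<gamma> h (x0', p0'))
      \<le> ereal (q * (17 * (edist d x0' x0)\<^sup>2 / (\<gamma> * h ^ 3) + 2 * (edist d p0' p0)\<^sup>2 / (\<gamma> * h) + 7 * real d * (4 * \<beta> * h\<^sup>2)\<^sup>2))"
    by (rule renyi_div_OHO_le[OF x0 q L retarget_lipschitz])
  \<comment> \<open>112 is 7 times the square of the 4 in the Lipschitz constant.\<close>
  also have "\<dots> = ereal (q * (17 * A + 2 * B + 112 * (\<beta>\<^sup>2 * real d * h ^ 4)))"
    by (simp add: A_def B_def power2_eq_square power4_eq_xxxx mult_ac)
  also have "\<dots> \<le> ereal (q * (252 * A + 252 * B + 252 * (\<beta>\<^sup>2 * real d * h ^ 4)))"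
    using q AB by (intro ereal_less_eq(3)[THEN iffD2] mult_left_mono add_mono mult_right_mono) auto
  finally show ?thesis by (simp add: A_def B_def algebra_simps)
qed

lemma renyi_div_OHO_le_hessian_lipschitz:
  assumes "0 \<le> \<beta>" "0 < \<gamma>" and q: "1 < q" and "0 < h" "C2_on_Rn d V"
    and "\<And>x. x \<in> Rn d \<Longrightarrow> loewner_le d (scaled_id (- \<beta>)) (hessian V x) \<and>
      loewner_le d (hessian V x) (scaled_id \<beta>)"
    and "h * (sqrt \<beta> * sqrt q) \<le> 1/4" "h * \<gamma> \<le> 1/4"
    and b: "0 \<le> b" and op: "\<And>x y. x \<in> Rn d \<Longrightarrow> y \<in> Rn d \<Longrightarrow>
      op_norm d (\<lambda>i j. hessian V x i j - hessian V y i j) \<le> b * edist d x y"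
    and x0: "x0 \<in> Rn d" "x0' \<in> Rn d"
  shows "renyi_div q (OHO d V \<gamma> h (x0, p0)) (OHO d V \<gamma> h (x0', p0'))
    \<le> ereal (252 * (q * (edist d x0' x0)\<^sup>2 * (1 / (\<gamma> * h ^ 3) + b\<^sup>2 * h ^ 4 * real d)
      + q * (edist d p0' p0)\<^sup>2 / (\<gamma> * h)))"
proof -
  note S = oho_setting[OF assms(1-8)]
  interpret oho \<beta> h d V \<gamma> by (rule S(1))
  let ?R = "retarget (emb d x0') (emb d x0)"
  define X where "X = edist d x0' x0"
  have X: "norm (emb d x0' - emb d x0) = X" "0 \<le> X" by (simp_all add: X_def edist_eq_norm_emb)
  define L2 where "L2 = 6 * b * h\<^sup>2 * X"
  \<comment> \<open>The first entry keeps the smallness conditions true for arbitrarily distant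
    starting points; the second makes the dimensional term proportional to the squared
    distance.\<close>
  define L where "L = min (4 * \<beta> * h\<^sup>2) L2"
  have L2: "0 \<le> L2" using b X by (simp add: L2_def)
  have L4: "L \<le> 4 * \<beta> * h\<^sup>2" by (simp add: L_def)
  have L: "0 \<le> L" "L \<le> 1/4" using S(3) \<open>0 \<le> \<beta>\<close> L2 by (auto simp: L_def min_def)
  have "(q - 1) * L \<le> (q - 1) * (4 * \<beta> * h\<^sup>2)" using q L4 by (intro mult_left_mono) auto
  also have "\<dots> \<le> 1/4" using S(2) mult_nonneg_nonneg[OF \<open>0 \<le> \<beta>\<close> zero_le_power2[of h]] by (simp add: algebra_simps)
  finally have qL: "(q - 1) * L \<le> 1/4" .
  have "norm ((?R p - p) - (?R r - r)) \<le> L2 * norm (p - r)" for p r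
    using retarget_lipschitz_second_order[OF hess.G_second_difference[OF hessian_lipschitz_bilinear[OF b op]] b,
        of "emb d x0'" "emb d x0" p r]
    by (simp add: L2_def X)
  then have lip: "norm ((?R p - p) - (?R r - r)) \<le> L * norm (p - r)" for p r
    using retarget_lipschitz[of "emb d x0'" "emb d x0" p r] by (simp add: L_def min_def)
  have LL: "L\<^sup>2 \<le> 36 * (b\<^sup>2 * h ^ 4 * X\<^sup>2)"
  proof -
    have "L\<^sup>2 \<le> L2\<^sup>2" using L by (intro power_mono) (auto simp: L_def)
    then show ?thesis by (simp add: L2_def power2_eq_square power4_eq_xxxx mult_ac)
  qed
  define A where "A = X\<^sup>2 / (\<gamma> * h ^ 3)"
  define B where "B = (edist d p0' p0)\<^sup>2 / (\<gamma> * h)"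
  have AB: "0 \<le> A" "0 \<le> B" using assms by (auto simp: A_def B_def)
  have "renyi_div q (OHO d V \<gamma> h (x0, p0)) (OHO d V \<gamma> h (x0', p0'))
      \<le> ereal (q * (17 * (edist d x0' x0)\<^sup>2 / (\<gamma> * h ^ 3) + 2 * (edist d p0' p0)\<^sup>2 / (\<gamma> * h) + 7 * real d * L\<^sup>2))"
    by (rule renyi_div_OHO_le[OF x0 q L qL lip])
  also have "\<dots> \<le> ereal (q * (17 * A + 2 * B + 7 * real d * (36 * (b\<^sup>2 * h ^ 4 * X\<^sup>2))))"
    using q LL by (intro ereal_less_eq(3)[THEN iffD2] mult_left_mono add_mono) (auto simp: A_def B_def X_def)
  also have "\<dots> \<le> ereal (q * (252 * A + 252 * B + 7 * real d * (36 * (b\<^sup>2 * h ^ 4 * X\<^sup>2))))"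
    using q AB by (intro ereal_less_eq(3)[THEN iffD2] mult_left_mono add_mono mult_right_mono) auto
  also have "q * (252 * A + 252 * B + 7 * real d * (36 * (b\<^sup>2 * h ^ 4 * X\<^sup>2)))
      = 252 * (q * X\<^sup>2 * (1 / (\<gamma> * h ^ 3) + b\<^sup>2 * h ^ 4 * real d) + q * (edist d p0' p0)\<^sup>2 / (\<gamma> * h))"
    by (simp add: A_def B_def algebra_simps)
  finally show ?thesis by (simp add: X_def)
qed

text \<open>The seventh power of the step-size condition reads h^7 b^2 \<gamma> d \<le> K^7; three
  of the powers of h and \<gamma> go to the other side.\<close>

lemma powr_small_step:
  fixes h b \<gamma> K :: real
  assumes "0 < h" "0 \<le> b" "0 < \<gamma>" "0 < d" "h * (b powr (2/7) * \<gamma> powr (1/7) * real d powr (1/7)) \<le> K"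
  shows "b\<^sup>2 * h ^ 4 * real d \<le> K ^ 7 / (\<gamma> * h ^ 3)"
proof -
  have pw: "(x powr (k / 7)) ^ 7 = x powr k" if "0 \<le> x" for x k :: real
  proof -
    have "(x powr (k / 7)) ^ 7 = (x powr (k / 7)) powr 7" by (simp add: powr_numeral)
    also have "\<dots> = x powr (k / 7 * 7)" by (rule powr_powr)
    finally show ?thesis by simp
  qed
  have "(h * (b powr (2/7) * \<gamma> powr (1/7) * real d powr (1/7))) ^ 7 \<le> K ^ 7"
    using assms by (intro power_mono) auto
  also have "(h * (b powr (2/7) * \<gamma> powr (1/7) * real d powr (1/7))) ^ 7 = h ^ 7 * (b\<^sup>2 * \<gamma> * real d)"
    using assms by (simp add: power_mult_distrib pw)
  also have "h ^ 7 = h ^ 4 * h ^ 3" by (simp flip: power_add)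
  finally show ?thesis using assms by (simp add: field_simps)
qed

theorem theorem5p9:
  shows "\<exists>c>0. \<exists>C>0. \<forall>K>0. \<exists>C'>0.
    \<forall>(d::nat) (V :: (nat \<Rightarrow> real) \<Rightarrow> real) (\<beta>::real) (\<gamma>::real) (q::real) (h::real).
      0 < d \<longrightarrow> 0 \<le> \<beta> \<longrightarrow> 0 < \<gamma> \<longrightarrow> 1 < q \<longrightarrow> 0 < h \<longrightarrow>
      C2_on_Rn d V \<longrightarrow>
      (\<forall>x\<in>Rn d. loewner_le d (scaled_id (- \<beta>)) (hessian V x) \<and>
                loewner_le d (hessian V x) (scaled_id \<beta>)) \<longrightarrow>
      h * (sqrt \<beta> * sqrt q) \<le> c \<longrightarrow> h * \<gamma> \<le> c \<longrightarrow>
      (\<forall>x0\<in>Rn d. \<forall>x0'\<in>Rn d. \<forall>p0\<in>Rn d. \<forall>p0'\<in>Rn d.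
         renyi_div q (OHO d V \<gamma> h (x0, p0)) (OHO d V \<gamma> h (x0', p0'))
         \<le> ereal (C * (q * (edist d x0' x0)\<^sup>2 / (\<gamma> * h ^ 3) + q * (edist d p0' p0)\<^sup>2 / (\<gamma> * h)
                      + \<beta>\<^sup>2 * real d * h ^ 4 * q))) \<and>
      (\<forall>\<beta>H::real. 0 \<le> \<beta>H \<longrightarrow>
        (\<forall>x\<in>Rn d. \<forall>y\<in>Rn d.
           op_norm d (\<lambda>i j. hessian V x i j - hessian V y i j) \<le> \<beta>H * edist d x y) \<longrightarrow>
        (\<forall>x0\<in>Rn d. \<forall>x0'\<in>Rn d. \<forall>p0\<in>Rn d. \<forall>p0'\<in>Rn d.
           renyi_div q (OHO d V \<gamma> h (x0, p0)) (OHO d V \<gamma> h (x0', p0'))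
           \<le> ereal (C * (q * (edist d x0' x0)\<^sup>2 * (1 / (\<gamma> * h ^ 3) + \<beta>H\<^sup>2 * h ^ 4 * real d)
                        + q * (edist d p0' p0)\<^sup>2 / (\<gamma> * h)))) \<and>
        (h * (\<beta>H powr (2/7) * \<gamma> powr (1/7) * real d powr (1/7)) \<le> K \<longrightarrow>
          (\<forall>x0\<in>Rn d. \<forall>x0'\<in>Rn d. \<forall>p0\<in>Rn d. \<forall>p0'\<in>Rn d.
             renyi_div q (OHO d V \<gamma> h (x0, p0)) (OHO d V \<gamma> h (x0', p0'))
             \<le> ereal (C' * (q * (edist d x0 x0')\<^sup>2 / (\<gamma> * h ^ 3)
                           + q * (edist d p0' p0)\<^sup>2 / (\<gamma> * h))))))"
\<comment> \<open>252 is 7 * 36, where 36 is the square of the 6 in the second-order Lipschitz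
  constant, and it dominates 17, 2 and 112. The last constant depends on \<open>K\<close> through
  \<open>powr_small_step\<close>.\<close>
proof (rule exI[of _ "1/4"], intro conjI, simp, rule exI[of _ 252], intro conjI, simp, intro allI impI,
    rule_tac x = "252 * (1 + K ^ 7)" in exI, intro conjI, simp add: add_pos_nonneg, intro allI impI conjI)
  fix K :: real and d :: nat and V :: "(nat \<Rightarrow> real) \<Rightarrow> real" and \<beta> \<gamma> q h :: real
  assume K: "0 < K" and d: "0 < d"
    and A: "0 \<le> \<beta>" "0 < \<gamma>" "1 < q" "0 < h" "C2_on_Rn d V"
    and loewner: "\<forall>x\<in>Rn d. loewner_le d (scaled_id (- \<beta>)) (hessian V x) \<and>
                loewner_le d (hessian V x) (scaled_id \<beta>)"
    and small: "h * (sqrt \<beta> * sqrt q) \<le> 1/4" "h * \<gamma> \<le> 1/4"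
  show "\<forall>x0\<in>Rn d. \<forall>x0'\<in>Rn d. \<forall>p0\<in>Rn d. \<forall>p0'\<in>Rn d.
         renyi_div q (OHO d V \<gamma> h (x0, p0)) (OHO d V \<gamma> h (x0', p0'))
         \<le> ereal (252 * (q * (edist d x0' x0)\<^sup>2 / (\<gamma> * h ^ 3) + q * (edist d p0' p0)\<^sup>2 / (\<gamma> * h)
                      + \<beta>\<^sup>2 * real d * h ^ 4 * q))"
    by (intro ballI renyi_div_OHO_le_dimension[OF A _ small]) (use loewner in auto)
  fix b :: real
  assume b: "0 \<le> b" and op: "\<forall>x\<in>Rn d. \<forall>y\<in>Rn d.
           op_norm d (\<lambda>i j. hessian V x i j - hessian V y i j) \<le> b * edist d x y"
  have second: "renyi_div q (OHO d V \<gamma> h (x0, p0)) (OHO d V \<gamma> h (x0', p0'))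
           \<le> ereal (252 * (q * (edist d x0' x0)\<^sup>2 * (1 / (\<gamma> * h ^ 3) + b\<^sup>2 * h ^ 4 * real d)
                        + q * (edist d p0' p0)\<^sup>2 / (\<gamma> * h)))" if "x0 \<in> Rn d" "x0' \<in> Rn d" for x0 x0' p0 p0'
    by (rule renyi_div_OHO_le_hessian_lipschitz[OF A _ small b _ that]) (use loewner op in auto)
  show "\<forall>x0\<in>Rn d. \<forall>x0'\<in>Rn d. \<forall>p0\<in>Rn d. \<forall>p0'\<in>Rn d.
           renyi_div q (OHO d V \<gamma> h (x0, p0)) (OHO d V \<gamma> h (x0', p0'))
           \<le> ereal (252 * (q * (edist d x0' x0)\<^sup>2 * (1 / (\<gamma> * h ^ 3) + b\<^sup>2 * h ^ 4 * real d)
                        + q * (edist d p0' p0)\<^sup>2 / (\<gamma> * h)))"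
    by (intro ballI second)
  assume "h * (b powr (2/7) * \<gamma> powr (1/7) * real d powr (1/7)) \<le> K"
  from powr_small_step[OF A(4) b A(2) d this]
  have bK: "b\<^sup>2 * h ^ 4 * real d \<le> K ^ 7 / (\<gamma> * h ^ 3)" .
  show "\<forall>x0\<in>Rn d. \<forall>x0'\<in>Rn d. \<forall>p0\<in>Rn d. \<forall>p0'\<in>Rn d.
             renyi_div q (OHO d V \<gamma> h (x0, p0)) (OHO d V \<gamma> h (x0', p0'))
             \<le> ereal (252 * (1 + K ^ 7) * (q * (edist d x0 x0')\<^sup>2 / (\<gamma> * h ^ 3)
                           + q * (edist d p0' p0)\<^sup>2 / (\<gamma> * h)))"
  proof (intro ballI)
    fix x0 x0' p0 p0' assume x: "x0 \<in> Rn d" "x0' \<in> Rn d" and p: "p0 \<in> Rn d" "p0' \<in> Rn d"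
    define X where "X = q * (edist d x0' x0)\<^sup>2"
    define B where "B = q * (edist d p0' p0)\<^sup>2 / (\<gamma> * h)"
    have nn: "0 \<le> X" "0 \<le> B" using A by (auto simp: X_def B_def)
    have sym: "edist d x0 x0' = edist d x0' x0" by (simp add: edist_eq_norm_emb norm_minus_commute)
    note second[OF x, of p0 p0']
    also have "252 * (q * (edist d x0' x0)\<^sup>2 * (1 / (\<gamma> * h ^ 3) + b\<^sup>2 * h ^ 4 * real d) + q * (edist d p0' p0)\<^sup>2 / (\<gamma> * h))
        \<le> 252 * (X * (1 / (\<gamma> * h ^ 3) + K ^ 7 / (\<gamma> * h ^ 3)) + (1 + K ^ 7) * B)"
    proof -
      have X_le: "X * (1 / (\<gamma> * h ^ 3) + b\<^sup>2 * h ^ 4 * real d) \<le> X * (1 / (\<gamma> * h ^ 3) + K ^ 7 / (\<gamma> * h ^ 3))"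
        using nn bK by (intro mult_left_mono add_left_mono)
      \<comment> \<open>The momentum term is enlarged as well, so that 1 + K^7 becomes a common
        factor.\<close>
      have "1 * B \<le> (1 + K ^ 7) * B" using nn K by (intro mult_right_mono) auto
      then have B_le: "B \<le> (1 + K ^ 7) * B" by simp
      show ?thesis unfolding X_def[symmetric] B_def[symmetric]
        by (rule mult_left_mono[OF add_mono[OF X_le B_le]]) simp
    qed
    also have "252 * (X * (1 / (\<gamma> * h ^ 3) + K ^ 7 / (\<gamma> * h ^ 3)) + (1 + K ^ 7) * B)
        = 252 * (1 + K ^ 7) * (X / (\<gamma> * h ^ 3) + B)"
      by (simp add: add_divide_distrib algebra_simps)
    finally show "renyi_div q (OHO d V \<gamma> h (x0, p0)) (OHO d V \<gamma> h (x0', p0'))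
        \<le> ereal (252 * (1 + K ^ 7) * (q * (edist d x0 x0')\<^sup>2 / (\<gamma> * h ^ 3)
            + q * (edist d p0' p0)\<^sup>2 / (\<gamma> * h)))"
      unfolding X_def B_def sym by simp
  qed
qed

end
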